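(* For each $\lambda\in\mathbb C$ and each integer $n\ge5$, the $*$-algebra $\mathcal Q_{n,\lambda}( * )$ is not of type I, i.e. it has a factor-representation which is not of type I.
   Context: $\mathcal Q_{n,\lambda}( * )=\mathbb C\langle q_1,\dots,q_n,q_1^*,\dots,q_n^*,e\mid\sum_{k=1}^nq_k=\lambda e,\ q_k^2=q_k,\ k=1,\dots,n\rangle$ is the unital $*$-algebra generated by $n$ idempotents with sum $\lambda e$ and their adjoints. Representations here are unital $*$-homomorphisms $\pi:\mathcal Q_{n,\lambda}( * )\to B(H)$, $H$ a complex separable Hilbert space. $\pi$ is a factor-representation if the von Neumann algebra $\pi(\mathcal Q_{n,\lambda}( * ))''$ is a factor, and it is of type I if this factor is of type I. *)

theory Defs
  imports
    "HOL-Library.Countable_Set"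
    "HOL-Algebra.QuotRing"
    "HOL-Algebra.Module"
    "HOL-Algebra.Algebraic_Closure_Type"
begin

section \<open>Complex *-algebras\<close>

record 'a star_algebra = "(complex, 'a) module" +
  invol :: "'a \<Rightarrow> 'a"

definition star_hom :: "'a star_algebra \<Rightarrow> 'b star_algebra \<Rightarrow> ('a \<Rightarrow> 'b) set" where
  "star_hom A B = {h \<in> ring_hom A B.
     (\<forall>c. \<forall>a \<in> carrier A. h (c \<odot>\<^bsub>A\<^esub> a) = c \<odot>\<^bsub>B\<^esub> h a) \<and>
     (\<forall>a \<in> carrier A. h (invol A a) = invol B (h a))}"

text \<open>The quotient by a two-sided ideal that is closed under the involution. The ring part is
  the library's \<^const>\<open>FactRing\<close>; scalars and involution act on representatives.\<close>

definition star_quotient :: "'a star_algebra \<Rightarrow> 'a set \<Rightarrow> 'a set star_algebra" where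
  "star_quotient A I =
    \<lparr>carrier = carrier (A Quot I),
     monoid.mult = monoid.mult (A Quot I),
     monoid.one = monoid.one (A Quot I),
     ring.zero = ring.zero (A Quot I),
     ring.add = ring.add (A Quot I),
     module.smult = (\<lambda>c S. \<Union>x\<in>S. I +>\<^bsub>A\<^esub> (c \<odot>\<^bsub>A\<^esub> x)),
     invol = (\<lambda>S. \<Union>x\<in>S. I +>\<^bsub>A\<^esub> invol A x)\<rparr>"


section \<open>The *-algebra generated by n idempotents with sum lam e and their adjoints\<close>

text \<open>\<open>Gen k\<close> and \<open>Adj k\<close> are the letters for $q_k$ and $q_k^*$. The empty word is the unit $e$.\<close>

datatype letter = Gen nat | Adj nat

fun letter_adj :: "letter \<Rightarrow> letter" where
  "letter_adj (Gen k) = Adj k"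
| "letter_adj (Adj k) = Gen k"

definition word_adj :: "letter list \<Rightarrow> letter list" where
  "word_adj w = rev (map letter_adj w)"

text \<open>The free unital *-algebra on $q_1,\dots,q_n$: an element is its family of coefficients, a
  finitely supported function on words.\<close>

definition free_star_algebra :: "nat \<Rightarrow> (letter list \<Rightarrow> complex) star_algebra" where
  "free_star_algebra n =
    \<lparr>carrier = {f. finite {w. f w \<noteq> 0} \<and> {w. f w \<noteq> 0} \<subseteq> lists (Gen ` {1..n} \<union> Adj ` {1..n})},
     monoid.mult = (\<lambda>f g w. \<Sum>i\<le>length w. f (take i w) * g (drop i w)),
     monoid.one = (\<lambda>w. if w = [] then 1 else 0),
     ring.zero = (\<lambda>w. 0),
     ring.add = (\<lambda>f g w. f w + g w),
     module.smult = (\<lambda>c f w. c * f w),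
     invol = (\<lambda>f w. cnj (f (word_adj w)))\<rparr>"

lemma split_sum_assoc:
  fixes f g h :: "'a list \<Rightarrow> complex"
  shows "(\<Sum>i\<le>length w. (\<Sum>j\<le>length (take i w). f (take j (take i w)) * g (drop j (take i w))) * h (drop i w)) =
     (\<Sum>i\<le>length w. f (take i w) * (\<Sum>j\<le>length (drop i w). g (take j (drop i w)) * h (drop j (drop i w))))"
proof -
  have "(\<Sum>i\<le>length w. (\<Sum>j\<le>length (take i w). f (take j (take i w)) * g (drop j (take i w))) * h (drop i w))
     = (\<Sum>i\<le>length w. \<Sum>j\<le>i. f (take j w) * g (drop j (take i w)) * h (drop i w))"
    by (intro sum.cong refl) (simp add: sum_distrib_right min_def)
  also have "\<dots> = (\<Sum>(i,j)\<in>Sigma {..length w} (\<lambda>i. {..i}). f (take j w) * g (drop j (take i w)) * h (drop i w))"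
    by (simp add: sum.Sigma)
  also have "\<dots> = (\<Sum>(j,k)\<in>Sigma {..length w} (\<lambda>j. {..length w - j}). f (take j w) * (g (take k (drop j w)) * h (drop k (drop j w))))"
    by (rule sum.reindex_bij_witness[of _ "\<lambda>(j,k). (j+k,j)" "\<lambda>(i,j). (j, i-j)"])
       (auto simp: drop_take mult.assoc add.commute)
  also have "\<dots> = (\<Sum>j\<le>length w. \<Sum>k\<le>length w - j. f (take j w) * (g (take k (drop j w)) * h (drop k (drop j w))))"
    by (rule sum.Sigma[symmetric]) simp_all
  also have "\<dots> = (\<Sum>i\<le>length w. f (take i w) * (\<Sum>j\<le>length (drop i w). g (take j (drop i w)) * h (drop j (drop i w))))"
    by (simp add: sum_distrib_left)
  finally show ?thesis .
qed

lemma free_mult_closed: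
  assumes "f \<in> carrier (free_star_algebra n)" "g \<in> carrier (free_star_algebra n)"
  shows "f \<otimes>\<^bsub>free_star_algebra n\<^esub> g \<in> carrier (free_star_algebra n)"
proof -
  let ?A = "{w. f w \<noteq> 0}" and ?B = "{w. g w \<noteq> 0}"
  let ?W = "lists (Gen ` {1..n} \<union> Adj ` {1..n})"
  have A: "finite ?A" "?A \<subseteq> ?W" "finite ?B" "?B \<subseteq> ?W"
    using assms by (auto simp: free_star_algebra_def)
  have sub: "{w. (\<Sum>i\<le>length w. f (take i w) * g (drop i w)) \<noteq> 0} \<subseteq> (\<lambda>(u,v). u @ v) ` (?A \<times> ?B)"
  proof
    fix w assume "w \<in> {w. (\<Sum>i\<le>length w. f (take i w) * g (drop i w)) \<noteq> 0}"
    then have "(\<Sum>i\<le>length w. f (take i w) * g (drop i w)) \<noteq> 0" by simp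
    then obtain i where "f (take i w) * g (drop i w) \<noteq> 0"
      by (rule sum.not_neutral_contains_not_neutral)
    then show "w \<in> (\<lambda>(u,v). u @ v) ` (?A \<times> ?B)"
      by (intro image_eqI[of _ _ "(take i w, drop i w)"]) auto
  qed
  have "(\<lambda>(u,v). u @ v) ` (?A \<times> ?B) \<subseteq> ?W"
  proof
    fix w assume "w \<in> (\<lambda>(u,v). u @ v) ` (?A \<times> ?B)"
    then obtain u v where w: "w = u @ v" and "u \<in> ?A" "v \<in> ?B" by (elim imageE SigmaE) simp
    then have "u \<in> ?W" "v \<in> ?W" using A by blast+
    then show "w \<in> ?W" by (simp only: w append_in_lists_conv)
  qed
  moreover have "finite ((\<lambda>(u,v). u @ v) ` (?A \<times> ?B))" using A by simp
  ultimately have "finite {w. (\<Sum>i\<le>length w. f (take i w) * g (drop i w)) \<noteq> 0}"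
      "{w. (\<Sum>i\<le>length w. f (take i w) * g (drop i w)) \<noteq> 0} \<subseteq> ?W"
    using sub by (blast intro: finite_subset)+
  then show ?thesis unfolding free_star_algebra_def by simp
qed

lemma free_add_closed:
  assumes "f \<in> carrier (free_star_algebra n)" "g \<in> carrier (free_star_algebra n)"
  shows "f \<oplus>\<^bsub>free_star_algebra n\<^esub> g \<in> carrier (free_star_algebra n)"
proof -
  let ?A = "{w. f w \<noteq> 0}" and ?B = "{w. g w \<noteq> 0}"
  let ?W = "lists (Gen ` {1..n} \<union> Adj ` {1..n})"
  have A: "finite (?A \<union> ?B)" "?A \<union> ?B \<subseteq> ?W"
    using assms by (simp_all add: free_star_algebra_def)
  have "{w. f w + g w \<noteq> 0} \<subseteq> ?A \<union> ?B" by auto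
  with A have "finite {w. f w + g w \<noteq> 0}" "{w. f w + g w \<noteq> 0} \<subseteq> ?W"
    by (blast intro: finite_subset)+
  then show ?thesis unfolding free_star_algebra_def by simp
qed

lemma ring_free_star_algebra: "ring (free_star_algebra n)"
proof (rule ringI)
  show "abelian_group (free_star_algebra n)"
  proof (rule abelian_groupI)
    fix f assume "f \<in> carrier (free_star_algebra n)"
    then show "\<exists>g\<in>carrier (free_star_algebra n). g \<oplus>\<^bsub>free_star_algebra n\<^esub> f = \<zero>\<^bsub>free_star_algebra n\<^esub>"
      by (intro bexI[of _ "\<lambda>w. - f w"]) (auto simp: free_star_algebra_def)
  qed (simp add: free_add_closed, auto simp: free_star_algebra_def)
next
  have one: "\<one>\<^bsub>free_star_algebra n\<^esub> \<in> carrier (free_star_algebra n)"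
    by (auto simp: free_star_algebra_def)
  show "Group.monoid (free_star_algebra n)"
  proof (rule monoidI)
    fix f assume "f \<in> carrier (free_star_algebra n)"
    show "\<one>\<^bsub>free_star_algebra n\<^esub> \<otimes>\<^bsub>free_star_algebra n\<^esub> f = f"
    proof
      fix w
      have "(\<Sum>i\<le>length w. (if take i w = [] then 1 else 0) * f (drop i w))
        = (\<Sum>i\<le>length w. if i = 0 then f w else 0)"
        by (intro sum.cong refl) auto
      then show "(\<one>\<^bsub>free_star_algebra n\<^esub> \<otimes>\<^bsub>free_star_algebra n\<^esub> f) w = f w"
        by (simp add: free_star_algebra_def)
    qed
    show "f \<otimes>\<^bsub>free_star_algebra n\<^esub> \<one>\<^bsub>free_star_algebra n\<^esub> = f"
    proof
      fix w
      have "(\<Sum>i\<le>length w. f (take i w) * (if drop i w = [] then 1 else 0))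
        = (\<Sum>i\<le>length w. if i = length w then f w else 0)"
        by (intro sum.cong refl) auto
      then show "(f \<otimes>\<^bsub>free_star_algebra n\<^esub> \<one>\<^bsub>free_star_algebra n\<^esub>) w = f w"
        by (simp add: free_star_algebra_def)
    qed
  next
    fix f g h
    show "f \<otimes>\<^bsub>free_star_algebra n\<^esub> g \<otimes>\<^bsub>free_star_algebra n\<^esub> h
      = f \<otimes>\<^bsub>free_star_algebra n\<^esub> (g \<otimes>\<^bsub>free_star_algebra n\<^esub> h)"
      using split_sum_assoc[where f = f and g = g and h = h] by (simp add: free_star_algebra_def)
  qed (use one free_mult_closed in auto)
qed (auto simp: free_star_algebra_def sum.distrib algebra_simps)

lemma word_adj_word_adj: "word_adj (word_adj w) = w"
proof -
  have "letter_adj (letter_adj l) = l" for l by (cases l) auto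
  then have "letter_adj \<circ> letter_adj = id" by (simp add: fun_eq_iff)
  then show ?thesis by (simp add: word_adj_def rev_map)
qed

lemma free_invol_mult:
  "invol (free_star_algebra n) (f \<otimes>\<^bsub>free_star_algebra n\<^esub> g) =
   invol (free_star_algebra n) g \<otimes>\<^bsub>free_star_algebra n\<^esub> invol (free_star_algebra n) f"
proof
  fix w
  have l: "length (word_adj w) = length w" for w by (simp add: word_adj_def)
  have t: "word_adj (take i w) = drop (length w - i) (word_adj w)"
       "word_adj (drop i w) = take (length w - i) (word_adj w)" if "i \<le> length w" for i
    using that by (simp_all add: word_adj_def take_rev drop_rev take_map drop_map)
  have "(\<Sum>i\<le>length w. f (take i (word_adj w)) * g (drop i (word_adj w)))
     = (\<Sum>i\<le>length w. g (word_adj (take i w)) * f (word_adj (drop i w)))"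
    by (rule sum.reindex_bij_witness[of _ "\<lambda>i. length w - i" "\<lambda>i. length w - i"])
       (auto simp: t)
  then show "invol (free_star_algebra n) (f \<otimes>\<^bsub>free_star_algebra n\<^esub> g) w =
   (invol (free_star_algebra n) g \<otimes>\<^bsub>free_star_algebra n\<^esub> invol (free_star_algebra n) f) w"
    by (simp add: free_star_algebra_def l flip: complex_cnj_mult cnj_sum)
qed

definition free_gen :: "nat \<Rightarrow> letter list \<Rightarrow> complex" where
  "free_gen k = (\<lambda>w. if w = [Gen k] then 1 else 0)"

definition Q_relators :: "nat \<Rightarrow> complex \<Rightarrow> (letter list \<Rightarrow> complex) set" where
  "Q_relators n lam = (let F = free_star_algebra n in
     insert ((\<Oplus>\<^bsub>F\<^esub> k \<in> {1..n}. free_gen k) \<ominus>\<^bsub>F\<^esub> lam \<odot>\<^bsub>F\<^esub> \<one>\<^bsub>F\<^esub>)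
       ((\<lambda>k. (free_gen k \<otimes>\<^bsub>F\<^esub> free_gen k) \<ominus>\<^bsub>F\<^esub> free_gen k) ` {1..n}))"

definition Q_ideal :: "nat \<Rightarrow> complex \<Rightarrow> (letter list \<Rightarrow> complex) set" where
  "Q_ideal n lam = genideal (free_star_algebra n)
     (Q_relators n lam \<union> invol (free_star_algebra n) ` Q_relators n lam)"

definition Q_star_algebra :: "nat \<Rightarrow> complex \<Rightarrow> (letter list \<Rightarrow> complex) set star_algebra" where
  "Q_star_algebra n lam = star_quotient (free_star_algebra n) (Q_ideal n lam)"


section \<open>Complex Hilbert spaces with explicit carrier\<close>

text \<open>The vector space structure is the library's \<^locale>\<open>module\<close> over the field of complex numbers;
  as there, the fields \<^const>\<open>mult\<close> and \<^const>\<open>one\<close> of the record play no role. The inner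
  product is linear in the first argument.\<close>

record 'h hilbert = "(complex, 'h) module" +
  cinner :: "'h \<Rightarrow> 'h \<Rightarrow> complex"

definition hnorm :: "'h hilbert \<Rightarrow> 'h \<Rightarrow> real" where
  "hnorm H x = sqrt (Re (cinner H x x))"

locale complex_hilbert_space =
  module "ring_of_type_algebra :: complex ring" H for H :: "'h hilbert" +
  assumes cinner_add_left: "\<lbrakk>x \<in> carrier H; y \<in> carrier H; z \<in> carrier H\<rbrakk> \<Longrightarrow>
      cinner H (x \<oplus>\<^bsub>H\<^esub> y) z = cinner H x z + cinner H y z"
    and cinner_smult_left: "\<lbrakk>x \<in> carrier H; y \<in> carrier H\<rbrakk> \<Longrightarrow>
      cinner H (c \<odot>\<^bsub>H\<^esub> x) y = c * cinner H x y"
    and cinner_commute: "\<lbrakk>x \<in> carrier H; y \<in> carrier H\<rbrakk> \<Longrightarrow> cinner H x y = cnj (cinner H y x)"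
    and cinner_nonneg: "x \<in> carrier H \<Longrightarrow> 0 \<le> Re (cinner H x x)"
    and cinner_definite: "\<lbrakk>x \<in> carrier H; cinner H x x = 0\<rbrakk> \<Longrightarrow> x = \<zero>\<^bsub>H\<^esub>"
    and complete: "\<lbrakk>\<And>i. s i \<in> carrier H;
      \<And>e. e > 0 \<Longrightarrow> \<exists>N. \<forall>i\<ge>N. \<forall>j\<ge>N. hnorm H (s i \<ominus>\<^bsub>H\<^esub> s j) < e\<rbrakk> \<Longrightarrow>
      \<exists>x \<in> carrier H. (\<lambda>i::nat. hnorm H (s i \<ominus>\<^bsub>H\<^esub> x)) \<longlonglongrightarrow> 0"

locale separable_hilbert_space = complex_hilbert_space +
  assumes separable: "\<exists>D. countable D \<and> D \<subseteq> carrier H \<and>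
      (\<forall>x \<in> carrier H. \<forall>e>0. \<exists>y \<in> D. hnorm H (x \<ominus>\<^bsub>H\<^esub> y) < e)"

text \<open>Bounded operators are taken to be \<^const>\<open>undefined\<close> outside the carrier, so that equality of
  operators is equality of functions.\<close>

definition bounded_op :: "'h hilbert \<Rightarrow> ('h \<Rightarrow> 'h) \<Rightarrow> bool" where
  "bounded_op H T \<longleftrightarrow> T \<in> carrier H \<rightarrow>\<^sub>E carrier H \<and>
     (\<forall>x \<in> carrier H. \<forall>y \<in> carrier H. T (x \<oplus>\<^bsub>H\<^esub> y) = T x \<oplus>\<^bsub>H\<^esub> T y) \<and>
     (\<forall>c. \<forall>x \<in> carrier H. T (c \<odot>\<^bsub>H\<^esub> x) = c \<odot>\<^bsub>H\<^esub> T x) \<and>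
     (\<exists>K. \<forall>x \<in> carrier H. hnorm H (T x) \<le> K * hnorm H x)"

definition op_adjoint :: "'h hilbert \<Rightarrow> ('h \<Rightarrow> 'h) \<Rightarrow> 'h \<Rightarrow> 'h" where
  "op_adjoint H T = (THE S. bounded_op H S \<and>
     (\<forall>x \<in> carrier H. \<forall>y \<in> carrier H. cinner H (T x) y = cinner H x (S y)))"

definition BH :: "'h hilbert \<Rightarrow> ('h \<Rightarrow> 'h) star_algebra" where
  "BH H =
    \<lparr>carrier = {T. bounded_op H T},
     monoid.mult = compose (carrier H),
     monoid.one = (\<lambda>x \<in> carrier H. x),
     ring.zero = (\<lambda>x \<in> carrier H. \<zero>\<^bsub>H\<^esub>),
     ring.add = (\<lambda>S T. \<lambda>x \<in> carrier H. S x \<oplus>\<^bsub>H\<^esub> T x),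
     module.smult = (\<lambda>c T. \<lambda>x \<in> carrier H. c \<odot>\<^bsub>H\<^esub> T x),
     invol = op_adjoint H\<rparr>"


section \<open>Von Neumann algebras, factors, type I\<close>

definition commutant :: "'h hilbert \<Rightarrow> ('h \<Rightarrow> 'h) set \<Rightarrow> ('h \<Rightarrow> 'h) set" where
  "commutant H S = {T \<in> carrier (BH H). \<forall>s \<in> S. T \<otimes>\<^bsub>BH H\<^esub> s = s \<otimes>\<^bsub>BH H\<^esub> T}"

definition von_neumann_algebra :: "'h hilbert \<Rightarrow> ('h \<Rightarrow> 'h) set \<Rightarrow> bool" where
  "von_neumann_algebra H M \<longleftrightarrow> M \<subseteq> carrier (BH H) \<and>
     (\<forall>T \<in> M. invol (BH H) T \<in> M) \<and> commutant H (commutant H M) = M"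

text \<open>The condition \<open>\<one> \<noteq> \<zero>\<close> excludes the zero Hilbert space.\<close>

definition factor_on :: "'h hilbert \<Rightarrow> ('h \<Rightarrow> 'h) set \<Rightarrow> bool" where
  "factor_on H M \<longleftrightarrow> von_neumann_algebra H M \<and> \<one>\<^bsub>BH H\<^esub> \<noteq> \<zero>\<^bsub>BH H\<^esub> \<and>
     M \<inter> commutant H M = {c \<odot>\<^bsub>BH H\<^esub> \<one>\<^bsub>BH H\<^esub> | c. True}"

definition projections :: "'h hilbert \<Rightarrow> ('h \<Rightarrow> 'h) set \<Rightarrow> ('h \<Rightarrow> 'h) set" where
  "projections H M = {p \<in> M. p \<otimes>\<^bsub>BH H\<^esub> p = p \<and> invol (BH H) p = p}"

definition abelian_projection :: "'h hilbert \<Rightarrow> ('h \<Rightarrow> 'h) set \<Rightarrow> ('h \<Rightarrow> 'h) \<Rightarrow> bool" where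
  "abelian_projection H M p \<longleftrightarrow> p \<in> projections H M \<and>
     (\<forall>a \<in> M. \<forall>b \<in> M.
        (p \<otimes>\<^bsub>BH H\<^esub> a \<otimes>\<^bsub>BH H\<^esub> p) \<otimes>\<^bsub>BH H\<^esub> (p \<otimes>\<^bsub>BH H\<^esub> b \<otimes>\<^bsub>BH H\<^esub> p) =
        (p \<otimes>\<^bsub>BH H\<^esub> b \<otimes>\<^bsub>BH H\<^esub> p) \<otimes>\<^bsub>BH H\<^esub> (p \<otimes>\<^bsub>BH H\<^esub> a \<otimes>\<^bsub>BH H\<^esub> p))"

text \<open>Every nonzero central projection \<open>z\<close> majorizes a nonzero abelian projection \<open>p\<close>;
  \<open>p \<le> z\<close> is written as \<open>z p = p\<close>.\<close>

definition type_I :: "'h hilbert \<Rightarrow> ('h \<Rightarrow> 'h) set \<Rightarrow> bool" where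
  "type_I H M \<longleftrightarrow>
     (\<forall>z \<in> projections H (M \<inter> commutant H M). z \<noteq> \<zero>\<^bsub>BH H\<^esub> \<longrightarrow>
        (\<exists>p. abelian_projection H M p \<and> p \<noteq> \<zero>\<^bsub>BH H\<^esub> \<and> z \<otimes>\<^bsub>BH H\<^esub> p = p))"


section \<open>Representations\<close>

definition generated_vna ::
    "'a star_algebra \<Rightarrow> 'h hilbert \<Rightarrow> ('a \<Rightarrow> 'h \<Rightarrow> 'h) \<Rightarrow> ('h \<Rightarrow> 'h) set" where
  "generated_vna A H \<pi> = commutant H (commutant H (\<pi> ` carrier A))"

definition star_representation ::
    "'a star_algebra \<Rightarrow> 'h hilbert \<Rightarrow> ('a \<Rightarrow> 'h \<Rightarrow> 'h) \<Rightarrow> bool" where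
  "star_representation A H \<pi> \<longleftrightarrow> separable_hilbert_space H \<and> \<pi> \<in> star_hom A (BH H)"

definition factor_representation ::
    "'a star_algebra \<Rightarrow> 'h hilbert \<Rightarrow> ('a \<Rightarrow> 'h \<Rightarrow> 'h) \<Rightarrow> bool" where
  "factor_representation A H \<pi> \<longleftrightarrow>
     star_representation A H \<pi> \<and> factor_on H (generated_vna A H \<pi>)"

definition type_I_representation ::
    "'a star_algebra \<Rightarrow> 'h hilbert \<Rightarrow> ('a \<Rightarrow> 'h \<Rightarrow> 'h) \<Rightarrow> bool" where
  "type_I_representation A H \<pi> \<longleftrightarrow> type_I H (generated_vna A H \<pi>)"

text \<open>A *-algebra is of type I if all its factor-representations are. A separable Hilbert space has
  at most continuum many elements, so up to unitary equivalence nothing is lost by letting the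
  carriers range over subsets of \<^typ>\<open>nat \<Rightarrow> complex\<close>.\<close>

definition type_I_star_algebra :: "'a star_algebra \<Rightarrow> bool" where
  "type_I_star_algebra A \<longleftrightarrow>
     (\<forall>(H :: (nat \<Rightarrow> complex) hilbert) \<pi>.
        factor_representation A H \<pi> \<longrightarrow> type_I_representation A H \<pi>)"

end

theory Submission
  imports Defs "HOL-Analysis.Infinite_Sum" "HOL-Analysis.L2_Norm" "HOL-Analysis.Topology_Euclidean_Space"
begin

text \<open>The factor will be \<open>B(K) \<otimes> R\<close>, where \<open>K\<close> is infinite-dimensional and \<open>R\<close> is the hyperfinite
  \<open>II\<^sub>1\<close> factor. An infinite-dimensional \<open>K\<close> is unavoidable: in a finite factor the trace
  restricts the scalars that are sums of idempotents, whereas here \<open>\<lambda>\<close> is arbitrary. The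
  algebra \<open>R\<close> acts in standard form on families indexed by finite bit strings. It is
  generated by left multiplications \<open>left_op j\<close> with Pauli matrices, one pair of
  anticommuting unitaries for each tensor factor, and the corresponding right
  multiplications \<open>right_op j\<close> commute with all of them.

  Idempotents with a prescribed sum. Relative to a decomposition of the space into two
  halves (leaves and hubs), an upper and a lower triangular idempotent with diagonal
  \<open>(1, 0)\<close> and \<open>(0, 1)\<close> have arbitrary corners. So two of the five idempotents absorb every
  off-diagonal part, and it remains to find three idempotents whose sum has the same scalar
  on both diagonal blocks (\<open>gens345_diagonal_blocks\<close>). Put \<open>\<kappa> = 2 \<lambda> - 5\<close>. Two of them are
  built on triples of two leaves and one hub, with diagonal sum \<open>1 - \<kappa>, 1 - \<kappa>, 1 + 2 \<kappa>\<close>; the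
  trace 3 of this diagonal is forced by the ranks one and two. The third one is built on
  pairs of one leaf and one hub, where its diagonal has trace 1 and equalizes the former.
  Infinitely many leaves and hubs can be arranged both in pairs and in triples with two
  leaves each: this is what makes the trace disappear and \<open>\<lambda>\<close> arbitrary.

  Generation. In these idempotents there is the freedom to put weights and unitaries at the
  hubs. Distinct weights in one of the two idempotents on triples produce the projections
  onto single hubs, their corners produce matrix units between all sectors, and the unitary
  \<open>left_op k\<close> placed at the hub \<open>k\<close> in the other one yields all left multiplications
  (\<open>left_op_in\<close>). On the other hand the right multiplications commute with everything
  (\<open>right_op_commutes_gens\<close>).

  Factor. A central operator commutes with the matrix units and with left and right
  multiplications, so it is diagonal and its entries are all equal (\<open>central_is_scalar\<close>).

  Not of type I. Let \<open>p\<close> be an abelian projection in the generated algebra and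
  \<open>h = p h \<noteq> 0\<close>. For the two left multiplications \<open>u\<close>, \<open>v\<close> in a far away tensor factor,
  \<open>u h\<close> and \<open>v h\<close> are close to \<open>r h\<close> and \<open>s h\<close>, with the right multiplications \<open>r\<close>, \<open>s\<close>,
  because \<open>h\<close> almost does not involve that tensor factor. Since \<open>p\<close> commutes with \<open>r\<close> and
  \<open>s\<close>, the vector \<open>p u p v h\<close> is close to \<open>s r h\<close> and \<open>p v p u h\<close> is close to
  \<open>r s h = - s r h\<close> (\<open>compressed_products_near\<close>). But the compressions of \<open>u\<close> and \<open>v\<close> by the
  abelian projection \<open>p\<close> commute, a contradiction (\<open>abelian_projection_zero\<close>).\<close>

section \<open>The Hilbert space of square-summable families\<close>

definition l2 :: "('i \<Rightarrow> complex) hilbert" where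
  "l2 = \<lparr>carrier = {f. (\<lambda>i. (cmod (f i))\<^sup>2) summable_on UNIV},
     monoid.mult = undefined, monoid.one = undefined,
     ring.zero = (\<lambda>i. 0), ring.add = (\<lambda>f g i. f i + g i),
     module.smult = (\<lambda>c f i. c * f i),
     cinner = (\<lambda>f g. \<Sum>\<^sub>\<infinity>i. f i * cnj (g i))\<rparr>"

lemma l2_simps [simp]:
  "\<zero>\<^bsub>l2\<^esub> = (\<lambda>i. 0)"
  "f \<oplus>\<^bsub>l2\<^esub> g = (\<lambda>i. f i + g i)"
  "c \<odot>\<^bsub>l2\<^esub> f = (\<lambda>i. c * f i)"
  by (simp_all add: l2_def)

lemma mem_l2: "f \<in> carrier l2 \<longleftrightarrow> (\<lambda>i. (cmod (f i))\<^sup>2) summable_on UNIV"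
  by (simp add: l2_def)

lemma cinner_l2: "cinner l2 f g = (\<Sum>\<^sub>\<infinity>i. f i * cnj (g i))"
  by (simp add: l2_def)

lemma hnorm_l2:
  assumes "f \<in> carrier l2"
  shows "hnorm l2 f = sqrt (\<Sum>\<^sub>\<infinity>i. (cmod (f i))\<^sup>2)"
proof -
  have "(\<Sum>\<^sub>\<infinity>i. f i * cnj (f i)) = (\<Sum>\<^sub>\<infinity>i. complex_of_real ((cmod (f i))\<^sup>2))"
    by (intro infsum_cong) (simp only: complex_norm_square)
  also have "\<dots> = complex_of_real (\<Sum>\<^sub>\<infinity>i. (cmod (f i))\<^sup>2)"
    using has_sum_of_real[OF has_sum_infsum[OF assms[unfolded mem_l2]]] infsumI by blast
  finally show ?thesis by (simp add: hnorm_def cinner_l2)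
qed

lemma L2_set_le_hnorm:
  assumes "f \<in> carrier l2"
  shows "L2_set (\<lambda>i. cmod (f i)) F \<le> hnorm l2 f"
proof (cases "finite F")
  case True
  then show ?thesis
    unfolding hnorm_l2[OF assms] L2_set_def
    using assms by (intro real_sqrt_le_mono finite_sum_le_infsum) (auto simp: mem_l2)
next
  case False
  then show ?thesis unfolding hnorm_l2[OF assms]
    by (simp add: infsum_nonneg)
qed

lemma hnorm_l2_nonneg [simp]: "f \<in> carrier l2 \<Longrightarrow> 0 \<le> hnorm l2 f"
  by (simp add: hnorm_l2 infsum_nonneg)

text \<open>Completeness, the existence of adjoints and the boundedness of operators are all obtained by
  bounding finite partial sums uniformly.\<close>

lemma l2_bounded_partial_sums:
  assumes "\<And>F. finite F \<Longrightarrow> L2_set (\<lambda>i. cmod (f i)) F \<le> C"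
  shows "f \<in> carrier l2" "hnorm l2 f \<le> C"
proof -
  have C: "0 \<le> C" using assms[of "{}"] by simp
  have le: "(\<Sum>i\<in>F. (cmod (f i))\<^sup>2) \<le> C\<^sup>2" if "finite F" for F
    using assms[OF that] C by (simp add: L2_set_def real_sqrt_le_iff sqrt_le_D)
  show f: "f \<in> carrier l2"
    unfolding mem_l2 by (intro nonneg_bdd_above_summable_on bdd_aboveI[of _ "C\<^sup>2"]) (auto simp: le)
  have "(\<Sum>\<^sub>\<infinity>i. (cmod (f i))\<^sup>2) \<le> C\<^sup>2"
    using f by (intro infsum_le_finite_sums) (auto simp: le mem_l2)
  then show "hnorm l2 f \<le> C" using C by (simp add: hnorm_l2[OF f] real_le_lsqrt infsum_nonneg)
qed

lemma l2_zero_closed [simp]: "(\<lambda>i. 0) \<in> carrier l2"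
  by (simp add: mem_l2)

lemma
  assumes "f \<in> carrier l2" "g \<in> carrier l2"
  shows l2_add_closed [simp]: "(\<lambda>i. f i + g i) \<in> carrier l2"
    and hnorm_l2_triangle: "hnorm l2 (\<lambda>i. f i + g i) \<le> hnorm l2 f + hnorm l2 g"
proof -
  have "L2_set (\<lambda>i. cmod (f i + g i)) F \<le> hnorm l2 f + hnorm l2 g" for F
  proof -
    have "L2_set (\<lambda>i. cmod (f i + g i)) F \<le> L2_set (\<lambda>i. cmod (f i) + cmod (g i)) F"
      by (intro L2_set_mono norm_triangle_ineq) auto
    also have "\<dots> \<le> L2_set (\<lambda>i. cmod (f i)) F + L2_set (\<lambda>i. cmod (g i)) F"
      by (rule L2_set_triangle_ineq)
    also have "\<dots> \<le> hnorm l2 f + hnorm l2 g"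
      by (intro add_mono L2_set_le_hnorm assms)
    finally show ?thesis .
  qed
  from l2_bounded_partial_sums[OF this]
  show "(\<lambda>i. f i + g i) \<in> carrier l2" "hnorm l2 (\<lambda>i. f i + g i) \<le> hnorm l2 f + hnorm l2 g" .
qed

lemma
  assumes "f \<in> carrier l2"
  shows l2_smult_closed [simp]: "(\<lambda>i. c * f i) \<in> carrier l2"
    and hnorm_l2_smult: "hnorm l2 (\<lambda>i. c * f i) = cmod c * hnorm l2 f"
proof -
  show *: "(\<lambda>i. c * f i) \<in> carrier l2"
    using assms by (auto simp: mem_l2 norm_mult power_mult_distrib intro!: summable_on_cmult_right)
  have "(\<Sum>\<^sub>\<infinity>i. (cmod (c * f i))\<^sup>2) = (cmod c)\<^sup>2 * (\<Sum>\<^sub>\<infinity>i. (cmod (f i))\<^sup>2)"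
    by (simp add: norm_mult power_mult_distrib infsum_cmult_right')
  then show "hnorm l2 (\<lambda>i. c * f i) = cmod c * hnorm l2 f"
    by (simp add: hnorm_l2 * assms real_sqrt_mult)
qed

lemma l2_uminus_closed [simp]: "f \<in> carrier l2 \<Longrightarrow> (\<lambda>i. - f i) \<in> carrier l2"
  by (simp add: mem_l2)

lemma l2_diff_closed [simp]: "f \<in> carrier l2 \<Longrightarrow> g \<in> carrier l2 \<Longrightarrow> (\<lambda>i. f i - g i) \<in> carrier l2"
  using l2_add_closed[of f "\<lambda>i. - g i"] by simp

lemma hnorm_l2_uminus: "f \<in> carrier l2 \<Longrightarrow> hnorm l2 (\<lambda>i. - f i) = hnorm l2 f"
  by (simp add: hnorm_l2)

lemma l2_sum_closed [simp]:
  "(\<And>a. a \<in> A \<Longrightarrow> f a \<in> carrier l2) \<Longrightarrow> (\<lambda>i. \<Sum>a\<in>A. f a i) \<in> carrier l2"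
  by (induction A rule: infinite_finite_induct) auto

lemma l2_coord_le: "f \<in> carrier l2 \<Longrightarrow> cmod (f i) \<le> hnorm l2 f"
  using L2_set_le_hnorm[of f "{i}"] by simp

lemma l2_prod_abs_summable:
  assumes "f \<in> carrier l2" "g \<in> carrier l2"
  shows "(\<lambda>i. f i * cnj (g i)) abs_summable_on UNIV"
    and "(\<Sum>\<^sub>\<infinity>i. cmod (f i * cnj (g i))) \<le> hnorm l2 f * hnorm l2 g"
proof -
  have le: "(\<Sum>i\<in>F. cmod (f i * cnj (g i))) \<le> hnorm l2 f * hnorm l2 g" for F
  proof -
    have "(\<Sum>i\<in>F. cmod (f i * cnj (g i))) = (\<Sum>i\<in>F. \<bar>cmod (f i)\<bar> * \<bar>cmod (g i)\<bar>)"
      by (simp add: norm_mult)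
    also have "\<dots> \<le> L2_set (\<lambda>i. cmod (f i)) F * L2_set (\<lambda>i. cmod (g i)) F"
      by (rule L2_set_mult_ineq)
    also have "\<dots> \<le> hnorm l2 f * hnorm l2 g"
      by (intro mult_mono L2_set_le_hnorm assms) (auto simp: assms)
    finally show ?thesis .
  qed
  show *: "(\<lambda>i. f i * cnj (g i)) abs_summable_on UNIV"
    using le by (intro nonneg_bdd_above_summable_on bdd_aboveI[of _ "hnorm l2 f * hnorm l2 g"]) auto
  show "(\<Sum>\<^sub>\<infinity>i. cmod (f i * cnj (g i))) \<le> hnorm l2 f * hnorm l2 g"
    using * le by (intro infsum_le_finite_sums) auto
qed

lemma l2_prod_summable:
  "f \<in> carrier l2 \<Longrightarrow> g \<in> carrier l2 \<Longrightarrow> (\<lambda>i. f i * cnj (g i)) summable_on UNIV"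
  by (rule abs_summable_summable[OF l2_prod_abs_summable(1)])

lemma l2_Cauchy_Schwarz:
  assumes "f \<in> carrier l2" "g \<in> carrier l2"
  shows "cmod (cinner l2 f g) \<le> hnorm l2 f * hnorm l2 g"
  unfolding cinner_l2
  using norm_infsum_bound[OF l2_prod_abs_summable(1)[OF assms]] l2_prod_abs_summable(2)[OF assms]
  by linarith

lemma l2_cinner_add_left:
  "f \<in> carrier l2 \<Longrightarrow> g \<in> carrier l2 \<Longrightarrow> h \<in> carrier l2 \<Longrightarrow>
   cinner l2 (\<lambda>i. f i + g i) h = cinner l2 f h + cinner l2 g h"
  by (simp add: cinner_l2 distrib_right infsum_add l2_prod_summable)

lemma l2_cinner_smult_left: "cinner l2 (\<lambda>i. c * f i) g = c * cinner l2 f g"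
  by (simp add: cinner_l2 mult.assoc infsum_cmult_right')

lemma l2_cinner_commute: "cinner l2 f g = cnj (cinner l2 g f)"
  by (simp add: cinner_l2 mult.commute flip: infsum_cnj)

lemma l2_cinner_add_right:
  "f \<in> carrier l2 \<Longrightarrow> g \<in> carrier l2 \<Longrightarrow> h \<in> carrier l2 \<Longrightarrow>
   cinner l2 h (\<lambda>i. f i + g i) = cinner l2 h f + cinner l2 h g"
  using l2_cinner_add_left[of f g h] l2_cinner_commute[of h] by simp

lemma l2_cinner_smult_right: "cinner l2 f (\<lambda>i. c * g i) = cnj c * cinner l2 f g"
  using l2_cinner_smult_left[of c g f] l2_cinner_commute[of f] by simp

lemma l2_cinner_self: "f \<in> carrier l2 \<Longrightarrow> cinner l2 f f = complex_of_real ((hnorm l2 f)\<^sup>2)"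
proof -
  assume f: "f \<in> carrier l2"
  have "Im (cinner l2 f f) = 0"
    using l2_cinner_commute[of f f] by (metis complex_cnj add.inverse_neutral cnj.simps(2) equal_neg_zero)
  moreover have "Re (cinner l2 f f) = (hnorm l2 f)\<^sup>2"
  proof -
    have "0 \<le> Re (cinner l2 f f)"
      using hnorm_l2_nonneg[OF f] by (simp add: hnorm_def)
    then show ?thesis by (simp add: hnorm_def)
  qed
  ultimately show ?thesis by (simp add: complex_eq_iff)
qed

lemma hnorm_l2_eq_0D: "f \<in> carrier l2 \<Longrightarrow> hnorm l2 f = 0 \<Longrightarrow> f = (\<lambda>i. 0)"
  using l2_coord_le by fastforce

definition basis_vec :: "'i \<Rightarrow> 'i \<Rightarrow> complex" where
  "basis_vec i = (\<lambda>j. if j = i then 1 else 0)"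

definition trunc :: "'i set \<Rightarrow> ('i \<Rightarrow> complex) \<Rightarrow> 'i \<Rightarrow> complex" where
  "trunc F f = (\<lambda>i. if i \<in> F then f i else 0)"

lemma trunc_closed [simp]: "f \<in> carrier l2 \<Longrightarrow> trunc F f \<in> carrier l2"
  by (rule l2_bounded_partial_sums[of _ "hnorm l2 f"],
      rule order_trans[OF _ L2_set_le_hnorm], rule L2_set_mono) (auto simp: trunc_def)

lemma trunc_finite_closed [simp]:
  assumes "finite F" shows "trunc F f \<in> carrier l2"
  unfolding mem_l2
  using summable_on_cong_neutral[of F UNIV "\<lambda>i. (cmod (trunc F f i))\<^sup>2" "\<lambda>i. (cmod (trunc F f i))\<^sup>2"] assms
  by (auto simp: trunc_def)

lemma basis_vec_trunc: "basis_vec i = trunc {i} (\<lambda>_. 1)"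
  by (auto simp: basis_vec_def trunc_def)

lemma basis_vec_closed [simp]: "basis_vec i \<in> carrier l2"
  by (simp add: basis_vec_trunc)

lemma cinner_trunc:
  assumes "finite F" shows "cinner l2 (trunc F f) g = (\<Sum>i\<in>F. f i * cnj (g i))"
proof -
  have "(\<Sum>\<^sub>\<infinity>i. trunc F f i * cnj (g i)) = (\<Sum>\<^sub>\<infinity>i\<in>F. f i * cnj (g i))"
    by (rule infsum_cong_neutral) (auto simp: trunc_def)
  then show ?thesis using assms by (simp add: cinner_l2)
qed

lemma cinner_basis_vec [simp]:
  "cinner l2 f (basis_vec i) = f i" "cinner l2 (basis_vec i) f = cnj (f i)"
proof -
  show "cinner l2 (basis_vec i) f = cnj (f i)" by (simp add: basis_vec_trunc cinner_trunc)
  then show "cinner l2 f (basis_vec i) = f i" by (subst l2_cinner_commute) simp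
qed

lemma hnorm_trunc: "finite F \<Longrightarrow> hnorm l2 (trunc F f) = L2_set (\<lambda>i. cmod (f i)) F"
proof -
  assume F: "finite F"
  have "cinner l2 (trunc F f) (trunc F f) = (\<Sum>i\<in>F. complex_of_real ((cmod (f i))\<^sup>2))"
    unfolding cinner_trunc[OF F] by (intro sum.cong refl) (simp add: trunc_def del: of_real_power flip: complex_norm_square)
  then show ?thesis by (simp add: hnorm_def L2_set_def)
qed

lemma l2_small_tail:
  assumes "f \<in> carrier l2" "0 < e"
  obtains F where "finite F" "hnorm l2 (trunc (- F) f) < e"
proof -
  let ?g = "\<lambda>i. (cmod (f i))\<^sup>2"
  have g: "?g summable_on UNIV" using assms by (simp add: mem_l2)
  obtain F where F: "finite F" "dist (sum ?g F) (infsum ?g UNIV) \<le> e\<^sup>2 / 2"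
    using infsum_finite_approximation[OF g, of "e\<^sup>2/2"] assms by auto
  have tr: "trunc (- F) f \<in> carrier l2" using assms by simp
  have "infsum ?g UNIV = infsum ?g F + infsum ?g (- F)"
    using infsum_Un_disjoint[of ?g F "- F"] g F by (simp add: summable_on_subset_banach)
  then have "infsum ?g (-F) \<le> e\<^sup>2 / 2" using F by (simp add: dist_real_def)
  moreover have "infsum ?g (-F) = (\<Sum>\<^sub>\<infinity>i. (cmod (trunc (- F) f i))\<^sup>2)"
    by (rule infsum_cong_neutral) (auto simp: trunc_def)
  ultimately have "(\<Sum>\<^sub>\<infinity>i. (cmod (trunc (- F) f i))\<^sup>2) < e\<^sup>2" using assms(2)
    by (smt (verit) field_sum_of_halves zero_less_power)
  then have "hnorm l2 (trunc (- F) f) < e"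
    unfolding hnorm_l2[OF tr] using assms(2) by (simp add: real_less_lsqrt infsum_nonneg)
  with F that show thesis by blast
qed

lemma abelian_group_l2: "abelian_group l2"
proof (rule abelian_groupI)
  fix f :: "'a \<Rightarrow> complex" assume "f \<in> carrier l2"
  then show "\<exists>g\<in>carrier l2. g \<oplus>\<^bsub>l2\<^esub> f = \<zero>\<^bsub>l2\<^esub>"
    by (intro bexI[of _ "\<lambda>i. - f i"]) auto
qed (auto simp: algebra_simps)

lemma l2_a_inv [simp]: "f \<in> carrier l2 \<Longrightarrow> \<ominus>\<^bsub>l2\<^esub> f = (\<lambda>i. - f i)"
proof -
  interpret abelian_group "l2 :: ('a \<Rightarrow> complex) hilbert" by (rule abelian_group_l2)
  assume "f \<in> carrier l2" then show ?thesis by (intro minus_equality) auto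
qed

lemma l2_minus [simp]: "f \<in> carrier l2 \<Longrightarrow> g \<in> carrier l2 \<Longrightarrow> f \<ominus>\<^bsub>l2\<^esub> g = (\<lambda>i. f i - g i)"
  by (simp add: a_minus_def)

lemma l2_complete:
  fixes s :: "nat \<Rightarrow> 'i \<Rightarrow> complex"
  assumes s: "\<And>i. s i \<in> carrier l2"
    and cauchy: "\<And>e. e > 0 \<Longrightarrow> \<exists>N. \<forall>i\<ge>N. \<forall>j\<ge>N. hnorm l2 (\<lambda>k. s i k - s j k) < e"
  shows "\<exists>x\<in>carrier l2. (\<lambda>i. hnorm l2 (\<lambda>k. s i k - x k)) \<longlonglongrightarrow> 0"
proof -
  have "Cauchy (\<lambda>i. s i k)" for k
  proof (rule metric_CauchyI)
    fix e :: real assume "0 < e"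
    with cauchy obtain N where N: "\<forall>i\<ge>N. \<forall>j\<ge>N. hnorm l2 (\<lambda>k. s i k - s j k) < e" by blast
    show "\<exists>M. \<forall>m\<ge>M. \<forall>n\<ge>M. dist (s m k) (s n k) < e"
    proof (intro exI[of _ N] allI impI)
      fix m n assume "N \<le> m" "N \<le> n"
      then show "dist (s m k) (s n k) < e"
        using N l2_coord_le[of "\<lambda>k. s m k - s n k" k] s by (fastforce simp: dist_norm)
    qed
  qed
  then have "\<forall>k. \<exists>l. (\<lambda>i. s i k) \<longlonglongrightarrow> l" using Cauchy_convergent convergent_def by blast
  then obtain x where x: "\<And>k. (\<lambda>i. s i k) \<longlonglongrightarrow> x k" by metis
  \<comment> \<open>Finite partial sums pass to the coordinatewise limit.\<close>
  have close: "\<exists>N. \<forall>i\<ge>N. (\<lambda>k. s i k - x k) \<in> carrier l2 \<and> hnorm l2 (\<lambda>k. s i k - x k) \<le> e" if "e > 0" for e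
  proof -
    from cauchy that obtain N where N: "\<forall>i\<ge>N. \<forall>j\<ge>N. hnorm l2 (\<lambda>k. s i k - s j k) < e" by blast
    have "L2_set (\<lambda>k. cmod (s i k - x k)) F \<le> e" if "i \<ge> N" for i F
    proof (rule tendsto_upperbound)
      show "(\<lambda>j. L2_set (\<lambda>k. cmod (s i k - s j k)) F) \<longlonglongrightarrow> L2_set (\<lambda>k. cmod (s i k - x k)) F"
        unfolding L2_set_def by (intro tendsto_intros x)
      show "\<forall>\<^sub>F j in sequentially. L2_set (\<lambda>k. cmod (s i k - s j k)) F \<le> e"
        using eventually_ge_at_top[of N]
      proof eventually_elim
        case (elim j)
        have "L2_set (\<lambda>k. cmod (s i k - s j k)) F \<le> hnorm l2 (\<lambda>k. s i k - s j k)"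
          by (rule L2_set_le_hnorm) (simp add: s)
        also have "\<dots> < e" using N \<open>i \<ge> N\<close> elim by blast
        finally show ?case by simp
      qed
    qed simp
    then show ?thesis using l2_bounded_partial_sums by metis
  qed
  from close[of 1] obtain N where "(\<lambda>k. s N k - x k) \<in> carrier l2" by auto
  then have "(\<lambda>k. s N k - (s N k - x k)) \<in> carrier l2" by (rule l2_diff_closed[OF s])
  then have xl: "x \<in> carrier l2" by (simp only: diff_diff_eq2 add_diff_cancel_left')
  have "(\<lambda>i. hnorm l2 (\<lambda>k. s i k - x k)) \<longlonglongrightarrow> 0"
  proof (rule LIMSEQ_I)
    fix r :: real assume "0 < r"
    with close[of "r/2"] obtain N where "\<forall>i\<ge>N. hnorm l2 (\<lambda>k. s i k - x k) \<le> r/2" by auto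
    then show "\<exists>no. \<forall>n\<ge>no. norm (hnorm l2 (\<lambda>k. s n k - x k) - 0) < r"
      using \<open>0 < r\<close> s xl by (intro exI[of _ N]) (fastforce simp: hnorm_l2_nonneg)
  qed
  with xl show ?thesis by blast
qed

lemma complex_hilbert_space_l2: "complex_hilbert_space (l2 :: ('i \<Rightarrow> complex) hilbert)"
proof (intro complex_hilbert_space.intro complex_hilbert_space_axioms.intro)
  show "module ring_of_type_algebra (l2 :: ('i \<Rightarrow> complex) hilbert)"
    by (rule moduleI[OF cring_from_type_algebra abelian_group_l2])
      (auto simp: ring_of_type_algebra_def algebra_simps)
next
  fix s :: "nat \<Rightarrow> 'i \<Rightarrow> complex"
  assume s: "\<And>i. s i \<in> carrier l2"
    and "\<And>e. 0 < e \<Longrightarrow> \<exists>N. \<forall>i\<ge>N. \<forall>j\<ge>N. hnorm l2 (s i \<ominus>\<^bsub>l2\<^esub> s j) < e"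
  then have "\<And>e. 0 < e \<Longrightarrow> \<exists>N. \<forall>i\<ge>N. \<forall>j\<ge>N. hnorm l2 (\<lambda>k. s i k - s j k) < e" by simp
  from l2_complete[OF s this]
  show "\<exists>x\<in>carrier l2. (\<lambda>i. hnorm l2 (s i \<ominus>\<^bsub>l2\<^esub> x)) \<longlonglongrightarrow> 0"
    using s by auto
next
  fix x :: "'i \<Rightarrow> complex" assume "x \<in> carrier l2" "cinner l2 x x = 0"
  then show "x = \<zero>\<^bsub>l2\<^esub>" using hnorm_l2_eq_0D[of x] by (simp add: hnorm_def)
qed (auto simp: l2_cinner_add_left l2_cinner_smult_left l2_cinner_self intro: l2_cinner_commute)

lemma separable_hilbert_space_l2: "separable_hilbert_space (l2 :: ('i::countable \<Rightarrow> complex) hilbert)"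
proof (intro separable_hilbert_space.intro complex_hilbert_space_l2 separable_hilbert_space_axioms.intro)
  obtain Z :: "complex set" where Z: "countable Z" "\<And>A. open A \<Longrightarrow> A \<noteq> {} \<Longrightarrow> \<exists>d\<in>Z. d \<in> A"
    using countable_dense_exists[where 'a = complex] by blast
  define vec :: "('i \<times> complex) list \<Rightarrow> 'i \<Rightarrow> complex"
    where "vec l i = (case map_of l i of None \<Rightarrow> 0 | Some z \<Rightarrow> z)" for l i
  define A where "A = vec ` lists (UNIV \<times> Z)"
  have vec: "vec l = trunc (fst ` set l) (vec l)" for l
    by (auto simp: trunc_def fun_eq_iff vec_def split: option.split dest: map_of_SomeD image_eqI[rotated])
      (metis fst_conv image_eqI map_of_SomeD)
  have "\<exists>y\<in>A. hnorm l2 (\<lambda>i. x i - y i) < e" if x: "x \<in> carrier l2" and "e > 0" for x e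
  proof -
    obtain F where F: "finite F" "hnorm l2 (trunc (- F) x) < e / 2"
      using l2_small_tail[OF x, of "e/2"] \<open>e > 0\<close> by auto
    \<comment> \<open>The coordinates in \<open>F\<close> are approximated within \<open>d\<close> each, so that together they contribute less than half of \<open>e\<close>.\<close>
    define d where "d = e / (2 * (card F + 1))"
    have "d > 0" using \<open>e > 0\<close> by (simp add: d_def)
    then have "\<exists>z\<in>Z. dist (x i) z < d" for i using Z(2)[of "ball (x i) d"] by auto
    then obtain z where z: "\<And>i. z i \<in> Z" "\<And>i. dist (x i) (z i) < d" by metis
    obtain l where l: "set l = F" using finite_list[OF F(1)] by blast
    have vl: "vec (map (\<lambda>i. (i, z i)) l) = trunc F z"
      by (auto simp: vec_def trunc_def fun_eq_iff map_of_map_restrict restrict_map_def l)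
    have "L2_set (\<lambda>i. cmod (x i - z i)) F \<le> (\<Sum>i\<in>F. cmod (x i - z i))"
      by (rule L2_set_le_sum) simp
    also have "\<dots> \<le> card F * d"
      using sum_bounded_above[of F "\<lambda>i. cmod (x i - z i)" d] z(2) by (simp add: dist_norm less_imp_le)
    also have "\<dots> < e / 2" using \<open>e > 0\<close> by (simp add: d_def field_simps)
    finally have "hnorm l2 (trunc F (\<lambda>i. x i - z i)) < e / 2" using F by (simp add: hnorm_trunc)
    moreover have "(\<lambda>i. x i - trunc F z i) = (\<lambda>i. trunc F (\<lambda>i. x i - z i) i + trunc (- F) x i)"
      by (auto simp: trunc_def)
    ultimately have "hnorm l2 (\<lambda>i. x i - trunc F z i) < e"
      using hnorm_l2_triangle[of "trunc F (\<lambda>i. x i - z i)" "trunc (- F) x"] F x by simp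
    moreover have "trunc F z \<in> A" unfolding A_def vl[symmetric] using z by (intro imageI) (auto simp: in_lists_conv_set)
    ultimately show ?thesis by blast
  qed
  moreover have "countable A" unfolding A_def using Z(1)
    by (intro countable_image countable_lists countable_SIGMA) auto
  moreover have "A \<subseteq> carrier l2" unfolding A_def using vec by (metis image_subsetI List.finite_set finite_imageI trunc_finite_closed)
  ultimately show "\<exists>D. countable D \<and> D \<subseteq> carrier (l2 :: ('i \<Rightarrow> complex) hilbert) \<and>
      (\<forall>x \<in> carrier l2. \<forall>e>0. \<exists>y \<in> D. hnorm l2 (x \<ominus>\<^bsub>l2\<^esub> y) < e)"
    by (intro exI[of _ A]) (auto simp: subset_iff)
qed

section \<open>Bounded operators and adjoints\<close>

text \<open>Boundedness and linearity of a function whose values outside the carrier are arbitrary.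
  Concrete operators can then be written as plain functions and composed as such; they are
  made extensional only where they have to be elements of \<^const>\<open>BH\<close>.\<close>

definition blin :: "(('i \<Rightarrow> complex) \<Rightarrow> 'i \<Rightarrow> complex) \<Rightarrow> bool" where
  "blin T \<longleftrightarrow> (\<forall>f\<in>carrier l2. T f \<in> carrier l2) \<and>
     (\<forall>f\<in>carrier l2. \<forall>g\<in>carrier l2. T (\<lambda>i. f i + g i) = (\<lambda>i. T f i + T g i)) \<and>
     (\<forall>c. \<forall>f\<in>carrier l2. T (\<lambda>i. c * f i) = (\<lambda>i. c * T f i)) \<and>
     (\<exists>K. \<forall>f\<in>carrier l2. hnorm l2 (T f) \<le> K * hnorm l2 f)"

lemma blinI:
  assumes "\<And>f. f \<in> carrier l2 \<Longrightarrow> T f \<in> carrier l2"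
    and "\<And>f g. f \<in> carrier l2 \<Longrightarrow> g \<in> carrier l2 \<Longrightarrow> T (\<lambda>i. f i + g i) = (\<lambda>i. T f i + T g i)"
    and "\<And>c f. f \<in> carrier l2 \<Longrightarrow> T (\<lambda>i. c * f i) = (\<lambda>i. c * T f i)"
    and "\<And>f. f \<in> carrier l2 \<Longrightarrow> hnorm l2 (T f) \<le> K * hnorm l2 f"
  shows "blin T"
  unfolding blin_def using assms by blast

lemma
  assumes "blin T" "f \<in> carrier l2"
  shows blin_closed: "T f \<in> carrier l2"
    and blin_add: "g \<in> carrier l2 \<Longrightarrow> T (\<lambda>i. f i + g i) = (\<lambda>i. T f i + T g i)"
    and blin_smult: "T (\<lambda>i. c * f i) = (\<lambda>i. c * T f i)"
  using assms unfolding blin_def by blast+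

lemma blin_zero: assumes "blin T" shows "T (\<lambda>i. 0) = (\<lambda>i. 0)"
  using blin_smult[OF assms l2_zero_closed, of 0] by simp

lemma blin_uminus: assumes "blin T" "f \<in> carrier l2" shows "T (\<lambda>i. - f i) = (\<lambda>i. - T f i)"
  using blin_smult[OF assms, of "-1"] by simp

lemma blin_sum:
  assumes "blin T" "\<And>a. a \<in> A \<Longrightarrow> f a \<in> carrier l2"
  shows "T (\<lambda>i. \<Sum>a\<in>A. f a i) = (\<lambda>i. \<Sum>a\<in>A. T (f a) i)"
  using assms(2)
proof (induction A rule: infinite_finite_induct)
  case (insert a A)
  then have "T (\<lambda>i. f a i + (\<Sum>a\<in>A. f a i)) = (\<lambda>i. T (f a) i + T (\<lambda>i. \<Sum>a\<in>A. f a i) i)"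
    by (intro blin_add[OF assms(1)]) auto
  with insert show ?case by simp
qed (simp_all add: blin_zero[OF assms(1)])

lemma blin_bound:
  assumes "blin T"
  obtains K where "0 \<le> K" "\<And>f. f \<in> carrier l2 \<Longrightarrow> hnorm l2 (T f) \<le> K * hnorm l2 f"
proof -
  obtain K where K: "\<And>f. f \<in> carrier l2 \<Longrightarrow> hnorm l2 (T f) \<le> K * hnorm l2 f"
    using assms unfolding blin_def by blast
  have "hnorm l2 (T f) \<le> \<bar>K\<bar> * hnorm l2 f" if f: "f \<in> carrier l2" for f
    by (rule order_trans[OF K[OF f]], rule mult_right_mono) (use f in auto)
  then show thesis using that[of "\<bar>K\<bar>"] by simp
qed

lemma blin_cong:
  assumes "\<And>f. f \<in> carrier l2 \<Longrightarrow> S f = T f" "blin S" shows "blin T"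
proof -
  obtain K where K: "\<And>f. f \<in> carrier l2 \<Longrightarrow> hnorm l2 (S f) \<le> K * hnorm l2 f"
    using blin_bound[OF assms(2)] by blast
  show ?thesis
    by (rule blinI[of _ K])
      (simp_all add: assms(1)[symmetric] blin_closed[OF assms(2)] blin_add[OF assms(2)] blin_smult[OF assms(2)] K)
qed

lemma blin_id: "blin (\<lambda>f. f)"
  by (rule blinI[of _ 1]) auto

lemma blin_const_zero: "blin (\<lambda>f i. 0)"
proof (rule blinI[of _ 0])
  show "hnorm l2 (\<lambda>i. 0) \<le> 0 * hnorm l2 f" if "f \<in> carrier l2" for f :: "'a \<Rightarrow> complex"
    by (simp add: hnorm_l2)
qed auto

lemma blin_comp:
  assumes "blin S" "blin T" shows "blin (\<lambda>f. S (T f))"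
proof -
  obtain K where K: "K \<ge> 0" "\<And>f. f \<in> carrier l2 \<Longrightarrow> hnorm l2 (S f) \<le> K * hnorm l2 f"
    using blin_bound[OF assms(1)] by blast
  obtain L where L: "L \<ge> 0" "\<And>f. f \<in> carrier l2 \<Longrightarrow> hnorm l2 (T f) \<le> L * hnorm l2 f"
    using blin_bound[OF assms(2)] by blast
  show ?thesis
  proof (rule blinI[of _ "K * L"])
    fix f :: "'a \<Rightarrow> complex" assume f: "f \<in> carrier l2"
    have "hnorm l2 (S (T f)) \<le> K * hnorm l2 (T f)" by (rule K(2)[OF blin_closed[OF assms(2) f]])
    also have "\<dots> \<le> K * (L * hnorm l2 f)" by (rule mult_left_mono[OF L(2)[OF f] K(1)])
    finally show "hnorm l2 (S (T f)) \<le> K * L * hnorm l2 f" by (simp add: mult.assoc)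
  qed (simp_all add: blin_closed[OF assms(1)] blin_closed[OF assms(2)] blin_add[OF assms(1)] blin_add[OF assms(2)] blin_smult[OF assms(1)] blin_smult[OF assms(2)])
qed

lemma blin_plus:
  assumes "blin S" "blin T" shows "blin (\<lambda>f i. S f i + T f i)"
proof -
  obtain K where K: "K \<ge> 0" "\<And>f. f \<in> carrier l2 \<Longrightarrow> hnorm l2 (S f) \<le> K * hnorm l2 f"
    using blin_bound[OF assms(1)] by blast
  obtain L where L: "L \<ge> 0" "\<And>f. f \<in> carrier l2 \<Longrightarrow> hnorm l2 (T f) \<le> L * hnorm l2 f"
    using blin_bound[OF assms(2)] by blast
  show ?thesis
  proof (rule blinI[of _ "K + L"])
    fix f :: "'a \<Rightarrow> complex" assume f: "f \<in> carrier l2"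
    have "hnorm l2 (\<lambda>i. S f i + T f i) \<le> hnorm l2 (S f) + hnorm l2 (T f)"
      by (rule hnorm_l2_triangle[OF blin_closed[OF assms(1) f] blin_closed[OF assms(2) f]])
    also have "\<dots> \<le> (K + L) * hnorm l2 f" using K(2)[OF f] L(2)[OF f] by (simp add: distrib_right)
    finally show "hnorm l2 (\<lambda>i. S f i + T f i) \<le> (K + L) * hnorm l2 f" .
    show "(\<lambda>i. S f i + T f i) \<in> carrier l2" by (rule l2_add_closed[OF blin_closed[OF assms(1) f] blin_closed[OF assms(2) f]])
    fix c show "(\<lambda>i. S (\<lambda>i. c * f i) i + T (\<lambda>i. c * f i) i) = (\<lambda>i. c * (S f i + T f i))"
      unfolding blin_smult[OF assms(1) f] blin_smult[OF assms(2) f] by (simp add: distrib_left)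
  next
    fix f g :: "'a \<Rightarrow> complex" assume f: "f \<in> carrier l2" and g: "g \<in> carrier l2"
    show "(\<lambda>i. S (\<lambda>i. f i + g i) i + T (\<lambda>i. f i + g i) i) = (\<lambda>i. S f i + T f i + (S g i + T g i))"
      unfolding blin_add[OF assms(1) f g] blin_add[OF assms(2) f g] by (simp add: add_ac)
  qed
qed

lemma blin_scale:
  assumes "blin T" shows "blin (\<lambda>f i. c * T f i)"
proof -
  obtain L where L: "L \<ge> 0" "\<And>f. f \<in> carrier l2 \<Longrightarrow> hnorm l2 (T f) \<le> L * hnorm l2 f"
    using blin_bound[OF assms(1)] by blast
  show ?thesis
  proof (rule blinI[of _ "cmod c * L"])
    fix f :: "'a \<Rightarrow> complex" assume f: "f \<in> carrier l2"
    show "hnorm l2 (\<lambda>i. c * T f i) \<le> cmod c * L * hnorm l2 f"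
      using mult_left_mono[OF L(2)[OF f], of "cmod c"] blin_closed[OF assms f]
      by (simp add: hnorm_l2_smult mult.assoc)
    show "(\<lambda>i. c * T f i) \<in> carrier l2" by (rule l2_smult_closed[OF blin_closed[OF assms f]])
    fix d show "(\<lambda>i. c * T (\<lambda>i. d * f i) i) = (\<lambda>i. d * (c * T f i))"
      unfolding blin_smult[OF assms f] by (simp add: mult.left_commute)
  next
    fix f g :: "'a \<Rightarrow> complex" assume f: "f \<in> carrier l2" and g: "g \<in> carrier l2"
    show "(\<lambda>i. c * T (\<lambda>i. f i + g i) i) = (\<lambda>i. c * T f i + c * T g i)"
      unfolding blin_add[OF assms f g] by (simp add: distrib_left)
  qed
qed

lemma blin_minus: "blin S \<Longrightarrow> blin T \<Longrightarrow> blin (\<lambda>f i. S f i - T f i)"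
  using blin_plus[OF _ blin_scale, of S T "-1"] by (simp only: mult_minus_left mult_1 add_uminus_conv_diff)

lemma blin_finite_sum:
  assumes "\<And>a. a \<in> A \<Longrightarrow> blin (S a)" shows "blin (\<lambda>f i. \<Sum>a\<in>A. S a f i)"
  using assms
proof (induction A rule: infinite_finite_induct)
  case (insert a A)
  then have "blin (\<lambda>f i. S a f i + (\<Sum>a\<in>A. S a f i))" by (intro blin_plus) blast+
  with insert show ?case by simp
qed (simp_all add: blin_const_zero)

lemma bounded_op_l2: "bounded_op l2 T \<longleftrightarrow> T \<in> extensional (carrier l2) \<and> blin T"
  unfolding bounded_op_def blin_def l2_simps PiE_iff by blast

lemma blin_gens345rict: "blin T \<Longrightarrow> blin (restrict T (carrier l2))"
  by (rule blin_cong[of T]) auto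

lemma bounded_op_restrict: "blin T \<Longrightarrow> bounded_op l2 (restrict T (carrier l2))"
  by (simp add: bounded_op_l2 blin_gens345rict)

lemma l2_eq_by_cinner:
  assumes "\<And>h. h \<in> carrier l2 \<Longrightarrow> cinner l2 f h = cinner l2 g h"
  shows "f = g"
proof
  fix i show "f i = g i" using assms[OF basis_vec_closed, of i] by simp
qed

text \<open>Both operators of the pair are bounded. Working with the pair instead of \<^const>\<open>op_adjoint\<close> keeps
  the adjoint of a concrete operator an explicit plain function.\<close>

definition adj_pair :: "(('i \<Rightarrow> complex) \<Rightarrow> 'i \<Rightarrow> complex) \<Rightarrow> (('i \<Rightarrow> complex) \<Rightarrow> 'i \<Rightarrow> complex) \<Rightarrow> bool" where
  "adj_pair T S \<longleftrightarrow> blin T \<and> blin S \<and>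
     (\<forall>f\<in>carrier l2. \<forall>g\<in>carrier l2. cinner l2 (T f) g = cinner l2 f (S g))"

lemma adj_pairI:
  assumes "blin T" "blin S"
    "\<And>f g. f \<in> carrier l2 \<Longrightarrow> g \<in> carrier l2 \<Longrightarrow> cinner l2 (T f) g = cinner l2 f (S g)"
  shows "adj_pair T S"
  using assms by (auto simp: adj_pair_def)

lemma adj_pairD:
  assumes "adj_pair T S"
  shows "blin T" "blin S"
    "f \<in> carrier l2 \<Longrightarrow> g \<in> carrier l2 \<Longrightarrow> cinner l2 (T f) g = cinner l2 f (S g)"
  using assms by (auto simp: adj_pair_def)

lemma adj_pair_sym: assumes "adj_pair T S" shows "adj_pair S T"
proof (rule adj_pairI)
  fix f g :: "'a \<Rightarrow> complex" assume fg: "f \<in> carrier l2" "g \<in> carrier l2"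
  have "cinner l2 (S f) g = cnj (cinner l2 g (S f))" by (rule l2_cinner_commute)
  also have "\<dots> = cnj (cinner l2 (T g) f)" using adj_pairD(3)[OF assms fg(2,1)] by simp
  finally show "cinner l2 (S f) g = cinner l2 f (T g)" using l2_cinner_commute[of f "T g"] by simp
qed (use adj_pairD[OF assms] in auto)

lemma adj_pair_coord:
  assumes "adj_pair T S" "f \<in> carrier l2" shows "T f i = cinner l2 f (S (basis_vec i))"
  using adj_pairD(3)[OF assms, of "basis_vec i"] by simp

lemma adj_pair_unique:
  assumes "adj_pair T S" "adj_pair T S'" "g \<in> carrier l2" shows "S g = S' g"
proof (rule l2_eq_by_cinner)
  fix h :: "'a \<Rightarrow> complex" assume h: "h \<in> carrier l2"
  show "cinner l2 (S g) h = cinner l2 (S' g) h"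
    using adj_pairD(3)[OF adj_pair_sym[OF assms(1)] assms(3) h] adj_pairD(3)[OF adj_pair_sym[OF assms(2)] assms(3) h]
    by simp
qed

lemma adj_pair_cong:
  assumes "adj_pair T S" "\<And>f. f \<in> carrier l2 \<Longrightarrow> T f = T' f" "\<And>f. f \<in> carrier l2 \<Longrightarrow> S f = S' f"
  shows "adj_pair T' S'"
  using assms blin_cong[of T T'] blin_cong[of S S'] by (auto simp: adj_pair_def)

lemma adj_pair_comp:
  assumes "adj_pair T S" "adj_pair T' S'" shows "adj_pair (\<lambda>f. T (T' f)) (\<lambda>f. S' (S f))"
  using assms blin_comp[of T T'] blin_comp[of S' S] blin_closed[of T'] blin_closed[of S] by (simp add: adj_pair_def)

lemma adj_pair_id: "adj_pair (\<lambda>f. f) (\<lambda>f. f)"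
  by (simp add: adj_pair_def blin_id)

lemma adj_pair_plus:
  assumes "adj_pair S S'" "adj_pair T T'" shows "adj_pair (\<lambda>f i. S f i + T f i) (\<lambda>f i. S' f i + T' f i)"
proof (rule adj_pairI)
  show "blin (\<lambda>f i. S f i + T f i)" by (rule blin_plus[OF adj_pairD(1)[OF assms(1)] adj_pairD(1)[OF assms(2)]])
  show "blin (\<lambda>f i. S' f i + T' f i)" by (rule blin_plus[OF adj_pairD(2)[OF assms(1)] adj_pairD(2)[OF assms(2)]])
  fix f g :: "'a \<Rightarrow> complex" assume f: "f \<in> carrier l2" and g: "g \<in> carrier l2"
  show "cinner l2 (\<lambda>i. S f i + T f i) g = cinner l2 f (\<lambda>i. S' g i + T' g i)"
    using adj_pairD(3)[OF assms(1) f g] adj_pairD(3)[OF assms(2) f g]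
      l2_cinner_add_left[OF blin_closed[OF adj_pairD(1)[OF assms(1)] f] blin_closed[OF adj_pairD(1)[OF assms(2)] f] g]
      l2_cinner_add_right[OF blin_closed[OF adj_pairD(2)[OF assms(1)] g] blin_closed[OF adj_pairD(2)[OF assms(2)] g] f]
    by simp
qed

lemma adj_pair_scale:
  assumes "adj_pair S S'" shows "adj_pair (\<lambda>f i. c * S f i) (\<lambda>f i. cnj c * S' f i)"
proof (rule adj_pairI)
  show "blin (\<lambda>f i. c * S f i)" by (rule blin_scale[OF adj_pairD(1)[OF assms]])
  show "blin (\<lambda>f i. cnj c * S' f i)" by (rule blin_scale[OF adj_pairD(2)[OF assms]])
  fix f g :: "'a \<Rightarrow> complex" assume f: "f \<in> carrier l2" and g: "g \<in> carrier l2"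
  show "cinner l2 (\<lambda>i. c * S f i) g = cinner l2 f (\<lambda>i. cnj c * S' g i)"
    using adj_pairD(3)[OF assms f g] by (simp add: l2_cinner_smult_left l2_cinner_smult_right)
qed

lemma trunc_expand: "finite F \<Longrightarrow> trunc F f = (\<lambda>j. \<Sum>i\<in>F. f i * basis_vec i j)"
  by (auto simp: trunc_def basis_vec_def fun_eq_iff if_distrib cong: if_cong)

text \<open>The matrix of \<open>T\<close> determines the only candidate \<open>S\<close>. Testing \<open>T\<close> on the truncations of \<open>S g\<close>
  bounds the partial sums of \<open>S g\<close>, and the adjoint relation extends from finitely supported
  vectors by continuity.\<close>

lemma blin_adjoint_exists:
  assumes T: "blin T" obtains S where "adj_pair T S"
proof -
  obtain K where K: "K \<ge> 0" "\<And>f. f \<in> carrier l2 \<Longrightarrow> hnorm l2 (T f) \<le> K * hnorm l2 f"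
    using blin_bound[OF T] by blast
  define S where "S g j = cnj (cinner l2 (T (basis_vec j)) g)" for g j
  have fin: "cinner l2 (T (trunc F f)) g = (\<Sum>i\<in>F. f i * cnj (S g i))"
    if F: "finite F" and g: "g \<in> carrier l2" for F f g
  proof -
    have "T (trunc F f) = (\<lambda>j. \<Sum>i\<in>F. T (\<lambda>j. f i * basis_vec i j) j)"
      unfolding trunc_expand[OF F] by (intro blin_sum[OF T]) simp
    then have "T (trunc F f) = (\<lambda>j. \<Sum>i\<in>F. f i * T (basis_vec i) j)"
      by (simp add: blin_smult[OF T])
    moreover have "cinner l2 (\<lambda>j. \<Sum>i\<in>F. f i * T (basis_vec i) j) g = (\<Sum>i\<in>F. f i * cinner l2 (T (basis_vec i)) g)"
      using F
    proof (induction F)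
      case (insert a F)
      have "cinner l2 (\<lambda>j. f a * T (basis_vec a) j + (\<Sum>i\<in>F. f i * T (basis_vec i) j)) g
        = cinner l2 (\<lambda>j. f a * T (basis_vec a) j) g + cinner l2 (\<lambda>j. \<Sum>i\<in>F. f i * T (basis_vec i) j) g"
        by (rule l2_cinner_add_left) (simp_all add: g blin_closed[OF T])
      with insert show ?case by (simp add: l2_cinner_smult_left)
    qed (simp add: cinner_l2)
    ultimately show ?thesis by (simp add: S_def)
  qed
  have bound: "S g \<in> carrier l2 \<and> hnorm l2 (S g) \<le> K * hnorm l2 g" if g: "g \<in> carrier l2" for g
  proof -
    have "L2_set (\<lambda>i. cmod (S g i)) F \<le> K * hnorm l2 g" if F: "finite F" for F
    proof -
      let ?L = "L2_set (\<lambda>i. cmod (S g i)) F"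
      have "complex_of_real (?L\<^sup>2) = (\<Sum>i\<in>F. S g i * cnj (S g i))"
        by (simp add: L2_set_def sum_nonneg del: of_real_power flip: complex_norm_square)
      also have "\<dots> = cinner l2 (T (trunc F (S g))) g" by (simp add: fin F g)
      finally have "?L\<^sup>2 = cmod (cinner l2 (T (trunc F (S g))) g)"
        by (metis norm_of_real abs_of_nonneg zero_le_power2)
      also have "\<dots> \<le> hnorm l2 (T (trunc F (S g))) * hnorm l2 g"
        by (rule l2_Cauchy_Schwarz) (simp_all add: F g blin_closed[OF T])
      also have "\<dots> \<le> K * ?L * hnorm l2 g"
        using K(2)[of "trunc F (S g)"] F g by (intro mult_right_mono) (auto simp: hnorm_trunc)
      finally have "?L * ?L \<le> (K * hnorm l2 g) * ?L" by (simp add: power2_eq_square mult_ac)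
      moreover have "0 \<le> ?L" by simp
      ultimately show ?thesis using K(1) g
        by (cases "?L = 0") (simp_all add: mult_le_cancel_right)
    qed
    then show ?thesis using l2_bounded_partial_sums by metis
  qed
  have S: "blin S"
    by (rule blinI[of _ K])
       (use bound in \<open>auto simp: S_def fun_eq_iff l2_cinner_smult_right l2_cinner_add_right blin_closed[OF T]\<close>)
  have "cinner l2 (T f) g = cinner l2 f (S g)" if f: "f \<in> carrier l2" and g: "g \<in> carrier l2" for f g
  proof -
    have "cmod (cinner l2 (T f) g - cinner l2 f (S g)) \<le> e" if "e > 0" for e
    proof -
      define c where "c = 2 * K * hnorm l2 g + 1"
      have c: "c > 0" using K(1) g by (simp add: c_def add_nonneg_pos)
      obtain F where F: "finite F" "hnorm l2 (trunc (- F) f) < e / c"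
        using l2_small_tail[OF f, of "e / c"] \<open>e > 0\<close> c by auto
      let ?t = "trunc F f" and ?r = "trunc (- F) f"
      have f_eq: "f = (\<lambda>i. ?t i + ?r i)" by (auto simp: trunc_def)
      have [simp]: "?t \<in> carrier l2" "?r \<in> carrier l2" "T ?t \<in> carrier l2" "T ?r \<in> carrier l2" "S g \<in> carrier l2"
        using f g F by (simp_all add: blin_closed[OF T] blin_closed[OF S])
      have "cinner l2 (T f) g = cinner l2 (T ?t) g + cinner l2 (T ?r) g"
        by (subst f_eq, subst blin_add[OF T]) (simp_all add: l2_cinner_add_left g)
      moreover have "cinner l2 f (S g) = cinner l2 ?t (S g) + cinner l2 ?r (S g)"
        by (subst f_eq) (simp add: l2_cinner_add_left g)
      moreover have "cinner l2 (T ?t) g = cinner l2 ?t (S g)"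
        by (simp add: fin F g cinner_trunc)
      ultimately have "cmod (cinner l2 (T f) g - cinner l2 f (S g))
          \<le> cmod (cinner l2 (T ?r) g) + cmod (cinner l2 ?r (S g))"
        by (simp add: norm_triangle_ineq4)
      also have "\<dots> \<le> hnorm l2 (T ?r) * hnorm l2 g + hnorm l2 ?r * hnorm l2 (S g)"
        by (intro add_mono l2_Cauchy_Schwarz) (auto simp: g)
      also have "\<dots> \<le> (K * hnorm l2 ?r) * hnorm l2 g + hnorm l2 ?r * (K * hnorm l2 g)"
        by (intro add_mono mult_right_mono mult_left_mono K) (auto simp: g bound)
      also have "\<dots> \<le> c * hnorm l2 ?r" by (simp add: c_def algebra_simps)
      also have "\<dots> \<le> e" using F c by (simp add: field_simps)
      finally show ?thesis .
    qed
    then show ?thesis using field_le_epsilon[of "cmod (cinner l2 (T f) g - cinner l2 f (S g))" 0] by simp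
  qed
  with T S show thesis using that by (blast intro: adj_pairI)
qed

lemma op_adjoint_eqI:
  assumes "adj_pair T S" shows "op_adjoint l2 T = restrict S (carrier l2)"
  unfolding op_adjoint_def
proof (rule the_equality)
  show "bounded_op l2 (restrict S (carrier l2)) \<and>
    (\<forall>x\<in>carrier l2. \<forall>y\<in>carrier l2. cinner l2 (T x) y = cinner l2 x (restrict S (carrier l2) y))"
    using adj_pairD[OF assms] by (auto intro: bounded_op_restrict)
next
  fix S' assume S': "bounded_op l2 S' \<and> (\<forall>x\<in>carrier l2. \<forall>y\<in>carrier l2. cinner l2 (T x) y = cinner l2 x (S' y))"
  then have "adj_pair T S'" using adj_pairD(1)[OF assms] by (auto simp: adj_pair_def bounded_op_l2)
  from adj_pair_unique[OF this assms] S' show "S' = restrict S (carrier l2)"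
    by (auto simp: bounded_op_l2 extensional_def fun_eq_iff)
qed

lemma adj_pair_op_adjoint: "blin T \<Longrightarrow> adj_pair T (op_adjoint l2 T)"
proof -
  assume "blin T"
  then obtain S where S: "adj_pair T S" by (rule blin_adjoint_exists)
  show ?thesis by (rule adj_pair_cong[OF S]) (simp_all add: op_adjoint_eqI[OF S])
qed

lemma bounded_op_adjoint: "blin T \<Longrightarrow> bounded_op l2 (op_adjoint l2 T)"
  by (metis adj_pair_op_adjoint adj_pairD(2) op_adjoint_eqI bounded_op_restrict)

lemma BH_l2_simps [simp]:
  "carrier (BH l2) = {T. bounded_op l2 T}"
  "S \<otimes>\<^bsub>BH l2\<^esub> T = compose (carrier l2) S T"
  "\<one>\<^bsub>BH l2\<^esub> = (\<lambda>x\<in>carrier l2. x)"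
  "\<zero>\<^bsub>BH l2\<^esub> = (\<lambda>x\<in>carrier l2. (\<lambda>i. 0))"
  "S \<oplus>\<^bsub>BH l2\<^esub> T = (\<lambda>x\<in>carrier l2. (\<lambda>i. S x i + T x i))"
  "c \<odot>\<^bsub>BH l2\<^esub> T = (\<lambda>x\<in>carrier l2. (\<lambda>i. c * T x i))"
  "invol (BH l2) T = op_adjoint l2 T"
  by (simp_all add: BH_def)

lemma bounded_op_eqI:
  assumes "bounded_op l2 S" "bounded_op l2 T" "\<And>f. f \<in> carrier l2 \<Longrightarrow> S f = T f" shows "S = T"
  using assms by (auto simp: bounded_op_l2 intro: extensionalityI)

lemma ring_BH_l2: "ring (BH (l2 :: ('i \<Rightarrow> complex) hilbert))"
proof (rule ringI)
  let ?B = "BH (l2 :: ('i \<Rightarrow> complex) hilbert)"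
  have closed: "bounded_op l2 (compose (carrier l2) S T)" "bounded_op l2 (\<lambda>x\<in>carrier l2. (\<lambda>i. S x i + T x i))"
    if "bounded_op l2 S" "bounded_op l2 T" for S T :: "('i \<Rightarrow> complex) \<Rightarrow> 'i \<Rightarrow> complex"
    using that unfolding compose_def bounded_op_l2
    by (simp_all add: blin_gens345rict[OF blin_comp] blin_gens345rict[OF blin_plus])
  show "abelian_group ?B"
  proof (rule abelian_groupI)
    fix T assume "T \<in> carrier ?B"
    then have T: "blin T" by (simp add: bounded_op_l2)
    let ?S = "restrict (\<lambda>f i. (-1) * T f i) (carrier l2)"
    have "bounded_op l2 ?S" by (intro bounded_op_restrict blin_scale T)
    moreover have "?S \<oplus>\<^bsub>?B\<^esub> T = \<zero>\<^bsub>?B\<^esub>" by (auto simp: fun_eq_iff)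
    ultimately show "\<exists>S\<in>carrier ?B. S \<oplus>\<^bsub>?B\<^esub> T = \<zero>\<^bsub>?B\<^esub>" by (intro bexI[of _ ?S]) simp_all
  next
    show "\<zero>\<^bsub>?B\<^esub> \<in> carrier ?B" by (simp add: bounded_op_restrict blin_const_zero)
  next
    fix T assume "T \<in> carrier ?B"
    then have T: "bounded_op l2 T" by simp
    show "\<zero>\<^bsub>?B\<^esub> \<oplus>\<^bsub>?B\<^esub> T = T"
      using T closed(2)[OF bounded_op_restrict[OF blin_const_zero] T] by (intro bounded_op_eqI) simp_all
  next
    fix R S T assume "R \<in> carrier ?B" "S \<in> carrier ?B" "T \<in> carrier ?B"
    show "R \<oplus>\<^bsub>?B\<^esub> S \<oplus>\<^bsub>?B\<^esub> T = R \<oplus>\<^bsub>?B\<^esub> (S \<oplus>\<^bsub>?B\<^esub> T)"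
      by (simp add: add.assoc cong: restrict_cong)
  next
    fix S T assume "S \<in> carrier ?B" "T \<in> carrier ?B"
    then show "S \<oplus>\<^bsub>?B\<^esub> T \<in> carrier ?B" using closed(2) by simp
    show "S \<oplus>\<^bsub>?B\<^esub> T = T \<oplus>\<^bsub>?B\<^esub> S" by (simp add: add.commute)
  qed
  show "Group.monoid ?B"
  proof (rule monoidI)
    fix T assume "T \<in> carrier ?B"
    then have T: "bounded_op l2 T" by simp
    then have bT: "blin T" by (simp add: bounded_op_l2)
    note one = bounded_op_restrict[OF blin_id]
    show "\<one>\<^bsub>?B\<^esub> \<otimes>\<^bsub>?B\<^esub> T = T" "T \<otimes>\<^bsub>?B\<^esub> \<one>\<^bsub>?B\<^esub> = T"
      using T closed(1)[OF one T] closed(1)[OF T one]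
      by (auto intro!: bounded_op_eqI simp: compose_def blin_closed[OF bT])
  next
    fix R S T assume "R \<in> carrier ?B" "S \<in> carrier ?B" "T \<in> carrier ?B"
    then have T: "blin T" by (simp add: bounded_op_l2)
    show "R \<otimes>\<^bsub>?B\<^esub> S \<otimes>\<^bsub>?B\<^esub> T = R \<otimes>\<^bsub>?B\<^esub> (S \<otimes>\<^bsub>?B\<^esub> T)"
      by (simp add: compose_def blin_closed[OF T] cong: restrict_cong)
  next
    fix S T assume "S \<in> carrier ?B" "T \<in> carrier ?B"
    then show "S \<otimes>\<^bsub>?B\<^esub> T \<in> carrier ?B" using closed(1) by simp
  qed (simp add: bounded_op_restrict blin_id)
next
  let ?B = "BH (l2 :: ('i \<Rightarrow> complex) hilbert)"
  fix R S T assume "R \<in> carrier ?B" "S \<in> carrier ?B" "T \<in> carrier ?B"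
  then have R: "blin R" and S: "blin S" and T: "blin T" by (simp_all add: bounded_op_l2)
  show "(R \<oplus>\<^bsub>?B\<^esub> S) \<otimes>\<^bsub>?B\<^esub> T = R \<otimes>\<^bsub>?B\<^esub> T \<oplus>\<^bsub>?B\<^esub> S \<otimes>\<^bsub>?B\<^esub> T"
    by (simp add: compose_def blin_closed[OF T] cong: restrict_cong)
  show "T \<otimes>\<^bsub>?B\<^esub> (R \<oplus>\<^bsub>?B\<^esub> S) = T \<otimes>\<^bsub>?B\<^esub> R \<oplus>\<^bsub>?B\<^esub> T \<otimes>\<^bsub>?B\<^esub> S"
    by (simp add: compose_def blin_closed[OF R] blin_closed[OF S] blin_add[OF T] cong: restrict_cong)
qed

section \<open>Commutants and generated von Neumann algebras\<close>

definition commutes :: "(('i \<Rightarrow> complex) \<Rightarrow> 'i \<Rightarrow> complex) \<Rightarrow> (('i \<Rightarrow> complex) \<Rightarrow> 'i \<Rightarrow> complex) \<Rightarrow> bool" where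
  "commutes T S \<longleftrightarrow> (\<forall>f\<in>carrier l2. T (S f) = S (T f))"

lemma mem_commutant_l2: "T \<in> commutant l2 A \<longleftrightarrow> bounded_op l2 T \<and> (\<forall>S\<in>A. commutes T S)"
  by (auto simp: commutant_def commutes_def compose_def fun_eq_iff restrict_def)

text \<open>Taking adjoints on both sides of \<open>T S = S T\<close>.\<close>

lemma commutes_adj:
  assumes "adj_pair T T'" "adj_pair S S'" "commutes T S" shows "commutes T' S'"
proof -
  have "T' (S' f) = S' (T' f)" if f: "f \<in> carrier l2" for f
  proof (rule l2_eq_by_cinner)
    fix g :: "'a \<Rightarrow> complex" assume g: "g \<in> carrier l2"
    note [simp] = blin_closed[OF adj_pairD(1)[OF assms(1)]] blin_closed[OF adj_pairD(2)[OF assms(1)]]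
      blin_closed[OF adj_pairD(1)[OF assms(2)]] blin_closed[OF adj_pairD(2)[OF assms(2)]]
    have "cinner l2 (T' (S' f)) g = cinner l2 f (S (T g))"
      using f g by (simp add: adj_pairD(3)[OF adj_pair_sym[OF assms(1)]] adj_pairD(3)[OF adj_pair_sym[OF assms(2)]])
    also have "\<dots> = cinner l2 f (T (S g))" using assms(3) g by (simp add: commutes_def)
    also have "\<dots> = cinner l2 (S' (T' f)) g"
      using f g by (simp add: adj_pairD(3)[OF adj_pair_sym[OF assms(1)]] adj_pairD(3)[OF adj_pair_sym[OF assms(2)]])
    finally show "cinner l2 (T' (S' f)) g = cinner l2 (S' (T' f)) g" .
  qed
  then show ?thesis by (simp add: commutes_def)
qed

definition star_closed :: "(('i \<Rightarrow> complex) \<Rightarrow> 'i \<Rightarrow> complex) set \<Rightarrow> bool" where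
  "star_closed A \<longleftrightarrow> (\<forall>T\<in>A. bounded_op l2 T \<and> op_adjoint l2 T \<in> A)"

lemma commutes_cong_right:
  assumes "commutes T S" "blin T" "\<And>f. f \<in> carrier l2 \<Longrightarrow> S f = S' f" shows "commutes T S'"
  using assms blin_closed[OF assms(2)] by (simp add: commutes_def)

lemma commutant_star_closed:
  assumes "star_closed A" shows "star_closed (commutant l2 A)"
  unfolding star_closed_def
proof (intro ballI conjI)
  fix T assume T: "T \<in> commutant l2 A"
  then show "bounded_op l2 T" by (simp add: mem_commutant_l2)
  then have bT: "blin T" by (simp add: bounded_op_l2)
  show "op_adjoint l2 T \<in> commutant l2 A" unfolding mem_commutant_l2
  proof (intro conjI ballI bounded_op_adjoint bT)
    fix S assume S: "S \<in> A"
    then have S': "blin S" "op_adjoint l2 S \<in> A" using assms by (auto simp: star_closed_def bounded_op_l2)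
    then have "commutes T (op_adjoint l2 S)" using T by (simp add: mem_commutant_l2)
    from commutes_adj[OF adj_pair_op_adjoint[OF bT] adj_pair_sym[OF adj_pair_op_adjoint[OF S'(1)]] this]
    show "commutes (op_adjoint l2 T) S" .
  qed
qed

lemma commutes_sym: "commutes T S \<longleftrightarrow> commutes S T"
  by (auto simp: commutes_def)

lemma commutant_triple:
  assumes "star_closed A"
  shows "commutant l2 (commutant l2 (commutant l2 A)) = commutant l2 A"
proof -
  have sub: "B \<subseteq> commutant l2 (commutant l2 B)" if "star_closed B" for B :: "(('a \<Rightarrow> complex) \<Rightarrow> 'a \<Rightarrow> complex) set"
    using that by (auto simp: mem_commutant_l2 star_closed_def) (subst commutes_sym, blast)
  have "commutant l2 (commutant l2 (commutant l2 A)) \<subseteq> commutant l2 A"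
    unfolding subset_iff mem_commutant_l2[of _ A] mem_commutant_l2[of _ "commutant l2 (commutant l2 A)"]
    using sub[OF assms] by blast
  moreover have "commutant l2 A \<subseteq> commutant l2 (commutant l2 (commutant l2 A))"
    by (rule sub[OF commutant_star_closed[OF assms]])
  ultimately show ?thesis by blast
qed

lemma von_neumann_algebra_bicommutant:
  assumes "star_closed A" shows "von_neumann_algebra l2 (commutant l2 (commutant l2 A))"
proof -
  have "star_closed (commutant l2 (commutant l2 A))"
    by (intro commutant_star_closed assms)
  then show ?thesis
    using commutant_triple[OF commutant_star_closed[OF assms]]
    by (auto simp: von_neumann_algebra_def star_closed_def)
qed

text \<open>Membership in the von Neumann algebra \<open>A\<close>'' for operators given as plain functions. By the
  bicommutant description, closure under the algebra operations, adjoints, range projections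
  and spectral projections is proved by looking at what commutes with \<open>S\<close>.\<close>

definition in_vna :: "(('i \<Rightarrow> complex) \<Rightarrow> 'i \<Rightarrow> complex) set \<Rightarrow> (('i \<Rightarrow> complex) \<Rightarrow> 'i \<Rightarrow> complex) \<Rightarrow> bool" where
  "in_vna A S \<longleftrightarrow> blin S \<and> (\<forall>T\<in>commutant l2 A. commutes T S)"

lemma in_vnaD: assumes "in_vna A S" "T \<in> commutant l2 A" shows "blin S" "blin T" "f \<in> carrier l2 \<Longrightarrow> T (S f) = S (T f)"
  using assms by (auto simp: in_vna_def commutes_def mem_commutant_l2 bounded_op_l2)

lemma in_vna_blin: "in_vna A S \<Longrightarrow> blin S" by (simp add: in_vna_def)

lemma in_vna_restrict:
  assumes "in_vna A S" shows "restrict S (carrier l2) \<in> commutant l2 (commutant l2 A)"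
  unfolding mem_commutant_l2
proof (intro conjI ballI bounded_op_restrict in_vna_blin[OF assms])
  fix T assume T: "T \<in> commutant l2 A"
  have "commutes T S" using T assms by (simp add: in_vna_def)
  then have "commutes T (restrict S (carrier l2))"
    by (rule commutes_cong_right[OF _ in_vnaD(2)[OF assms T]]) simp
  then show "commutes (restrict S (carrier l2)) T" by (simp add: commutes_sym)
qed

lemma in_vna_cong:
  assumes "in_vna A S" "\<And>f. f \<in> carrier l2 \<Longrightarrow> S f = S' f" shows "in_vna A S'"
  unfolding in_vna_def
proof (intro conjI ballI)
  show "blin S'" using blin_cong[of S S'] assms in_vna_blin by blast
  fix T assume T: "T \<in> commutant l2 A"
  have "commutes T S" using T assms(1) by (simp add: in_vna_def)
  then show "commutes T S'" by (rule commutes_cong_right[OF _ in_vnaD(2)[OF assms(1) T] assms(2)])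
qed

lemma in_vna_comp:
  assumes "in_vna A S" "in_vna A S'" shows "in_vna A (\<lambda>f. S (S' f))"
  unfolding in_vna_def
proof (intro conjI ballI)
  show "blin (\<lambda>f. S (S' f))" by (rule blin_comp[OF in_vna_blin[OF assms(1)] in_vna_blin[OF assms(2)]])
  fix T assume T: "T \<in> commutant l2 A"
  show "commutes T (\<lambda>f. S (S' f))"
    using in_vnaD(3)[OF assms(1) T] in_vnaD(3)[OF assms(2) T] blin_closed[OF in_vna_blin[OF assms(2)]]
    unfolding commutes_def by metis
qed

lemma in_vna_id: "in_vna A (\<lambda>f. f)"
  by (simp add: in_vna_def blin_id commutes_def)

lemma in_vna_plus:
  assumes "in_vna A S" "in_vna A S'" shows "in_vna A (\<lambda>f i. S f i + S' f i)"
  unfolding in_vna_def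
proof (intro conjI ballI)
  show "blin (\<lambda>f i. S f i + S' f i)" by (rule blin_plus[OF in_vna_blin[OF assms(1)] in_vna_blin[OF assms(2)]])
  fix T assume T: "T \<in> commutant l2 A"
  show "commutes T (\<lambda>f i. S f i + S' f i)" unfolding commutes_def
  proof
    fix f :: "'a \<Rightarrow> complex" assume f: "f \<in> carrier l2"
    have "T (\<lambda>i. S f i + S' f i) = (\<lambda>i. T (S f) i + T (S' f) i)"
      by (rule blin_add[OF in_vnaD(2)[OF assms(1) T]])
         (simp_all add: f blin_closed[OF in_vna_blin[OF assms(1)]] blin_closed[OF in_vna_blin[OF assms(2)]])
    then show "T (\<lambda>i. S f i + S' f i) = (\<lambda>i. S (T f) i + S' (T f) i)"
      using in_vnaD(3)[OF assms(1) T f] in_vnaD(3)[OF assms(2) T f] by simp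
  qed
qed

lemma in_vna_scale:
  assumes "in_vna A S" shows "in_vna A (\<lambda>f i. c * S f i)"
  unfolding in_vna_def
proof (intro conjI ballI)
  show "blin (\<lambda>f i. c * S f i)" by (rule blin_scale[OF in_vna_blin[OF assms]])
  fix T assume T: "T \<in> commutant l2 A"
  then show "commutes T (\<lambda>f i. c * S f i)"
    using in_vnaD(3)[OF assms T] blin_smult[OF in_vnaD(2)[OF assms T] blin_closed[OF in_vna_blin[OF assms]]]
    by (simp add: commutes_def)
qed

lemma in_vna_minus: "in_vna A S \<Longrightarrow> in_vna A S' \<Longrightarrow> in_vna A (\<lambda>f i. S f i - S' f i)"
  using in_vna_plus[of A S "\<lambda>f i. (-1) * S' f i"] in_vna_scale[of A S' "-1"] by simp

lemma in_vna_adj: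
  assumes "star_closed A" "in_vna A S" "adj_pair S S'" shows "in_vna A S'"
  unfolding in_vna_def
proof (intro conjI ballI)
  show "blin S'" using assms(3) by (rule adj_pairD)
  fix T assume T: "T \<in> commutant l2 A"
  then have bT: "blin T" by (simp add: mem_commutant_l2 bounded_op_l2)
  have "op_adjoint l2 T \<in> commutant l2 A"
    using commutant_star_closed[OF assms(1)] T by (simp add: star_closed_def)
  then have "commutes (op_adjoint l2 T) S" using assms(2) by (simp add: in_vna_def)
  then show "commutes T S'"
    by (rule commutes_adj[OF adj_pair_sym[OF adj_pair_op_adjoint[OF bT]] assms(3)])
qed

text \<open>If \<open>T\<close> commutes with \<open>q\<close>, then \<open>T\<close> leaves the range of \<open>q\<close> invariant, that is \<open>T P = P T P\<close>.
  The adjoint of \<open>T\<close> commutes with \<open>q\<close> as well whenever \<open>T\<close> is in the commutant, which gives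
  \<open>P T = P T P\<close>.\<close>

lemma in_vna_range_projection:
  assumes A: "star_closed A" and q: "in_vna A q" and P: "adj_pair P P"
    and qP: "\<And>f. f \<in> carrier l2 \<Longrightarrow> q (P f) = P f" and Pq: "\<And>f. f \<in> carrier l2 \<Longrightarrow> P (q f) = q f"
  shows "in_vna A P"
  unfolding in_vna_def
proof (intro conjI ballI)
  note bP = adj_pairD(1)[OF P]
  show "blin P" by (rule bP)
  have *: "T (P f) = P (T (P f))" if T: "T \<in> commutant l2 A" and f: "f \<in> carrier l2" for T f
  proof -
    have Pf: "P f \<in> carrier l2" by (rule blin_closed[OF bP f])
    have "T (P f) = q (T (P f))" using in_vnaD(3)[OF q T Pf] qP[OF f] by simp
    then show ?thesis using Pq[OF blin_closed[OF in_vnaD(2)[OF q T] Pf]] by simp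
  qed
  fix T assume T: "T \<in> commutant l2 A"
  have bT: "blin T" by (rule in_vnaD(2)[OF q T])
  define T' where "T' = op_adjoint l2 T"
  have T': "T' \<in> commutant l2 A"
    using commutant_star_closed[OF A] T by (simp add: star_closed_def T'_def)
  have TT': "adj_pair T T'" unfolding T'_def by (rule adj_pair_op_adjoint[OF bT])
  note [simp] = blin_closed[OF bP] blin_closed[OF bT] blin_closed[OF adj_pairD(2)[OF TT']]
  have "P (T f) = P (T (P f))" if f: "f \<in> carrier l2" for f
  proof (rule l2_eq_by_cinner)
    fix g :: "'a \<Rightarrow> complex" assume g: "g \<in> carrier l2"
    have "cinner l2 (P (T f)) g = cinner l2 f (T' (P g))"
      using f g by (simp add: adj_pairD(3)[OF P] adj_pairD(3)[OF TT'])
    also have "\<dots> = cinner l2 f (P (T' (P g)))" using *[OF T' g] by simp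
    also have "\<dots> = cinner l2 (P (T (P f))) g"
      using f g by (simp add: adj_pairD(3)[OF P] adj_pairD(3)[OF TT'])
    finally show "cinner l2 (P (T f)) g = cinner l2 (P (T (P f))) g" .
  qed
  then show "commutes T P" using *[OF T] unfolding commutes_def by metis
qed

text \<open>All concrete operators are sums and products of operators whose matrix has at most one
  nonzero entry in every row and every column. Such an operator has an adjoint of the same
  kind.\<close>

definition weighted_pullback :: "('i \<Rightarrow> complex) \<Rightarrow> ('i \<Rightarrow> 'i) \<Rightarrow> ('i \<Rightarrow> complex) \<Rightarrow> 'i \<Rightarrow> complex" where
  "weighted_pullback a \<phi> f = (\<lambda>i. a i * f (\<phi> i))"

lemma blin_weighted_pullback:
  assumes C: "\<And>i. cmod (a i) \<le> C" and inj: "inj_on \<phi> {i. a i \<noteq> 0}"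
  shows "blin (weighted_pullback a \<phi>)"
proof -
  have C0: "0 \<le> C" using order_trans[OF norm_ge_zero C] .
  have le: "L2_set (\<lambda>i. cmod (weighted_pullback a \<phi> f i)) F \<le> C * hnorm l2 f" if F: "finite F" and f: "f \<in> carrier l2" for F f
  proof -
    let ?F = "F \<inter> {i. a i \<noteq> 0}"
    have "(\<Sum>i\<in>F. (cmod (weighted_pullback a \<phi> f i))\<^sup>2) = (\<Sum>i\<in>?F. (cmod (weighted_pullback a \<phi> f i))\<^sup>2)"
      using F by (intro sum.mono_neutral_right) (auto simp: weighted_pullback_def)
    also have "\<dots> \<le> (\<Sum>i\<in>?F. C\<^sup>2 * (cmod (f (\<phi> i)))\<^sup>2)"
      by (intro sum_mono) (auto simp: weighted_pullback_def norm_mult power_mult_distrib C intro!: mult_right_mono power_mono)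
    also have "\<dots> = C\<^sup>2 * (\<Sum>j\<in>\<phi> ` ?F. (cmod (f j))\<^sup>2)"
      using inj by (subst sum.reindex) (auto simp: sum_distrib_left intro: inj_on_subset)
    also have "\<dots> = (C * L2_set (\<lambda>j. cmod (f j)) (\<phi> ` ?F))\<^sup>2"
      by (simp add: L2_set_def power_mult_distrib sum_nonneg)
    also have "\<dots> \<le> (C * hnorm l2 f)\<^sup>2"
      by (intro power_mono mult_left_mono L2_set_le_hnorm f C0) (simp add: C0)
    finally show ?thesis using C0 f by (simp add: L2_set_def real_le_lsqrt sum_nonneg)
  qed
  show ?thesis
    by (rule blinI[of _ C]) (use l2_bounded_partial_sums[OF le] in \<open>auto simp: weighted_pullback_def algebra_simps\<close>)
qed

lemma adj_pair_weighted_pullback: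
  assumes C: "\<And>i. cmod (a i) \<le> C"
    and inv: "\<And>i. a i \<noteq> 0 \<Longrightarrow> b (\<phi> i) = cnj (a i) \<and> \<psi> (\<phi> i) = i"
             "\<And>j. b j \<noteq> 0 \<Longrightarrow> a (\<psi> j) = cnj (b j) \<and> \<phi> (\<psi> j) = j"
  shows "adj_pair (weighted_pullback a \<phi>) (weighted_pullback b \<psi>)"
proof (rule adj_pairI)
  show "blin (weighted_pullback a \<phi>)" by (rule blin_weighted_pullback[OF C]) (metis (mono_tags, lifting) inj_onI inv(1) mem_Collect_eq)
  show "blin (weighted_pullback b \<psi>)"
  proof (rule blin_weighted_pullback)
    show "inj_on \<psi> {i. b i \<noteq> 0}" by (metis (mono_tags, lifting) inj_onI inv(2) mem_Collect_eq)
    show "cmod (b j) \<le> C" for j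
      using inv(2)[of j] C[of "\<psi> j"] order_trans[OF norm_ge_zero C] by (cases "b j = 0") auto
  qed
  fix f g :: "'a \<Rightarrow> complex"
  have bij: "bij_betw \<psi> {j. b j \<noteq> 0} {i. a i \<noteq> 0}"
    by (rule bij_betw_byWitness[where f' = \<phi>]) (use inv in force)+
  have "cinner l2 (weighted_pullback a \<phi> f) g = (\<Sum>\<^sub>\<infinity>i\<in>{i. a i \<noteq> 0}. a i * f (\<phi> i) * cnj (g i))"
    unfolding cinner_l2 weighted_pullback_def by (rule infsum_cong_neutral) auto
  also have "\<dots> = (\<Sum>\<^sub>\<infinity>j\<in>{j. b j \<noteq> 0}. a (\<psi> j) * f (\<phi> (\<psi> j)) * cnj (g (\<psi> j)))"
    by (rule infsum_reindex_bij_betw[OF bij, symmetric])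
  also have "\<dots> = cinner l2 f (weighted_pullback b \<psi> g)"
    unfolding cinner_l2 weighted_pullback_def by (rule infsum_cong_neutral) (auto simp: inv(2))
  finally show "cinner l2 (weighted_pullback a \<phi> f) g = cinner l2 f (weighted_pullback b \<psi> g)" .
qed

lemma adj_pair_trunc: "adj_pair (trunc F) (trunc F)"
proof -
  have "trunc F = weighted_pullback (\<lambda>i. if i \<in> F then 1 else 0) (\<lambda>i. i)"
    by (auto simp: fun_eq_iff trunc_def weighted_pullback_def)
  then show ?thesis
    using adj_pair_weighted_pullback[of "\<lambda>i. if i \<in> F then 1 else 0" 1 "\<lambda>i. if i \<in> F then 1 else 0" "\<lambda>i. i" "\<lambda>i. i"] by simp
qed

text \<open>An operator that commutes with the diagonal operator \<open>d\<close> has no matrix entries between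
  coordinates at which \<open>d\<close> differs. Applied to the adjoint, this says that each coordinate
  of \<open>T f\<close> depends only on the coordinates of \<open>f\<close> with the same value of \<open>d\<close>.\<close>

lemma in_vna_spectral_projection:
  assumes A: "star_closed A" and D: "in_vna A (weighted_pullback d (\<lambda>i. i))"
  shows "in_vna A (trunc {i. d i = c})"
  unfolding in_vna_def
proof (intro conjI ballI)
  show "blin (trunc {i. d i = c})" by (rule adj_pairD[OF adj_pair_trunc])
  have off: "T (basis_vec j) i = 0" if T: "T \<in> commutant l2 A" and "d i \<noteq> d j" for T i j
  proof -
    have "d i * T (basis_vec j) i = weighted_pullback d (\<lambda>i. i) (T (basis_vec j)) i" by (simp add: weighted_pullback_def)
    also have "\<dots> = T (weighted_pullback d (\<lambda>i. i) (basis_vec j)) i" using in_vnaD(3)[OF D T] by simp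
    also have "weighted_pullback d (\<lambda>i. i) (basis_vec j) = (\<lambda>i. d j * basis_vec j i)"
      by (auto simp: weighted_pullback_def basis_vec_def)
    also have "T \<dots> i = d j * T (basis_vec j) i" using blin_smult[OF in_vnaD(2)[OF D T]] by simp
    finally show ?thesis using \<open>d i \<noteq> d j\<close> by simp
  qed
  fix T assume T: "T \<in> commutant l2 A"
  have bT: "blin T" by (rule in_vnaD(2)[OF D T])
  define T' where "T' = op_adjoint l2 T"
  have T': "T' \<in> commutant l2 A"
    using commutant_star_closed[OF A] T by (simp add: star_closed_def T'_def)
  have TT': "adj_pair T T'" unfolding T'_def by (rule adj_pair_op_adjoint[OF bT])
  show "commutes T (trunc {i. d i = c})" unfolding commutes_def
  proof (intro ballI ext)
    fix f :: "'a \<Rightarrow> complex" and i assume f: "f \<in> carrier l2"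
    have "T (trunc {i. d i = c} f) i = (\<Sum>\<^sub>\<infinity>j. trunc {i. d i = c} f j * cnj (T' (basis_vec i) j))"
      using adj_pair_coord[OF TT' trunc_closed[OF f]] by (simp add: cinner_l2)
    also have "\<dots> = (\<Sum>\<^sub>\<infinity>j. (if d i = c then 1 else 0) * (f j * cnj (T' (basis_vec i) j)))"
      using off[OF T'] by (intro infsum_cong) (auto simp: trunc_def)
    also have "\<dots> = (if d i = c then 1 else 0) * cinner l2 f (T' (basis_vec i))"
      by (simp add: cinner_l2)
    also have "\<dots> = trunc {i. d i = c} (T f) i"
      by (simp add: trunc_def adj_pair_coord[OF TT' f])
    finally show "T (trunc {i. d i = c} f) i = trunc {i. d i = c} (T f) i" .
  qed
qed

text \<open>An infinite block diagonal operator belongs to the von Neumann algebra if its blocks do: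
  commutation can be tested one coordinate at a time, and a coordinate sees one block only.
  This replaces a limit in the strong operator topology.\<close>

lemma in_vna_by_blocks:
  assumes S: "blin S" and proj: "\<And>s. in_vna A (trunc {i. sec i = s})"
    and blk: "\<And>s. in_vna A (\<lambda>f. trunc {i. sec i = s} (S f))"
  shows "in_vna A S"
  unfolding in_vna_def
proof (intro conjI ballI S)
  fix T assume T: "T \<in> commutant l2 A"
  have bT: "blin T" by (rule in_vnaD(2)[OF proj T])
  show "commutes T S" unfolding commutes_def
  proof (intro ballI ext)
    fix f :: "'a \<Rightarrow> complex" and i assume f: "f \<in> carrier l2"
    let ?t = "trunc {j. sec j = sec i}"
    have "T (S f) i = ?t (T (S f)) i" by (simp add: trunc_def)
    also have "\<dots> = T (?t (S f)) i" using in_vnaD(3)[OF proj T] blin_closed[OF S f] by simp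
    also have "\<dots> = ?t (S (T f)) i" using in_vnaD(3)[OF blk T f] by simp
    finally show "T (S f) i = S (T f) i" by (simp add: trunc_def)
  qed
qed

section \<open>Representations given by idempotents\<close>

fun letter_op :: "(nat \<Rightarrow> ('i \<Rightarrow> complex) \<Rightarrow> 'i \<Rightarrow> complex) \<Rightarrow> letter \<Rightarrow> ('i \<Rightarrow> complex) \<Rightarrow> 'i \<Rightarrow> complex" where
  "letter_op q (Gen k) = q k"
| "letter_op q (Adj k) = op_adjoint l2 (q k)"

definition word_op :: "(nat \<Rightarrow> ('i \<Rightarrow> complex) \<Rightarrow> 'i \<Rightarrow> complex) \<Rightarrow> letter list \<Rightarrow> ('i \<Rightarrow> complex) \<Rightarrow> 'i \<Rightarrow> complex" where
  "word_op q w = foldr (letter_op q) w"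

definition eval_free :: "(nat \<Rightarrow> ('i \<Rightarrow> complex) \<Rightarrow> 'i \<Rightarrow> complex) \<Rightarrow> (letter list \<Rightarrow> complex) \<Rightarrow> ('i \<Rightarrow> complex) \<Rightarrow> 'i \<Rightarrow> complex" where
  "eval_free q a = (\<lambda>f\<in>carrier l2. (\<lambda>i. \<Sum>w | a w \<noteq> 0. a w * word_op q w f i))"

lemma word_op_Nil [simp]: "word_op q [] f = f"
  by (simp add: word_op_def)

lemma word_op_Cons [simp]: "word_op q (l # w) f = letter_op q l (word_op q w f)"
  by (simp add: word_op_def)

lemma word_op_append: "word_op q (u @ v) f = word_op q u (word_op q v f)"
  by (simp add: word_op_def)

lemma word_adj_simps [simp]: "word_adj [] = []" "word_adj (l # w) = word_adj w @ [letter_adj l]"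
  by (simp_all add: word_adj_def)

lemma free_simps [simp]:
  "f \<otimes>\<^bsub>free_star_algebra n\<^esub> g = (\<lambda>w. \<Sum>i\<le>length w. f (take i w) * g (drop i w))"
  "\<one>\<^bsub>free_star_algebra n\<^esub> = (\<lambda>w. if w = [] then 1 else 0)"
  "\<zero>\<^bsub>free_star_algebra n\<^esub> = (\<lambda>w. 0)"
  "f \<oplus>\<^bsub>free_star_algebra n\<^esub> g = (\<lambda>w. f w + g w)"
  "c \<odot>\<^bsub>free_star_algebra n\<^esub> f = (\<lambda>w. c * f w)"
  "invol (free_star_algebra n) f = (\<lambda>w. cnj (f (word_adj w)))"
  by (simp_all add: free_star_algebra_def)

lemma free_carrier:
  "a \<in> carrier (free_star_algebra n) \<longleftrightarrow>
    finite {w. a w \<noteq> 0} \<and> {w. a w \<noteq> 0} \<subseteq> lists (Gen ` {1..n} \<union> Adj ` {1..n})"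
  by (simp add: free_star_algebra_def)

lemma free_gen_closed: "k \<in> {1..n} \<Longrightarrow> free_gen k \<in> carrier (free_star_algebra n)"
proof -
  have "{w. free_gen k w \<noteq> 0} = {[Gen k]}" by (auto simp: free_gen_def)
  then show "k \<in> {1..n} \<Longrightarrow> ?thesis" by (simp add: free_carrier)
qed

lemma free_invol_closed:
  assumes a: "a \<in> carrier (free_star_algebra n)"
  shows "invol (free_star_algebra n) a \<in> carrier (free_star_algebra n)"
proof -
  have supp: "{w. invol (free_star_algebra n) a w \<noteq> 0} = word_adj ` {w. a w \<noteq> 0}"
    using word_adj_word_adj by (auto simp: image_iff) metis
  have letter: "letter_adj l \<in> Gen ` {1..n} \<union> Adj ` {1..n}" if "l \<in> Gen ` {1..n} \<union> Adj ` {1..n}" for l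
    using that by auto
  show ?thesis using a letter unfolding free_carrier supp
    by (fastforce simp: word_adj_def subset_iff)
qed

text \<open>The reason why the evaluation of words is multiplicative: cutting a word into two parts is
  inverse to concatenation.\<close>

lemma sum_splittings:
  fixes F :: "'a list \<Rightarrow> 'a list \<Rightarrow> complex"
  assumes A: "finite A" and B: "finite B" and F: "\<And>u v. u \<notin> A \<or> v \<notin> B \<Longrightarrow> F u v = 0"
  shows "(\<Sum>w\<in>(\<lambda>(u,v). u @ v) ` (A \<times> B). \<Sum>i\<le>length w. F (take i w) (drop i w)) = (\<Sum>u\<in>A. \<Sum>v\<in>B. F u v)"
proof -
  let ?W = "(\<lambda>(u,v). u @ v) ` (A \<times> B)"
  let ?S = "Sigma ?W (\<lambda>w. {..length w})"
  let ?T = "{(w,i). i \<le> length w \<and> take i w \<in> A \<and> drop i w \<in> B}"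
  have W: "finite ?W" using A B by simp
  have "(\<Sum>w\<in>?W. \<Sum>i\<le>length w. F (take i w) (drop i w)) = (\<Sum>(w,i)\<in>?S. F (take i w) (drop i w))"
    using W by (intro sum.Sigma) auto
  also have "\<dots> = (\<Sum>(w,i)\<in>?T. F (take i w) (drop i w))"
  proof (rule sum.mono_neutral_right)
    show "finite ?S" using W by simp
    show "?T \<subseteq> ?S" by (auto intro!: image_eqI[of _ _ "(take _ _, drop _ _)"])
    show "\<forall>x\<in>?S - ?T. (case x of (w, i) \<Rightarrow> F (take i w) (drop i w)) = 0" using F by fastforce
  qed
  also have "\<dots> = (\<Sum>(u,v)\<in>A \<times> B. F u v)"
    by (rule sum.reindex_bij_witness[of _ "\<lambda>(u,v). (u @ v, length u)" "\<lambda>(w,i). (take i w, drop i w)"])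
      (auto simp: min_def)
  also have "\<dots> = (\<Sum>u\<in>A. \<Sum>v\<in>B. F u v)" using A B by (simp add: sum.cartesian_product)
  finally show ?thesis .
qed

context
  fixes q :: "nat \<Rightarrow> ('i \<Rightarrow> complex) \<Rightarrow> 'i \<Rightarrow> complex"
  assumes blin_q: "\<And>k. blin (q k)"
begin

lemma letter_op_adj: "adj_pair (letter_op q l) (letter_op q (letter_adj l))"
  using adj_pair_op_adjoint[OF blin_q] adj_pair_sym[OF adj_pair_op_adjoint[OF blin_q]]
  by (cases l) auto

lemma word_op_adj: "adj_pair (word_op q w) (word_op q (word_adj w))"
proof (induction w)
  case Nil
  then show ?case by (simp add: adj_pair_def blin_id[unfolded id_def] word_op_def id_def)
next
  case (Cons l w)
  have "(\<lambda>f. letter_op q l (word_op q w f)) = word_op q (l # w)"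
    and "(\<lambda>f. word_op q (word_adj w) (letter_op q (letter_adj l) f)) = word_op q (word_adj (l # w))"
    by (simp_all add: fun_eq_iff word_op_append)
  then show ?case using adj_pair_comp[OF letter_op_adj Cons.IH, of l] by simp
qed

lemma blin_word_op: "blin (word_op q w)"
  by (rule adj_pairD(1)[OF word_op_adj])

lemma eval_free_superset:
  assumes "finite W" "{w. a w \<noteq> 0} \<subseteq> W" "f \<in> carrier l2"
  shows "eval_free q a f = (\<lambda>i. \<Sum>w\<in>W. a w * word_op q w f i)"
proof
  fix i
  have "(\<Sum>w | a w \<noteq> 0. a w * word_op q w f i) = (\<Sum>w\<in>W. a w * word_op q w f i)"
    using assms by (intro sum.mono_neutral_left) auto
  then show "eval_free q a f i = (\<Sum>w\<in>W. a w * word_op q w f i)"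
    using assms(3) by (simp add: eval_free_def)
qed

lemma bounded_op_eval_free: "bounded_op l2 (eval_free q a)"
  unfolding eval_free_def
  by (rule bounded_op_restrict, rule blin_finite_sum, rule blin_scale, rule blin_word_op)

lemma eval_free_closed: "f \<in> carrier l2 \<Longrightarrow> eval_free q a f \<in> carrier l2"
  using blin_closed[of "eval_free q a" f] bounded_op_eval_free[of a] by (simp add: bounded_op_l2)

lemma eval_free_add:
  assumes "a \<in> carrier (free_star_algebra n)" "b \<in> carrier (free_star_algebra n)"
  shows "eval_free q (a \<oplus>\<^bsub>free_star_algebra n\<^esub> b) = eval_free q a \<oplus>\<^bsub>BH l2\<^esub> eval_free q b"
proof -
  let ?W = "{w. a w \<noteq> 0} \<union> {w. b w \<noteq> 0}"
  have W: "finite ?W" "{w. a w \<noteq> 0} \<subseteq> ?W" "{w. b w \<noteq> 0} \<subseteq> ?W" "{w. a w + b w \<noteq> 0} \<subseteq> ?W"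
    using assms by (auto simp: free_carrier)
  show ?thesis
  proof (rule extensionalityI)
    fix f :: "'i \<Rightarrow> complex" assume f: "f \<in> carrier l2"
    show "eval_free q (a \<oplus>\<^bsub>free_star_algebra n\<^esub> b) f = (eval_free q a \<oplus>\<^bsub>BH l2\<^esub> eval_free q b) f"
      using f by (simp add: eval_free_superset[OF W(1,2) f] eval_free_superset[OF W(1,3) f]
          eval_free_superset[OF W(1,4) f] distrib_right sum.distrib)
  qed (auto simp: eval_free_def)
qed

lemma eval_free_smult:
  assumes "a \<in> carrier (free_star_algebra n)"
  shows "eval_free q (c \<odot>\<^bsub>free_star_algebra n\<^esub> a) = c \<odot>\<^bsub>BH l2\<^esub> eval_free q a"
proof -
  let ?W = "{w. a w \<noteq> 0}"
  have W: "finite ?W" "?W \<subseteq> ?W" "{w. c * a w \<noteq> 0} \<subseteq> ?W"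
    using assms by (auto simp: free_carrier)
  show ?thesis
  proof (rule extensionalityI)
    fix f :: "'i \<Rightarrow> complex" assume f: "f \<in> carrier l2"
    show "eval_free q (c \<odot>\<^bsub>free_star_algebra n\<^esub> a) f = (c \<odot>\<^bsub>BH l2\<^esub> eval_free q a) f"
      using f by (simp add: eval_free_superset[OF W(1,2) f] eval_free_superset[OF W(1,3) f] sum_distrib_left mult.assoc)
  qed (auto simp: eval_free_def)
qed

lemma eval_free_one: "eval_free q \<one>\<^bsub>free_star_algebra n\<^esub> = \<one>\<^bsub>BH l2\<^esub>"
proof (rule extensionalityI)
  fix f :: "'i \<Rightarrow> complex" assume f: "f \<in> carrier l2"
  show "eval_free q \<one>\<^bsub>free_star_algebra n\<^esub> f = \<one>\<^bsub>BH l2\<^esub> f"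
    using f by (subst eval_free_superset[of "{[]}"]) auto
qed (auto simp: eval_free_def)

lemma eval_free_gen: "f \<in> carrier l2 \<Longrightarrow> eval_free q (free_gen k) f = q k f"
  by (subst eval_free_superset[of "{[Gen k]}"]) (auto simp: free_gen_def)

lemma eval_free_mult:
  assumes a: "a \<in> carrier (free_star_algebra n)" and b: "b \<in> carrier (free_star_algebra n)"
  shows "eval_free q (a \<otimes>\<^bsub>free_star_algebra n\<^esub> b) = eval_free q a \<otimes>\<^bsub>BH l2\<^esub> eval_free q b"
proof -
  let ?A = "{w. a w \<noteq> 0}" and ?B = "{w. b w \<noteq> 0}"
  let ?W = "(\<lambda>(u,v). u @ v) ` (?A \<times> ?B)"
  let ?ab = "a \<otimes>\<^bsub>free_star_algebra n\<^esub> b"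
  have fin: "finite ?A" "finite ?B" "finite ?W" using assms by (auto simp: free_carrier)
  have sub: "{w. ?ab w \<noteq> 0} \<subseteq> ?W"
  proof
    fix w assume "w \<in> {w. ?ab w \<noteq> 0}"
    then have "(\<Sum>i\<le>length w. a (take i w) * b (drop i w)) \<noteq> 0" by simp
    then obtain i where "a (take i w) * b (drop i w) \<noteq> 0"
      by (rule sum.not_neutral_contains_not_neutral)
    then show "w \<in> ?W" by (intro image_eqI[of _ _ "(take i w, drop i w)"]) auto
  qed
  show ?thesis
  proof (rule extensionalityI)
    fix f :: "'i \<Rightarrow> complex" assume f: "f \<in> carrier l2"
    have g: "eval_free q b f \<in> carrier l2"
      by (rule eval_free_closed[OF f])
    show "eval_free q ?ab f = (eval_free q a \<otimes>\<^bsub>BH l2\<^esub> eval_free q b) f"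
    proof
      fix i
      have word: "word_op q u (eval_free q b f) i = (\<Sum>v\<in>?B. b v * word_op q (u @ v) f i)" for u
      proof -
        have "word_op q u (\<lambda>i. \<Sum>v\<in>?B. b v * word_op q v f i)
            = (\<lambda>i. \<Sum>v\<in>?B. word_op q u (\<lambda>i. b v * word_op q v f i) i)"
          by (rule blin_sum[OF blin_word_op]) (rule l2_smult_closed[OF blin_closed[OF blin_word_op f]])
        then show ?thesis
          by (simp add: eval_free_superset[OF fin(2) subset_refl f] word_op_append
            blin_smult[OF blin_word_op blin_closed[OF blin_word_op f]])
      qed
      have "eval_free q ?ab f i = (\<Sum>w\<in>?W. ?ab w * word_op q w f i)"
        by (simp only: eval_free_superset[OF fin(3) sub f])
      also have "\<dots> = (\<Sum>w\<in>?W. \<Sum>j\<le>length w. a (take j w) * b (drop j w) * word_op q (take j w @ drop j w) f i)"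
        by (simp add: sum_distrib_right)
      also have "\<dots> = (\<Sum>u\<in>?A. \<Sum>v\<in>?B. a u * b v * word_op q (u @ v) f i)"
        using fin by (intro sum_splittings) auto
      also have "\<dots> = (\<Sum>u\<in>?A. a u * word_op q u (eval_free q b f) i)"
        by (simp add: word sum_distrib_left mult.assoc)
      also have "\<dots> = eval_free q a (eval_free q b f) i"
        by (simp add: eval_free_superset[OF fin(1) subset_refl g])
      finally show "eval_free q ?ab f i = (eval_free q a \<otimes>\<^bsub>BH l2\<^esub> eval_free q b) f i"
        using f by (simp add: compose_def)
    qed
  qed (auto simp: eval_free_def compose_def)
qed

lemma eval_free_invol:
  assumes a: "a \<in> carrier (free_star_algebra n)"
  shows "eval_free q (invol (free_star_algebra n) a) = invol (BH l2) (eval_free q a)"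
proof -
  let ?A = "{w. a w \<noteq> 0}"
  let ?b = "invol (free_star_algebra n) a"
  have fin: "finite ?A" using a by (simp add: free_carrier)
  have supp: "{w. ?b w \<noteq> 0} = word_adj ` ?A"
    using word_adj_word_adj by (auto simp: image_iff) metis
  have inj: "inj_on word_adj ?A" by (metis inj_onI word_adj_word_adj)
  have ext: "restrict (eval_free q a) (carrier l2) = eval_free q a" for a
    by (simp add: eval_free_def)
  have "adj_pair (eval_free q a) (eval_free q ?b)"
  proof (rule adj_pairI)
    fix f g :: "'i \<Rightarrow> complex" assume f: "f \<in> carrier l2" and g: "g \<in> carrier l2"
    have cl: "(\<lambda>i. c * word_op q w h i) \<in> carrier l2" if "h \<in> carrier l2" for c w h
      by (rule l2_smult_closed[OF blin_closed[OF blin_word_op that]])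
    have left: "cinner l2 (\<lambda>i. \<Sum>w\<in>W. a w * word_op q w f i) g = (\<Sum>w\<in>W. a w * cinner l2 (word_op q w f) g)"
      if "finite W" for W using that
    proof induction
      case (insert x F)
      then show ?case
        using l2_cinner_add_left[OF cl[OF f, of "a x" x] l2_sum_closed[of F "\<lambda>w i. a w * word_op q w f i"] g]
        by (simp add: cl[OF f] l2_cinner_smult_left)
    qed (simp add: cinner_l2)
    have right: "cinner l2 f (\<lambda>i. \<Sum>w\<in>W. c w * word_op q (word_adj w) g i)
        = (\<Sum>w\<in>W. cnj (c w) * cinner l2 f (word_op q (word_adj w) g))"
      if "finite W" for W c using that
    proof induction
      case (insert x F)
      then show ?case
        using l2_cinner_add_right[OF cl[OF g, of "c x" "word_adj x"] l2_sum_closed[of F "\<lambda>w i. c w * word_op q (word_adj w) g i"] f]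
        by (simp add: cl[OF g] l2_cinner_smult_right)
    qed (simp add: cinner_l2)
    have eb: "eval_free q ?b g = (\<lambda>i. \<Sum>w\<in>?A. cnj (a w) * word_op q (word_adj w) g i)"
    proof -
      have "eval_free q ?b g = (\<lambda>i. \<Sum>w\<in>word_adj ` ?A. ?b w * word_op q w g i)"
        by (rule eval_free_superset[OF _ _ g]) (use fin supp in auto)
      then show ?thesis by (simp add: sum.reindex[OF inj] word_adj_word_adj)
    qed
    show "cinner l2 (eval_free q a f) g = cinner l2 f (eval_free q ?b g)"
      unfolding eb eval_free_superset[OF fin subset_refl f] left[OF fin] right[OF fin]
      by (simp add: adj_pairD(3)[OF word_op_adj f g])
  qed (use bounded_op_eval_free in \<open>auto simp: bounded_op_l2\<close>)
  from op_adjoint_eqI[OF this] show ?thesis by (simp only: ext BH_l2_simps)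
qed

lemma eval_free_hom: "eval_free q \<in> ring_hom (free_star_algebra n) (BH l2)"
  by (rule ring_hom_memI)
    (simp_all only: eval_free_mult eval_free_add eval_free_one, simp add: bounded_op_eval_free)

end


lemma finsum_BH_l2:
  fixes T :: "'k \<Rightarrow> ('i \<Rightarrow> complex) \<Rightarrow> 'i \<Rightarrow> complex"
  assumes "finite A" "\<And>k. k \<in> A \<Longrightarrow> bounded_op l2 (T k)" "f \<in> carrier l2"
  shows "(\<Oplus>\<^bsub>BH l2\<^esub>k\<in>A. T k) f = (\<lambda>i. \<Sum>k\<in>A. T k f i)"
proof -
  interpret ring "BH (l2 :: ('i \<Rightarrow> complex) hilbert)" by (rule ring_BH_l2)
  show ?thesis using assms(1,2)
  proof (induction A)
    case (insert a A)
    then have "(\<Oplus>\<^bsub>BH l2\<^esub>k\<in>insert a A. T k) = T a \<oplus>\<^bsub>BH l2\<^esub> (\<Oplus>\<^bsub>BH l2\<^esub>k\<in>A. T k)"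
      by (intro finsum_insert) auto
    with insert assms(3) show ?case by simp
  qed (simp add: assms(3))
qed

text \<open>Universal property: words are evaluated by composing operators, the evaluation \<^const>\<open>eval_free\<close>
  of the free algebra kills the relators and, being compatible with the involution, their
  adjoints. Hence it is constant on the cosets of the ideal. As \<open>\<pi>\<close> takes an arbitrary
  representative of a coset, the scalar multiples and adjoints in the quotient, which are
  unions of cosets, cause no difficulty.\<close>

lemma Q_algebra_representation:
  fixes q :: "nat \<Rightarrow> ('i \<Rightarrow> complex) \<Rightarrow> 'i \<Rightarrow> complex"
  assumes blin_q: "\<And>k. blin (q k)"
    and idem: "\<And>k f. k \<in> {1..n} \<Longrightarrow> f \<in> carrier l2 \<Longrightarrow> q k (q k f) = q k f"
    and sum: "\<And>f i. f \<in> carrier l2 \<Longrightarrow> (\<Sum>k=1..n. q k f i) = lam * f i"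
  obtains \<pi> where "\<pi> \<in> star_hom (Q_star_algebra n lam) (BH l2)"
    and "\<pi> ` carrier (Q_star_algebra n lam) = eval_free q ` carrier (free_star_algebra n)"
proof -
  let ?F = "free_star_algebra n" and ?B = "BH (l2 :: ('i \<Rightarrow> complex) hilbert)"
  let ?I = "Q_ideal n lam" and ?h = "eval_free q"
  interpret h: ring_hom_ring ?F ?B ?h
    by (intro ring_hom_ringI2 ring_free_star_algebra ring_BH_l2 eval_free_hom blin_q)
  note gen = free_gen_closed
  have smult_closed: "c \<odot>\<^bsub>?F\<^esub> a \<in> carrier ?F" if "a \<in> carrier ?F" for c a
    using that by (auto simp: free_carrier elim: rev_finite_subset)
  note invol_closed = free_invol_closed
  have hgen: "?h (free_gen k) = restrict (q k) (carrier l2)" for k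
    by (rule extensionalityI[of _ "carrier l2"]) (simp add: eval_free_def, simp, simp add: eval_free_gen[OF blin_q])
  have minus_0: "?h (a \<ominus>\<^bsub>?F\<^esub> b) = \<zero>\<^bsub>?B\<^esub>" if "a \<in> carrier ?F" "b \<in> carrier ?F" "?h a = ?h b" for a b
    using that by (simp add: a_minus_def h.S.r_neg del: BH_l2_simps free_simps)
  have idem_rel: "?h ((free_gen k \<otimes>\<^bsub>?F\<^esub> free_gen k) \<ominus>\<^bsub>?F\<^esub> free_gen k) = \<zero>\<^bsub>?B\<^esub>" if k: "k \<in> {1..n}" for k
  proof (rule minus_0)
    show "?h (free_gen k \<otimes>\<^bsub>?F\<^esub> free_gen k) = ?h (free_gen k)"
      unfolding eval_free_mult[OF blin_q gen[OF k] gen[OF k]] hgen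
      by (rule extensionalityI[of _ "carrier l2"])
         (simp_all add: compose_def idem[OF k] blin_closed[OF blin_q])
  qed (intro h.R.m_closed gen k)+
  have sum_rel: "?h ((\<Oplus>\<^bsub>?F\<^esub> k \<in> {1..n}. free_gen k) \<ominus>\<^bsub>?F\<^esub> lam \<odot>\<^bsub>?F\<^esub> \<one>\<^bsub>?F\<^esub>) = \<zero>\<^bsub>?B\<^esub>"
  proof (rule minus_0)
    show "(\<Oplus>\<^bsub>?F\<^esub> k \<in> {1..n}. free_gen k) \<in> carrier ?F" using gen by (intro h.R.finsum_closed) auto
    show "lam \<odot>\<^bsub>?F\<^esub> \<one>\<^bsub>?F\<^esub> \<in> carrier ?F" by (rule smult_closed[OF h.R.one_closed])
    have "?h (\<Oplus>\<^bsub>?F\<^esub> k \<in> {1..n}. free_gen k) = (\<Oplus>\<^bsub>?B\<^esub> k \<in> {1..n}. ?h (free_gen k))"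
      using h.hom_finsum[of free_gen "{1..n}"] gen by (simp add: Pi_iff comp_def)
    also have "\<dots> = ?h (lam \<odot>\<^bsub>?F\<^esub> \<one>\<^bsub>?F\<^esub>)"
      unfolding eval_free_smult[OF blin_q h.R.one_closed] eval_free_one[OF blin_q] hgen
    proof (rule extensionalityI[of _ "carrier l2"])
      show "(\<Oplus>\<^bsub>?B\<^esub>k\<in>{1..n}. restrict (q k) (carrier l2)) \<in> extensional (carrier l2)"
        using h.S.finsum_closed[of "\<lambda>k. restrict (q k) (carrier l2)" "{1..n}"] bounded_op_restrict[OF blin_q]
        by (simp add: Pi_iff bounded_op_l2)
      fix f :: "'i \<Rightarrow> complex" assume "f \<in> carrier l2"
      then show "(\<Oplus>\<^bsub>?B\<^esub>k\<in>{1..n}. restrict (q k) (carrier l2)) f = (lam \<odot>\<^bsub>?B\<^esub> \<one>\<^bsub>?B\<^esub>) f"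
        using sum by (subst finsum_BH_l2) (simp_all add: bounded_op_restrict[OF blin_q])
    qed simp
    finally show "?h (\<Oplus>\<^bsub>?F\<^esub> k \<in> {1..n}. free_gen k) = ?h (lam \<odot>\<^bsub>?F\<^esub> \<one>\<^bsub>?F\<^esub>)" .
  qed
  let ?K = "a_kernel ?F ?B ?h"
  have rel_closed: "Q_relators n lam \<subseteq> carrier ?F"
    using gen by (auto simp: Q_relators_def Let_def simp del: free_simps
      intro!: h.R.minus_closed h.R.finsum_closed smult_closed)
  have rel0: "?h a = \<zero>\<^bsub>?B\<^esub>" if "a \<in> Q_relators n lam" for a
    using that sum_rel idem_rel by (auto simp: Q_relators_def Let_def simp del: free_simps BH_l2_simps)
  have adj0: "invol ?B \<zero>\<^bsub>?B\<^esub> = \<zero>\<^bsub>?B\<^esub>"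
  proof -
    have "adj_pair \<zero>\<^bsub>?B\<^esub> (\<lambda>f i. 0)"
      by (rule adj_pairI) (simp_all add: blin_gens345rict[OF blin_const_zero] blin_const_zero cinner_l2)
    from op_adjoint_eqI[OF this] show ?thesis by simp
  qed
  have rels: "Q_relators n lam \<union> invol ?F ` Q_relators n lam \<subseteq> ?K"
  proof
    fix b assume "b \<in> Q_relators n lam \<union> invol ?F ` Q_relators n lam"
    then consider "b \<in> Q_relators n lam" | a where "a \<in> Q_relators n lam" "b = invol ?F a" by blast
    then have "b \<in> carrier ?F \<and> ?h b = \<zero>\<^bsub>?B\<^esub>"
    proof cases
      case 1
      then show ?thesis using rel_closed rel0 by blast
    next
      case 2
      then have "a \<in> carrier ?F" using rel_closed by blast
      then show ?thesis unfolding 2(2)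
        using invol_closed[of a n] eval_free_invol[OF blin_q, of a n] rel0[OF 2(1)] adj0 by (simp only:)
    qed
    then show "b \<in> ?K" unfolding a_kernel_def' by blast
  qed
  have I: "ideal ?I ?F" unfolding Q_ideal_def
    using rel_closed invol_closed by (intro h.R.genideal_ideal) blast
  have IK: "?I \<subseteq> ?K" unfolding Q_ideal_def
    by (rule h.R.genideal_minimal[OF h.kernel_is_ideal rels])
  interpret I: ideal ?I ?F by (rule I)
  have coset: "y \<in> carrier ?F \<and> ?h y = ?h x" if x: "x \<in> carrier ?F" and y: "y \<in> ?I +>\<^bsub>?F\<^esub> x" for x y
  proof -
    obtain i where i: "i \<in> ?I" "y = i \<oplus>\<^bsub>?F\<^esub> x" using y unfolding a_r_coset_def' by blast
    have i': "i \<in> carrier ?F" "?h i = \<zero>\<^bsub>?B\<^esub>" using IK i(1) unfolding a_kernel_def' by blast+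
    have "?h y = ?h x"
      unfolding i(2) h.hom_add[OF i'(1) x] i'(2) by (rule h.S.l_zero[OF h.hom_closed[OF x]])
    then show ?thesis unfolding i(2) using h.R.a_closed[OF i'(1) x] by blast
  qed
  define \<pi> where "\<pi> S = ?h (SOME x. x \<in> S)" for S
  have pi_eq: "\<pi> S = T" if "S \<noteq> {}" "\<And>y. y \<in> S \<Longrightarrow> ?h y = T" for S T
    unfolding \<pi>_def using that some_in_eq[of S] by auto
  have self: "x \<in> ?I +>\<^bsub>?F\<^esub> x" if "x \<in> carrier ?F" for x
    using that by (rule I.a_rcos_self)
  have pi: "\<pi> (?I +>\<^bsub>?F\<^esub> x) = ?h x" if "x \<in> carrier ?F" for x
    using coset[OF that] self[OF that] by (intro pi_eq) blast+
  have carr: "carrier (Q_star_algebra n lam) = (\<lambda>x. ?I +>\<^bsub>?F\<^esub> x) ` carrier ?F"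
    unfolding Q_star_algebra_def star_quotient_def FactRing_def A_RCOSETS_def' by auto
  have "\<pi> \<in> star_hom (Q_star_algebra n lam) ?B"
    unfolding star_hom_def
  proof (intro CollectI conjI allI ballI ring_hom_memI)
    fix S assume "S \<in> carrier (Q_star_algebra n lam)"
    then obtain x where x: "x \<in> carrier ?F" "S = ?I +>\<^bsub>?F\<^esub> x" by (auto simp: carr)
    show "\<pi> S \<in> carrier ?B" unfolding x(2) pi[OF x(1)] by (rule h.hom_closed[OF x(1)])
    have "\<pi> (\<Union>y\<in>S. ?I +>\<^bsub>?F\<^esub> (c \<odot>\<^bsub>?F\<^esub> y)) = c \<odot>\<^bsub>?B\<^esub> ?h x" for c
    proof (rule pi_eq)
      show "(\<Union>y\<in>S. ?I +>\<^bsub>?F\<^esub> (c \<odot>\<^bsub>?F\<^esub> y)) \<noteq> {}"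
        unfolding x(2) using self[OF x(1)] self[OF smult_closed[OF x(1), of c]] by blast
      fix z assume "z \<in> (\<Union>y\<in>S. ?I +>\<^bsub>?F\<^esub> (c \<odot>\<^bsub>?F\<^esub> y))"
      then obtain y where y: "y \<in> ?I +>\<^bsub>?F\<^esub> x" "z \<in> ?I +>\<^bsub>?F\<^esub> (c \<odot>\<^bsub>?F\<^esub> y)" unfolding x(2) by blast
      have y': "y \<in> carrier ?F" "?h y = ?h x" using coset[OF x(1) y(1)] by blast+
      have "?h z = ?h (c \<odot>\<^bsub>?F\<^esub> y)" using coset[OF smult_closed[OF y'(1)] y(2)] by blast
      then show "?h z = c \<odot>\<^bsub>?B\<^esub> ?h x" by (simp only: eval_free_smult[OF blin_q y'(1)] y'(2))
    qed
    then show "\<pi> (c \<odot>\<^bsub>Q_star_algebra n lam\<^esub> S) = c \<odot>\<^bsub>?B\<^esub> \<pi> S" for c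
      unfolding x(2) pi[OF x(1)] by (simp add: Q_star_algebra_def star_quotient_def del: free_simps BH_l2_simps)
    have "\<pi> (\<Union>y\<in>S. ?I +>\<^bsub>?F\<^esub> invol ?F y) = invol ?B (?h x)"
    proof (rule pi_eq)
      show "(\<Union>y\<in>S. ?I +>\<^bsub>?F\<^esub> invol ?F y) \<noteq> {}"
        unfolding x(2) using self[OF x(1)] self[OF invol_closed[OF x(1)]] by blast
      fix z assume "z \<in> (\<Union>y\<in>S. ?I +>\<^bsub>?F\<^esub> invol ?F y)"
      then obtain y where y: "y \<in> ?I +>\<^bsub>?F\<^esub> x" "z \<in> ?I +>\<^bsub>?F\<^esub> invol ?F y" unfolding x(2) by blast
      have y': "y \<in> carrier ?F" "?h y = ?h x" using coset[OF x(1) y(1)] by blast+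
      have "?h z = ?h (invol ?F y)" using coset[OF invol_closed[OF y'(1)] y(2)] by blast
      then show "?h z = invol ?B (?h x)" by (simp only: eval_free_invol[OF blin_q y'(1)] y'(2))
    qed
    then show "\<pi> (invol (Q_star_algebra n lam) S) = invol ?B (\<pi> S)"
      unfolding x(2) pi[OF x(1)] by (simp add: Q_star_algebra_def star_quotient_def del: free_simps BH_l2_simps)
    fix S' assume "S' \<in> carrier (Q_star_algebra n lam)"
    then obtain x' where x': "x' \<in> carrier ?F" "S' = ?I +>\<^bsub>?F\<^esub> x'" by (auto simp: carr)
    have "S \<otimes>\<^bsub>Q_star_algebra n lam\<^esub> S' = ?I +>\<^bsub>?F\<^esub> (x \<otimes>\<^bsub>?F\<^esub> x')"
      using I.rcoset_mult_add[OF x(1) x'(1)]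
      by (simp add: x x' Q_star_algebra_def star_quotient_def FactRing_def del: free_simps)
    then show "\<pi> (S \<otimes>\<^bsub>Q_star_algebra n lam\<^esub> S') = \<pi> S \<otimes>\<^bsub>?B\<^esub> \<pi> S'"
      using pi[OF h.R.m_closed[OF x(1) x'(1)]] h.hom_mult[OF x(1) x'(1)] pi[OF x(1)] pi[OF x'(1)] x(2) x'(2) by metis
    have "S \<oplus>\<^bsub>Q_star_algebra n lam\<^esub> S' = ?I +>\<^bsub>?F\<^esub> (x \<oplus>\<^bsub>?F\<^esub> x')"
      using I.a_rcos_sum[OF x(1) x'(1)]
      by (simp add: x x' Q_star_algebra_def star_quotient_def FactRing_def del: free_simps)
    then show "\<pi> (S \<oplus>\<^bsub>Q_star_algebra n lam\<^esub> S') = \<pi> S \<oplus>\<^bsub>?B\<^esub> \<pi> S'"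
      using pi[OF h.R.a_closed[OF x(1) x'(1)]] h.hom_add[OF x(1) x'(1)] pi[OF x(1)] pi[OF x'(1)] x(2) x'(2) by metis
  next
    have "\<one>\<^bsub>Q_star_algebra n lam\<^esub> = ?I +>\<^bsub>?F\<^esub> \<one>\<^bsub>?F\<^esub>"
      by (simp add: Q_star_algebra_def star_quotient_def FactRing_def del: free_simps)
    then show "\<pi> \<one>\<^bsub>Q_star_algebra n lam\<^esub> = \<one>\<^bsub>?B\<^esub>"
      using pi[OF h.R.one_closed] h.hom_one by metis
  qed
  moreover have "\<pi> ` carrier (Q_star_algebra n lam) = ?h ` carrier ?F"
    unfolding carr image_image using pi by (intro image_cong) auto
  ultimately show thesis using that by blast
qed

lemma star_closed_eval_free:
  assumes blin_q: "\<And>k. blin (q k)"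
  shows "star_closed (eval_free q ` carrier (free_star_algebra n))"
  unfolding star_closed_def
proof (intro ballI conjI)
  fix T assume "T \<in> eval_free q ` carrier (free_star_algebra n)"
  then obtain a where a: "a \<in> carrier (free_star_algebra n)" "T = eval_free q a" by blast
  show "bounded_op l2 T" unfolding a(2) by (rule bounded_op_eval_free[OF blin_q])
  show "op_adjoint l2 T \<in> eval_free q ` carrier (free_star_algebra n)"
    unfolding a(2) eval_free_invol[OF blin_q a(1), unfolded BH_l2_simps, symmetric]
    by (rule imageI[OF free_invol_closed[OF a(1)]])
qed

lemma in_vna_eval_free:
  assumes blin_q: "\<And>k. blin (q k)" and k: "k \<in> {1..n}"
  shows "in_vna (eval_free q ` carrier (free_star_algebra n)) (q k)"
  unfolding in_vna_def
proof (intro conjI ballI blin_q)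
  fix T assume "T \<in> commutant l2 (eval_free q ` carrier (free_star_algebra n))"
  then have "commutes T (eval_free q (free_gen k))" "blin T"
    using free_gen_closed[OF k] by (auto simp: mem_commutant_l2 bounded_op_l2)
  then show "commutes T (q k)" by (rule commutes_cong_right) (rule eval_free_gen[OF blin_q])
qed

lemma commutant_eval_freeI:
  assumes blin_q: "\<And>k. blin (q k)" and T: "blin T"
    and gens: "\<And>k. k \<in> {1..n} \<Longrightarrow> commutes T (q k)"
    and adjs: "\<And>k. k \<in> {1..n} \<Longrightarrow> commutes T (op_adjoint l2 (q k))"
  shows "restrict T (carrier l2) \<in> commutant l2 (eval_free q ` carrier (free_star_algebra n))"
  unfolding mem_commutant_l2
proof (intro conjI ballI bounded_op_restrict T)
  fix S assume "S \<in> eval_free q ` carrier (free_star_algebra n)"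
  then obtain a where a: "a \<in> carrier (free_star_algebra n)" "S = eval_free q a" by blast
  let ?W = "{w. a w \<noteq> 0}"
  have fin: "finite ?W" and W: "?W \<subseteq> lists (Gen ` {1..n} \<union> Adj ` {1..n})" using a(1) by (auto simp: free_carrier)
  have bw: "word_op q w f \<in> carrier l2" if "f \<in> carrier l2" for w f
    by (rule blin_closed[OF blin_word_op[OF blin_q] that])
  have word: "T (word_op q w f) = word_op q w (T f)"
    if "w \<in> lists (Gen ` {1..n} \<union> Adj ` {1..n})" "f \<in> carrier l2" for w f
    using that(1)
  proof induction
    case (Cons l w)
    have "T (letter_op q l (word_op q w f)) = letter_op q l (T (word_op q w f))"
      using Cons.hyps gens adjs bw[OF that(2)] by (auto simp: commutes_def)
    then show ?case by (simp add: Cons.IH)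
  qed simp
  have "T (eval_free q a f) = eval_free q a (T f)" if f: "f \<in> carrier l2" for f
  proof -
    have "T (eval_free q a f) = T (\<lambda>i. \<Sum>w\<in>?W. a w * word_op q w f i)"
      by (simp only: eval_free_superset[OF blin_q fin subset_refl f])
    also have "\<dots> = (\<lambda>i. \<Sum>w\<in>?W. T (\<lambda>i. a w * word_op q w f i) i)"
      by (rule blin_sum[OF T]) (rule l2_smult_closed[OF bw[OF f]])
    also have "\<dots> = (\<lambda>i. \<Sum>w\<in>?W. a w * word_op q w (T f) i)"
    proof (intro ext sum.cong refl)
      fix w i assume "w \<in> ?W"
      then have "w \<in> lists (Gen ` {1..n} \<union> Adj ` {1..n})" using W by (rule rev_subsetD)
      from word[OF this f] show "T (\<lambda>i. a w * word_op q w f i) i = a w * word_op q w (T f) i"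
        by (simp add: blin_smult[OF T bw[OF f]])
    qed
    also have "\<dots> = eval_free q a (T f)"
      by (simp only: eval_free_superset[OF blin_q fin subset_refl blin_closed[OF T f]])
    finally show ?thesis .
  qed
  moreover have "eval_free q a f \<in> carrier l2" if "f \<in> carrier l2" for f
    by (rule eval_free_closed[OF blin_q that])
  ultimately show "commutes (restrict T (carrier l2)) S"
    by (simp add: commutes_def a(2) blin_closed[OF T])
qed

section \<open>Sectors and bits\<close>

text \<open>Every natural number is a coordinate \<open>pt t k g\<close>: the pair of \<open>t\<close> (hub or leaf) and the site
  \<open>k\<close> indexes an orthonormal basis of the type I part, and the binary digits of \<open>g\<close> index an
  orthonormal basis of the space on which the hyperfinite factor acts. A pair (hub or leaf,
  site) is called a sector.\<close>

definition pt :: "bool \<Rightarrow> nat \<Rightarrow> nat \<Rightarrow> nat" where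
  "pt t k g = prod_encode (2 * k + of_bool t, g)"

definition hub :: "nat \<Rightarrow> bool" where "hub n = odd (fst (prod_decode n))"
definition site :: "nat \<Rightarrow> nat" where "site n = fst (prod_decode n) div 2"
definition bits :: "nat \<Rightarrow> nat" where "bits n = snd (prod_decode n)"

lemma coords_pt [simp]: "hub (pt t k g) = t" "site (pt t k g) = k" "bits (pt t k g) = g"
  by (cases t; simp add: hub_def site_def bits_def pt_def)+

lemma pt_coords [simp]: "pt (hub n) (site n) (bits n) = n"
proof -
  have "2 * (fst (prod_decode n) div 2) + of_bool (odd (fst (prod_decode n))) = fst (prod_decode n)"
    by (cases "odd (fst (prod_decode n))") simp_all
  then show ?thesis by (simp add: hub_def site_def bits_def pt_def)
qed

lemma pt_eq_iff [simp]: "pt t k g = pt t' k' g' \<longleftrightarrow> t = t' \<and> k = k' \<and> g = g'"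
proof
  assume eq: "pt t k g = pt t' k' g'"
  show "t = t' \<and> k = k' \<and> g = g'"
    using arg_cong[OF eq, of hub] arg_cong[OF eq, of site] arg_cong[OF eq, of bits] by simp
qed simp

lemma eq_by_coords:
  assumes "\<And>k g. f (pt False k g) = h (pt False k g)" "\<And>k g. f (pt True k g) = h (pt True k g)"
  shows "f = h"
proof
  fix n
  have "f (pt (hub n) (site n) (bits n)) = h (pt (hub n) (site n) (bits n))"
    using assms by (cases "hub n") simp_all
  then show "f n = h n" by simp
qed

lemma nat_halves_cases:
  fixes k :: nat
  obtains l where "k = 2 * l" | l where "k = 2 * l + 1"
  by (metis evenE oddE)

text \<open>In the standard representation of an infinite tensor product of \<open>2 \<times> 2\<close> matrix algebras, the
  pair of bits \<open>2 i\<close>, \<open>2 i + 1\<close> labels the Pauli matrices of the i-th tensor factor. The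
  generators with index \<open>2 i\<close> and \<open>2 i + 1\<close> are two anticommuting Pauli matrices;
  multiplying with one of them flips its bit, up to a sign that depends on the other bit and
  on the side of the multiplication. Truncated subtraction in \<open>j - 1\<close> is harmless as \<open>j\<close> is
  odd there.\<close>

definition left_sign :: "nat \<Rightarrow> nat \<Rightarrow> complex" where
  "left_sign j g = (if odd j \<and> bit g (j - 1) then - 1 else 1)"

definition right_sign :: "nat \<Rightarrow> nat \<Rightarrow> complex" where
  "right_sign j g = (if even j \<and> bit g (j + 1) then - 1 else 1)"

lemma bit_flip [simp]: "bit (flip_bit j g) i \<longleftrightarrow> (if i = j then \<not> bit g i else bit g i)" for g :: nat
  by (auto simp: bit_flip_bit_iff)

lemma flip_flip [simp]: "flip_bit j (flip_bit j g) = g" for g :: nat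
  by (rule bit_eqI) auto

lemma flip_commute: "flip_bit j (flip_bit k g) = flip_bit k (flip_bit j g)" for g :: nat
  by (rule bit_eqI) auto

lemma left_sign_flip_self [simp]: "left_sign j (flip_bit j g) = left_sign j g"
  by (cases j) (auto simp: left_sign_def)

lemma right_sign_flip_self [simp]: "right_sign j (flip_bit j g) = right_sign j g"
  by (auto simp: right_sign_def)

lemma sign_square [simp]:
  "left_sign j g * left_sign j g = 1" "right_sign j g * right_sign j g = 1"
  "left_sign j g * (left_sign j g * z) = z" "right_sign j g * (right_sign j g * z) = z"
  by (auto simp: left_sign_def right_sign_def)

lemma sign_nonzero [simp]: "left_sign j g \<noteq> 0" "right_sign j g \<noteq> 0"
  by (auto simp: left_sign_def right_sign_def)

lemma cnj_sign [simp]: "cnj (left_sign j g) = left_sign j g" "cnj (right_sign j g) = right_sign j g"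
  by (auto simp: left_sign_def right_sign_def)

lemma cmod_sign [simp]: "cmod (left_sign j g) = 1" "cmod (right_sign j g) = 1"
  by (auto simp: left_sign_def right_sign_def)

text \<open>The cocycle identity that makes left and right multiplications commute: both signs change
  exactly if \<open>j\<close>, \<open>k\<close> are the two indices of one tensor factor, in this order.\<close>

lemma left_right_signs:
  "left_sign k (flip_bit j g) * right_sign j g = left_sign k g * right_sign j (flip_bit k g)"
proof (cases "even j \<and> k = j + 1")
  case True
  then show ?thesis by (auto simp: left_sign_def right_sign_def)
next
  case False
  then have "left_sign k (flip_bit j g) = left_sign k g" by (cases k) (auto simp: left_sign_def)
  moreover have "right_sign j (flip_bit k g) = right_sign j g" using False by (auto simp: right_sign_def)
  ultimately show ?thesis by simp
qed

definition left_op :: "nat \<Rightarrow> (nat \<Rightarrow> complex) \<Rightarrow> nat \<Rightarrow> complex" where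
  "left_op j f = (\<lambda>n. left_sign j (bits n) * f (pt (hub n) (site n) (flip_bit j (bits n))))"

definition right_op :: "nat \<Rightarrow> (nat \<Rightarrow> complex) \<Rightarrow> nat \<Rightarrow> complex" where
  "right_op j f = (\<lambda>n. right_sign j (bits n) * f (pt (hub n) (site n) (flip_bit j (bits n))))"

text \<open>Pairwise distinct positive numbers, bounded and bounded away from zero. They serve to tell
  the hubs apart.\<close>

definition weight :: "nat \<Rightarrow> complex" where
  "weight k = of_real (1 + 1 / (real k + 1))"

text \<open>The graph behind the construction: the hub \<open>l\<close> is joined to the two leaves \<open>2 l\<close> and
  \<open>2 l + 1\<close> by the branches, and the hub \<open>k\<close> is matched with the leaf \<open>k\<close> by \<open>from_hub\<close>.
  Each of these maps is a partial isometry.\<close>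

definition branch0 :: "(nat \<Rightarrow> complex) \<Rightarrow> nat \<Rightarrow> complex" where
  "branch0 f = (\<lambda>n. if \<not> hub n \<and> even (site n) then f (pt True (site n div 2) (bits n)) else 0)"
definition branch1 :: "(nat \<Rightarrow> complex) \<Rightarrow> nat \<Rightarrow> complex" where
  "branch1 f = (\<lambda>n. if \<not> hub n \<and> odd (site n) then f (pt True (site n div 2) (bits n)) else 0)"
definition branch0_adj :: "(nat \<Rightarrow> complex) \<Rightarrow> nat \<Rightarrow> complex" where
  "branch0_adj f = (\<lambda>n. if hub n then f (pt False (2 * site n) (bits n)) else 0)"
definition branch1_adj :: "(nat \<Rightarrow> complex) \<Rightarrow> nat \<Rightarrow> complex" where
  "branch1_adj f = (\<lambda>n. if hub n then f (pt False (2 * site n + 1) (bits n)) else 0)"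
definition from_hub :: "(nat \<Rightarrow> complex) \<Rightarrow> nat \<Rightarrow> complex" where
  "from_hub f = (\<lambda>n. if hub n then 0 else f (pt True (site n) (bits n)))"
definition to_hub :: "(nat \<Rightarrow> complex) \<Rightarrow> nat \<Rightarrow> complex" where
  "to_hub f = (\<lambda>n. if hub n then f (pt False (site n) (bits n)) else 0)"
definition hub_weight :: "(nat \<Rightarrow> complex) \<Rightarrow> nat \<Rightarrow> complex" where
  "hub_weight f = (\<lambda>n. if hub n then weight (site n) * f n else 0)"
definition hub_weight_inv :: "(nat \<Rightarrow> complex) \<Rightarrow> nat \<Rightarrow> complex" where
  "hub_weight_inv f = (\<lambda>n. if hub n then f n / weight (site n) else 0)"

text \<open>The k-th left multiplication acts at the hub \<open>k\<close>, so that one operator carries all of them.\<close>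

definition hub_sign :: "(nat \<Rightarrow> complex) \<Rightarrow> nat \<Rightarrow> complex" where
  "hub_sign f = (\<lambda>n. if hub n then left_op (site n) f n else 0)"
definition move :: "nat \<Rightarrow> nat \<Rightarrow> (nat \<Rightarrow> complex) \<Rightarrow> nat \<Rightarrow> complex" where
  "move k l f = (\<lambda>n. if hub n \<and> site n = k then f (pt True l (bits n)) else 0)"

abbreviation hub_proj :: "(nat \<Rightarrow> complex) \<Rightarrow> nat \<Rightarrow> complex" where "hub_proj \<equiv> trunc {n. hub n}"
abbreviation leaf_proj :: "(nat \<Rightarrow> complex) \<Rightarrow> nat \<Rightarrow> complex" where "leaf_proj \<equiv> trunc {n. \<not> hub n}"

lemmas prim_defs = branch0_def branch1_def branch0_adj_def branch1_adj_def from_hub_def to_hub_def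
  hub_weight_def hub_weight_inv_def hub_sign_def move_def left_op_def right_op_def trunc_def

lemma weight_nonzero [simp]: "weight k \<noteq> 0"
proof -
  have "1 + 1 / (real k + 1) > 0" by (intro add_pos_nonneg) auto
  then show ?thesis unfolding weight_def of_real_eq_0_iff by linarith
qed

lemma cnj_weight [simp]: "cnj (weight k) = weight k" by (simp add: weight_def)

lemma cmod_weight: "cmod (weight k) = 1 + 1 / (real k + 1)"
proof -
  have "1 + 1 / (real k + 1) > 0" by (intro add_pos_nonneg) auto
  then show ?thesis unfolding weight_def norm_of_real by linarith
qed

lemma weight_square_inj: "weight k * weight k = weight l * weight l \<longleftrightarrow> k = l"
proof
  assume "weight k * weight k = weight l * weight l"
  then have "(cmod (weight k))\<^sup>2 = (cmod (weight l))\<^sup>2"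
    by (metis norm_mult power2_eq_square)
  then have "cmod (weight k) = cmod (weight l)" by (rule power2_eq_imp_eq) auto
  then show "k = l" by (simp add: cmod_weight)
qed simp

lemma of_pt_coords: "hub n \<Longrightarrow> pt True (site n) (bits n) = n" "\<not> hub n \<Longrightarrow> pt False (site n) (bits n) = n"
  using pt_coords[of n] by simp_all

lemma adj_pair_left_op: "adj_pair (left_op j) (left_op j)"
proof -
  let ?a = "\<lambda>n. left_sign j (bits n)" and ?b = "\<lambda>n. left_sign j (bits n)"
  let ?\<phi> = "\<lambda>n. pt (hub n) (site n) (flip_bit j (bits n))" and ?\<psi> = "\<lambda>n. pt (hub n) (site n) (flip_bit j (bits n))"
  have "adj_pair (weighted_pullback ?a ?\<phi>) (weighted_pullback ?b ?\<psi>)"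
    by (rule adj_pair_weighted_pullback[of _ 1]) (auto simp: of_pt_coords split: if_splits)
  moreover have "weighted_pullback ?a ?\<phi> = (left_op j)" "weighted_pullback ?b ?\<psi> = (left_op j)"
    by (auto simp: fun_eq_iff weighted_pullback_def prim_defs)
  ultimately show ?thesis by simp
qed

lemma adj_pair_right_op: "adj_pair (right_op j) (right_op j)"
proof -
  let ?a = "\<lambda>n. right_sign j (bits n)" and ?b = "\<lambda>n. right_sign j (bits n)"
  let ?\<phi> = "\<lambda>n. pt (hub n) (site n) (flip_bit j (bits n))" and ?\<psi> = "\<lambda>n. pt (hub n) (site n) (flip_bit j (bits n))"
  have "adj_pair (weighted_pullback ?a ?\<phi>) (weighted_pullback ?b ?\<psi>)"
    by (rule adj_pair_weighted_pullback[of _ 1]) (auto simp: of_pt_coords split: if_splits)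
  moreover have "weighted_pullback ?a ?\<phi> = (right_op j)" "weighted_pullback ?b ?\<psi> = (right_op j)"
    by (auto simp: fun_eq_iff weighted_pullback_def prim_defs)
  ultimately show ?thesis by simp
qed

lemma adj_pair_hub_sign: "adj_pair hub_sign hub_sign"
proof -
  let ?a = "\<lambda>n. if hub n then left_sign (site n) (bits n) else 0" and ?b = "\<lambda>n. if hub n then left_sign (site n) (bits n) else 0"
  let ?\<phi> = "\<lambda>n. pt (hub n) (site n) (flip_bit (site n) (bits n))" and ?\<psi> = "\<lambda>n. pt (hub n) (site n) (flip_bit (site n) (bits n))"
  have "adj_pair (weighted_pullback ?a ?\<phi>) (weighted_pullback ?b ?\<psi>)"
    by (rule adj_pair_weighted_pullback[of _ 1]) (auto simp: of_pt_coords split: if_splits)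
  moreover have "weighted_pullback ?a ?\<phi> = hub_sign" "weighted_pullback ?b ?\<psi> = hub_sign"
    by (auto simp: fun_eq_iff weighted_pullback_def prim_defs)
  ultimately show ?thesis by simp
qed

lemma adj_pair_branch0: "adj_pair branch0 branch0_adj"
proof -
  let ?a = "\<lambda>n. if \<not> hub n \<and> even (site n) then 1 else 0" and ?b = "\<lambda>n. if hub n then 1 else 0"
  let ?\<phi> = "\<lambda>n. pt True (site n div 2) (bits n)" and ?\<psi> = "\<lambda>n. pt False (2 * site n) (bits n)"
  have "adj_pair (weighted_pullback ?a ?\<phi>) (weighted_pullback ?b ?\<psi>)"
    by (rule adj_pair_weighted_pullback[of _ 1]) (auto simp: of_pt_coords split: if_splits)
  moreover have "weighted_pullback ?a ?\<phi> = branch0" "weighted_pullback ?b ?\<psi> = branch0_adj"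
    by (auto simp: fun_eq_iff weighted_pullback_def prim_defs)
  ultimately show ?thesis by simp
qed

lemma adj_pair_branch1: "adj_pair branch1 branch1_adj"
proof -
  let ?a = "\<lambda>n. if \<not> hub n \<and> odd (site n) then 1 else 0" and ?b = "\<lambda>n. if hub n then 1 else 0"
  let ?\<phi> = "\<lambda>n. pt True (site n div 2) (bits n)" and ?\<psi> = "\<lambda>n. pt False (Suc (2 * site n)) (bits n)"
  have "adj_pair (weighted_pullback ?a ?\<phi>) (weighted_pullback ?b ?\<psi>)"
    by (rule adj_pair_weighted_pullback[of _ 1]) (auto simp: of_pt_coords split: if_splits)
  moreover have "weighted_pullback ?a ?\<phi> = branch1" "weighted_pullback ?b ?\<psi> = branch1_adj"
    by (auto simp: fun_eq_iff weighted_pullback_def prim_defs)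
  ultimately show ?thesis by simp
qed

lemma adj_pair_from_hub: "adj_pair from_hub to_hub"
proof -
  let ?a = "\<lambda>n. if hub n then 0 else 1" and ?b = "\<lambda>n. if hub n then 1 else 0"
  let ?\<phi> = "\<lambda>n. pt True (site n) (bits n)" and ?\<psi> = "\<lambda>n. pt False (site n) (bits n)"
  have "adj_pair (weighted_pullback ?a ?\<phi>) (weighted_pullback ?b ?\<psi>)"
    by (rule adj_pair_weighted_pullback[of _ 1]) (auto simp: of_pt_coords split: if_splits)
  moreover have "weighted_pullback ?a ?\<phi> = from_hub" "weighted_pullback ?b ?\<psi> = to_hub"
    by (auto simp: fun_eq_iff weighted_pullback_def prim_defs)
  ultimately show ?thesis by simp
qed

lemma adj_pair_move: "adj_pair (move k l) (move l k)"
proof -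
  let ?a = "\<lambda>n. if hub n \<and> site n = k then 1 else 0" and ?b = "\<lambda>n. if hub n \<and> site n = l then 1 else 0"
  let ?\<phi> = "\<lambda>n. pt True l (bits n)" and ?\<psi> = "\<lambda>n. pt True k (bits n)"
  have "adj_pair (weighted_pullback ?a ?\<phi>) (weighted_pullback ?b ?\<psi>)"
    by (rule adj_pair_weighted_pullback[of _ 1]) (auto simp: of_pt_coords split: if_splits)
  moreover have "weighted_pullback ?a ?\<phi> = (move k l)" "weighted_pullback ?b ?\<psi> = (move l k)"
    by (auto simp: fun_eq_iff weighted_pullback_def prim_defs)
  ultimately show ?thesis by simp
qed

lemma adj_pair_hub_weight: "adj_pair hub_weight hub_weight"
proof -
  have le: "cmod (weight k) \<le> 2" for k by (simp add: cmod_weight)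
  let ?a = "\<lambda>n. if hub n then weight (site n) else 0" and ?b = "\<lambda>n. if hub n then weight (site n) else 0"
  let ?\<phi> = "\<lambda>n. n" and ?\<psi> = "\<lambda>n. n"
  have "adj_pair (weighted_pullback ?a ?\<phi>) (weighted_pullback ?b ?\<psi>)"
    by (rule adj_pair_weighted_pullback[of _ 2]) (auto simp: of_pt_coords le split: if_splits)
  moreover have "weighted_pullback ?a ?\<phi> = hub_weight" "weighted_pullback ?b ?\<psi> = hub_weight"
    by (auto simp: fun_eq_iff weighted_pullback_def prim_defs)
  ultimately show ?thesis by simp
qed

lemma blin_hub_weight_inv: "blin hub_weight_inv"
proof -
  have le: "cmod (1 / weight k) \<le> 1" for k
    using le_imp_inverse_le[of 1 "cmod (weight k)"] by (simp add: norm_inverse divide_inverse cmod_weight)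
  have "blin (weighted_pullback (\<lambda>n. if hub n then 1 / weight (site n) else 0) (\<lambda>n. n))"
    by (rule blin_weighted_pullback[of _ 1]) (use le in \<open>auto simp: inj_on_def\<close>)
  moreover have "weighted_pullback (\<lambda>n. if hub n then 1 / weight (site n) else 0) (\<lambda>n. n) = hub_weight_inv"
    by (auto simp: fun_eq_iff weighted_pullback_def prim_defs)
  ultimately show ?thesis by simp
qed

lemmas blin_prims = adj_pairD(1)[OF adj_pair_left_op] adj_pairD(1)[OF adj_pair_right_op] adj_pairD(1)[OF adj_pair_hub_sign]
  adj_pairD(1)[OF adj_pair_branch0] adj_pairD(2)[OF adj_pair_branch0] adj_pairD(1)[OF adj_pair_branch1]
  adj_pairD(2)[OF adj_pair_branch1] adj_pairD(1)[OF adj_pair_from_hub] adj_pairD(2)[OF adj_pair_from_hub]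
  adj_pairD(1)[OF adj_pair_hub_weight] blin_hub_weight_inv adj_pairD(1)[OF adj_pair_trunc]

section \<open>Five idempotents with scalar sum\<close>

text \<open>The idempotents \<open>gen3\<close> and 1 - \<open>gen4\<close> are products column times row with row times column
  equal to the identity of the hubs. In every triple consisting of a hub and its two leaves,
  \<open>gen3\<close> is an idempotent of rank one and \<open>gen4\<close> an idempotent of rank two. Omitting the hub
  weights and signs, on leaf, leaf, hub the columns are \<open>(1, 1 - \<kappa>, 1 + \<kappa>)\<close> and
  \<open>(1, 1, 1 - \<kappa>)\<close>, the rows are \<open>(-1, 1, 1)\<close> and \<open>(\<kappa> - 1, 1, 1)\<close>. They are chosen such that
  \<open>gen3 + gen4\<close> has the diagonal \<open>(1 - \<kappa>, 1 - \<kappa>, 1 + 2 \<kappa>)\<close> and no entries between the two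
  leaves.\<close>

definition row3 :: "(nat \<Rightarrow> complex) \<Rightarrow> nat \<Rightarrow> complex" where
  "row3 f = (\<lambda>n. branch1_adj f n - branch0_adj f n + hub_weight f n)"
definition col3 :: "complex \<Rightarrow> (nat \<Rightarrow> complex) \<Rightarrow> nat \<Rightarrow> complex" where
  "col3 \<kappa> f = (\<lambda>n. branch0 f n + (1 - \<kappa>) * branch1 f n + (1 + \<kappa>) * hub_weight_inv f n)"
definition row4 :: "complex \<Rightarrow> (nat \<Rightarrow> complex) \<Rightarrow> nat \<Rightarrow> complex" where
  "row4 \<kappa> f = (\<lambda>n. (\<kappa> - 1) * branch0_adj f n + branch1_adj f n + hub_sign f n)"
definition col4 :: "complex \<Rightarrow> (nat \<Rightarrow> complex) \<Rightarrow> nat \<Rightarrow> complex" where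
  "col4 \<kappa> f = (\<lambda>n. branch0 f n + branch1 f n + (1 - \<kappa>) * hub_sign f n)"

definition gen3 :: "complex \<Rightarrow> (nat \<Rightarrow> complex) \<Rightarrow> nat \<Rightarrow> complex" where
  "gen3 \<kappa> f = col3 \<kappa> (row3 f)"
definition gen4 :: "complex \<Rightarrow> (nat \<Rightarrow> complex) \<Rightarrow> nat \<Rightarrow> complex" where
  "gen4 \<kappa> f = (\<lambda>n. f n - col4 \<kappa> (row4 \<kappa> f) n)"

text \<open>In the pair of the leaf \<open>k\<close> and the hub \<open>k\<close> this is the rank one idempotent with the rows
  \<open>(x, x)\<close> and \<open>(1 - x, 1 - x)\<close>.\<close>

definition gen5 :: "complex \<Rightarrow> (nat \<Rightarrow> complex) \<Rightarrow> nat \<Rightarrow> complex" where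
  "gen5 x f = (\<lambda>n. x * (leaf_proj f n + from_hub f n) + (1 - x) * (to_hub f n + hub_proj f n))"

text \<open>With \<open>x = (3 \<kappa> + 1) / 2\<close> the diagonal \<open>(x, 1 - x)\<close> of \<open>gen5\<close> complements the diagonal
  \<open>(1 - \<kappa>, 1 + 2 \<kappa>)\<close> of \<open>gen3 + gen4\<close> to the scalar \<open>(\<kappa> + 3) / 2\<close>.\<close>

definition gens345 :: "complex \<Rightarrow> (nat \<Rightarrow> complex) \<Rightarrow> nat \<Rightarrow> complex" where
  "gens345 \<kappa> f = (\<lambda>n. (gen3 \<kappa> f n + gen4 \<kappa> f n) + gen5 ((3 * \<kappa> + 1) / 2) f n)"

text \<open>An idempotent with the range projection \<open>leaf_proj\<close> may have any corner from hubs to leaves,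
  and \<open>gen2\<close> any corner in the opposite direction. These corners cancel the off-diagonal
  part of the other three.\<close>

definition gen1 :: "complex \<Rightarrow> (nat \<Rightarrow> complex) \<Rightarrow> nat \<Rightarrow> complex" where
  "gen1 \<kappa> f = (\<lambda>n. leaf_proj f n - leaf_proj (gens345 \<kappa> (hub_proj f)) n)"
definition gen2 :: "complex \<Rightarrow> (nat \<Rightarrow> complex) \<Rightarrow> nat \<Rightarrow> complex" where
  "gen2 \<kappa> f = (\<lambda>n. hub_proj f n - hub_proj (gens345 \<kappa> (leaf_proj f)) n)"

lemmas gen_defs = row3_def col3_def row4_def col4_def gen3_def gen4_def gen5_def gens345_def gen1_def gen2_def

lemma blin_gen3: "blin (gen3 \<kappa>)"
proof -
  have "blin row3" unfolding row3_def[abs_def]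
    by (rule blin_plus[OF blin_minus]) (rule blin_prims)+
  moreover have "blin (col3 \<kappa>)" unfolding col3_def[abs_def]
    by (rule blin_plus[OF blin_plus[OF _ blin_scale] blin_scale]) (rule blin_prims)+
  ultimately show ?thesis unfolding gen3_def[abs_def] by (rule blin_comp[rotated])
qed

lemma blin_gen4: "blin (gen4 \<kappa>)"
proof -
  have "blin (row4 \<kappa>)" unfolding row4_def[abs_def]
    by (rule blin_plus[OF blin_plus[OF blin_scale]]) (rule blin_prims)+
  moreover have "blin (col4 \<kappa>)" unfolding col4_def[abs_def]
    by (rule blin_plus[OF blin_plus blin_scale]) (rule blin_prims)+
  ultimately show ?thesis unfolding gen4_def[abs_def]
    by (intro blin_minus[OF blin_id]) (rule blin_comp[rotated])
qed

lemma blin_gen5: "blin (gen5 x)"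
  unfolding gen5_def[abs_def]
  by (rule blin_plus[OF blin_scale[OF blin_plus] blin_scale[OF blin_plus]]) (rule blin_prims)+

lemma blin_gens345: "blin (gens345 \<kappa>)"
  unfolding gens345_def[abs_def] by (rule blin_plus[OF blin_plus[OF blin_gen3 blin_gen4] blin_gen5])

lemma blin_gen1: "blin (gen1 \<kappa>)"
  unfolding gen1_def[abs_def]
  by (rule blin_minus[OF blin_prims(12) blin_comp[OF blin_prims(12) blin_comp[OF blin_gens345 blin_prims(12)]]])

lemma blin_gen2: "blin (gen2 \<kappa>)"
  unfolding gen2_def[abs_def]
  by (rule blin_minus[OF blin_prims(12) blin_comp[OF blin_prims(12) blin_comp[OF blin_gens345 blin_prims(12)]]])

lemma row3_col3: "row3 (col3 \<kappa> f) = hub_proj f"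
  by (rule eq_by_coords) (simp_all add: gen_defs prim_defs algebra_simps)

lemma row3_hub: "hub_proj (row3 f) = row3 f"
  by (rule eq_by_coords) (simp_all add: gen_defs prim_defs)

lemma gen3_idem: "gen3 \<kappa> (gen3 \<kappa> f) = gen3 \<kappa> f"
  by (simp add: gen3_def row3_col3 row3_hub)

lemma row4_col4: "row4 \<kappa> (col4 \<kappa> f) = hub_proj f"
  by (rule eq_by_coords) (simp_all add: gen_defs prim_defs algebra_simps)

lemma row4_hub: "hub_proj (row4 \<kappa> f) = row4 \<kappa> f"
  by (rule eq_by_coords) (simp_all add: gen_defs prim_defs)

lemma row4_minus: "row4 \<kappa> (\<lambda>n. f n - g n) = (\<lambda>n. row4 \<kappa> f n - row4 \<kappa> g n)"
  by (rule eq_by_coords) (simp_all add: gen_defs prim_defs algebra_simps)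

lemma gen4_idem: "gen4 \<kappa> (gen4 \<kappa> f) = gen4 \<kappa> f"
proof -
  have "row4 \<kappa> (gen4 \<kappa> f) = (\<lambda>n. 0)"
    by (simp add: gen4_def row4_minus row4_col4 row4_hub)
  moreover have "col4 \<kappa> (\<lambda>n. 0) = (\<lambda>n. 0)"
    by (rule eq_by_coords) (simp_all add: gen_defs prim_defs)
  ultimately show ?thesis by (subst gen4_def) simp
qed

lemma gen5_idem: "gen5 x (gen5 x f) = gen5 x f"
  by (rule eq_by_coords) (simp_all add: gen_defs prim_defs algebra_simps)

lemma proj_simps [simp]:
  "leaf_proj (leaf_proj f) = leaf_proj f" "hub_proj (hub_proj f) = hub_proj f"
  "leaf_proj (hub_proj f) = (\<lambda>n. 0)" "hub_proj (leaf_proj f) = (\<lambda>n. 0)"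
  "leaf_proj (\<lambda>n. f n - g n) = (\<lambda>n. leaf_proj f n - leaf_proj g n)"
  "hub_proj (\<lambda>n. f n - g n) = (\<lambda>n. hub_proj f n - hub_proj g n)"
  by (auto simp: trunc_def)

lemma gens345_zero: "gens345 \<kappa> (\<lambda>n. 0) = (\<lambda>n. 0)"
  by (rule blin_zero[OF blin_gens345])

lemma gen1_leaf: "leaf_proj (gen1 \<kappa> f) = gen1 \<kappa> f" "gen1 \<kappa> (leaf_proj f) = leaf_proj f"
  by (simp_all add: gen1_def gens345_zero) (simp add: trunc_def)

lemma gen1_idem: "gen1 \<kappa> (gen1 \<kappa> f) = gen1 \<kappa> f"
  using gen1_leaf by metis

lemma gen2_idem: "gen2 \<kappa> (gen2 \<kappa> f) = gen2 \<kappa> f"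
proof -
  have "hub_proj (gen2 \<kappa> f) = gen2 \<kappa> f" "gen2 \<kappa> (hub_proj f) = hub_proj f" for f
    by (simp_all add: gen2_def gens345_zero) (simp add: trunc_def)
  then show ?thesis by metis
qed

text \<open>The identity on which the construction rests: compressed to the leaves or to the hubs, the
  three idempotents sum to one and the same scalar.\<close>

lemma gens345_diagonal_blocks:
  "leaf_proj (gens345 \<kappa> (leaf_proj f)) = (\<lambda>n. (\<kappa> + 3) / 2 * leaf_proj f n)"
  "hub_proj (gens345 \<kappa> (hub_proj f)) = (\<lambda>n. (\<kappa> + 3) / 2 * hub_proj f n)"
proof -
  show "leaf_proj (gens345 \<kappa> (leaf_proj f)) = (\<lambda>n. (\<kappa> + 3) / 2 * leaf_proj f n)"
  proof (rule eq_by_coords)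
    fix k g
    show "leaf_proj (gens345 \<kappa> (leaf_proj f)) (pt False k g) = (\<kappa> + 3) / 2 * leaf_proj f (pt False k g)"
      by (cases k rule: nat_halves_cases) (simp_all add: gen_defs prim_defs field_simps)
  qed (simp add: trunc_def)
  show "hub_proj (gens345 \<kappa> (hub_proj f)) = (\<lambda>n. (\<kappa> + 3) / 2 * hub_proj f n)"
    by (rule eq_by_coords) (simp_all add: gen_defs prim_defs field_simps)
qed

lemma gens_sum:
  assumes f: "f \<in> carrier l2"
  shows "gen1 \<kappa> f n + gen2 \<kappa> f n + gen3 \<kappa> f n + gen4 \<kappa> f n + gen5 ((3 * \<kappa> + 1) / 2) f n = (\<kappa> + 5) / 2 * f n"
proof -
  have proj_at: "leaf_proj h n = (if hub n then 0 else h n)" "hub_proj h n = (if hub n then h n else 0)" for h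
    by (simp_all add: trunc_def)
  have split: "f = (\<lambda>n. leaf_proj f n + hub_proj f n)" by (auto simp: trunc_def)
  have r: "gens345 \<kappa> f n = gens345 \<kappa> (leaf_proj f) n + gens345 \<kappa> (hub_proj f) n"
    using blin_add[OF blin_gens345 trunc_closed[OF f] trunc_closed[OF f]] split by metis
  have "gen1 \<kappa> f n + gen2 \<kappa> f n + gens345 \<kappa> f n
      = f n + leaf_proj (gens345 \<kappa> (leaf_proj f)) n + hub_proj (gens345 \<kappa> (hub_proj f)) n"
  proof -
    have "(if c then 0 else z) - (if c then 0 else b) + ((if c then z else 0) - (if c then a else 0)) + (a + b)
        = z + (if c then 0 else a) + (if c then b else 0)" for a b z :: complex and c by simp
    then show ?thesis unfolding gen1_def gen2_def r proj_at .
  qed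
  also have "\<dots> = (\<kappa> + 5) / 2 * f n"
  proof -
    have "z + (\<kappa> + 3) / 2 * (if c then 0 else z) + (\<kappa> + 3) / 2 * (if c then z else 0) = (\<kappa> + 5) / 2 * z"
      for z and c
    proof -
      have "(\<kappa> + 5) / 2 = 1 + (\<kappa> + 3) / 2" by (simp add: add_divide_distrib)
      then show ?thesis by (cases c) (simp_all add: distrib_right)
    qed
    then show ?thesis unfolding gens345_diagonal_blocks unfolding proj_at .
  qed
  finally show ?thesis by (simp only: gens345_def add.assoc)
qed

section \<open>Matrix units and left multiplications in the generated algebra\<close>

abbreviation sector :: "bool \<times> nat \<Rightarrow> nat set" where
  "sector s \<equiv> {n. (hub n, site n) = s}"

text \<open>The set \<open>A\<close> stands for the image of the algebra under the representation, seen only through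
  its bicommutant.\<close>

locale generated =
  fixes A :: "((nat \<Rightarrow> complex) \<Rightarrow> nat \<Rightarrow> complex) set" and \<kappa> :: complex
  assumes A: "star_closed A"
    and gens: "in_vna A (gen1 \<kappa>)" "in_vna A (gen3 \<kappa>)" "in_vna A (gen4 \<kappa>)" "in_vna A (gen5 ((3 * \<kappa> + 1) / 2))"
begin

lemma leaf_proj_in: "in_vna A leaf_proj"
  by (rule in_vna_range_projection[OF A gens(1) adj_pair_trunc gen1_leaf(2) gen1_leaf(1)])

lemma hub_proj_in: "in_vna A hub_proj"
  by (rule in_vna_cong[OF in_vna_minus[OF in_vna_id leaf_proj_in]]) (auto simp: trunc_def)

text \<open>The corners of \<open>gen5\<close> are the multiples of \<open>from_hub\<close> and its adjoint by \<open>x\<close> and \<open>1 - x\<close>,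
  which do not both vanish.\<close>

lemma from_hub_in: "in_vna A from_hub" and to_hub_in: "in_vna A to_hub"
proof -
  define x where "x = (3 * \<kappa> + 1) / 2"
  have g5: "in_vna A (gen5 x)" using gens(4) by (simp only: x_def)
  have "in_vna A from_hub \<and> in_vna A to_hub"
  proof (cases "x = 0")
    case False
    have "in_vna A (\<lambda>f n. (1 / x) * leaf_proj (gen5 x (hub_proj f)) n)"
      by (rule in_vna_scale[OF in_vna_comp[OF leaf_proj_in in_vna_comp[OF g5 hub_proj_in]]])
    then have "in_vna A from_hub"
      by (rule in_vna_cong) (rule eq_by_coords; simp add: gen5_def prim_defs False)
    then show ?thesis using in_vna_adj[OF A _ adj_pair_from_hub] by blast
  next
    case True
    have "in_vna A (\<lambda>f. hub_proj (gen5 x (leaf_proj f)))"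
      by (rule in_vna_comp[OF hub_proj_in in_vna_comp[OF g5 leaf_proj_in]])
    then have "in_vna A to_hub"
      by (rule in_vna_cong) (rule eq_by_coords; simp add: gen5_def prim_defs True)
    then show ?thesis using in_vna_adj[OF A _ adj_pair_sym[OF adj_pair_from_hub]] by blast
  qed
  then show "in_vna A from_hub" "in_vna A to_hub" by blast+
qed

text \<open>The corner \<open>B\<close> of \<open>gen3\<close> sends the hub \<open>k\<close> to its two leaves with weight \<open>k\<close>, so that
  \<open>B\<^sup>* B\<close> is a multiple of the squared weights. These are distinct, hence every hub is a
  spectral projection.\<close>

lemma hub_sector_in: "in_vna A (trunc (sector (True, k)))"
proof -
  define d where "d n = (if hub n then weight (site n) * weight (site n) else 0)" for n
  \<comment> \<open>The squared norm of the leaf part \<open>(1, 1 - \<kappa>)\<close> of the column of \<open>gen3\<close>.\<close>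
  define c where "c = 1 + (1 - \<kappa>) * cnj (1 - \<kappa>)"
  let ?B = "\<lambda>f n. branch0 (hub_weight f) n + (1 - \<kappa>) * branch1 (hub_weight f) n"
  let ?B' = "\<lambda>f n. hub_weight (branch0_adj f) n + cnj (1 - \<kappa>) * hub_weight (branch1_adj f) n"
  have "in_vna A (\<lambda>f. leaf_proj (gen3 \<kappa> (hub_proj f)))"
    by (rule in_vna_comp[OF leaf_proj_in in_vna_comp[OF gens(2) hub_proj_in]])
  then have B: "in_vna A ?B"
    by (rule in_vna_cong) (rule eq_by_coords; simp add: gen_defs prim_defs)
  have "adj_pair ?B ?B'"
    by (rule adj_pair_plus[OF adj_pair_comp[OF adj_pair_branch0 adj_pair_hub_weight]
        adj_pair_scale[OF adj_pair_comp[OF adj_pair_branch1 adj_pair_hub_weight]]])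
  from in_vna_comp[OF in_vna_adj[OF A B this] B] have BB: "in_vna A (\<lambda>f. ?B' (?B f))" .
  have "Re c \<ge> 1" unfolding c_def by (simp add: complex_norm_square[symmetric] del: complex_cnj_diff)
  then have c: "c \<noteq> 0" by auto
  have "in_vna A (\<lambda>f n. (1 / c) * ?B' (?B f) n)" by (rule in_vna_scale[OF BB])
  then have "in_vna A (weighted_pullback d (\<lambda>n. n))"
  proof (rule in_vna_cong)
    fix f :: "nat \<Rightarrow> complex"
    show "(\<lambda>n. (1 / c) * ?B' (?B f) n) = weighted_pullback d (\<lambda>n. n) f"
    proof (rule eq_by_coords)
      fix k g
      have "?B' (?B f) (pt True k g) = c * (weight k * weight k * f (pt True k g))"
        by (simp add: prim_defs c_def algebra_simps)
      then show "(1 / c) * ?B' (?B f) (pt True k g) = weighted_pullback d (\<lambda>n. n) f (pt True k g)"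
        using c by (simp add: weighted_pullback_def d_def)
    qed (simp add: prim_defs weighted_pullback_def d_def)
  qed
  from in_vna_spectral_projection[OF A this, of "weight k * weight k"]
  have "in_vna A (trunc {n. d n = weight k * weight k})" .
  moreover have "{n. d n = weight k * weight k} = sector (True, k)"
    by (auto simp: d_def weight_square_inj split: if_splits)
  ultimately show ?thesis by simp
qed

lemma sector_in: "in_vna A (trunc (sector s))"
proof (cases s)
  case (Pair t k)
  show ?thesis
  proof (cases t)
    case True
    then show ?thesis using hub_sector_in Pair by simp
  next
    case False
    have "in_vna A (\<lambda>f. from_hub (trunc (sector (True, k)) (to_hub f)))"
      by (rule in_vna_comp[OF from_hub_in in_vna_comp[OF hub_sector_in to_hub_in]])
    then show ?thesis
      by (rule in_vna_cong) (rule eq_by_coords; simp add: prim_defs Pair False)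
  qed
qed

text \<open>Matrix units between neighbouring hubs: a hub goes to one of its leaves by a corner of
  \<open>gen3\<close> or \<open>gen4\<close>, and the leaf goes to the hub matched with it. The corners of \<open>gen4\<close>
  carry a left multiplication along.\<close>

lemma move_step_in:
  "in_vna A (move (2 * l) l)"
  "in_vna A (\<lambda>f. move (2 * l) l (left_op l f))"
  "in_vna A (\<lambda>f. move (2 * l + 1) l (left_op l f))"
proof -
  have blk: "in_vna A (\<lambda>f n. c * to_hub (trunc (sector (False, k)) (S (trunc (sector (True, l)) f))) n)"
    if "in_vna A S" for S k c
    by (rule in_vna_scale[OF in_vna_comp[OF to_hub_in in_vna_comp[OF sector_in in_vna_comp[OF that sector_in]]]])
  show "in_vna A (move (2 * l) l)"
    by (rule in_vna_cong[OF blk[OF gens(2), of "1 / weight l" "2 * l"]])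
       (rule eq_by_coords; simp add: gen_defs prim_defs)
  show "in_vna A (\<lambda>f. move (2 * l) l (left_op l f))"
    by (rule in_vna_cong[OF blk[OF gens(3), of "- 1" "2 * l"]])
       (rule eq_by_coords; simp add: gen_defs prim_defs)
  show "in_vna A (\<lambda>f. move (2 * l + 1) l (left_op l f))"
    by (rule in_vna_cong[OF blk[OF gens(3), of "- 1" "2 * l + 1"]])
       (rule eq_by_coords; simp add: gen_defs prim_defs)
qed

text \<open>The even step is available with and without the left multiplication, which isolates it at
  one hub.\<close>

lemma hub_left_op_in: "in_vna A (\<lambda>f. move l l (left_op l f))"
  by (rule in_vna_cong[OF in_vna_comp[OF in_vna_adj[OF A move_step_in(1)[of l] adj_pair_move] move_step_in(2)[of l]]])
     (rule eq_by_coords; simp add: prim_defs)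

lemma move_odd_step_in: "in_vna A (move (2 * l + 1) l)"
  by (rule in_vna_cong[OF in_vna_comp[OF move_step_in(3)[of l] hub_left_op_in[of l]]])
     (rule eq_by_coords; simp add: prim_defs)

lemma move_trans: "move k l (move l m f) = move k m f"
  by (rule eq_by_coords) (simp_all add: prim_defs)

text \<open>Replacing \<open>k\<close> by half of it leads to the hub 0 in finitely many steps.\<close>

lemma move_from_root_in: "in_vna A (move k 0)"
proof (induction k rule: less_induct)
  case (less k)
  consider "k = 0" | l where "k = 2 * l" "l < k" | l where "k = 2 * l + 1" "l < k"
  proof -
    have "k = 0 \<or> (\<exists>l. k = 2 * l \<and> l < k) \<or> (\<exists>l. k = 2 * l + 1 \<and> l < k)" by presburger
    then show thesis using that by blast
  qed
  then show ?case
  proof cases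
    case 1
    have "trunc (sector (True, 0)) f = move 0 0 f" for f
      by (rule eq_by_coords) (simp_all add: prim_defs)
    then show ?thesis using in_vna_cong[OF sector_in[of "(True, 0)"]] 1 by blast
  next
    case 2
    then show ?thesis
      using in_vna_cong[OF in_vna_comp[OF move_step_in(1)[of l] less.IH[OF 2(2)]]] by (simp add: move_trans)
  next
    case 3
    then show ?thesis
      using in_vna_cong[OF in_vna_comp[OF move_odd_step_in[of l] less.IH[OF 3(2)]]] by (simp add: move_trans)
  qed
qed

lemma move_in: "in_vna A (move k l)"
  by (rule in_vna_cong[OF in_vna_comp[OF move_from_root_in in_vna_adj[OF A move_from_root_in adj_pair_move]]])
     (rule move_trans)

text \<open>The j-th left multiplication is found at the hub \<open>j\<close>; matrix units transport it to all other
  sectors.\<close>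

lemma left_op_in: "in_vna A (left_op j)"
proof (rule in_vna_by_blocks[where sec = "\<lambda>n. (hub n, site n)"])
  show "blin (left_op j)" by (rule adj_pairD(1)[OF adj_pair_left_op])
  show "in_vna A (trunc (sector s))" for s by (rule sector_in)
  have hubs: "in_vna A (\<lambda>f. move k j (move j j (left_op j (move j k f))))" for k
    by (rule in_vna_comp[OF move_in in_vna_comp[OF hub_left_op_in move_in]])
  have leaves: "in_vna A (\<lambda>f. from_hub (move k j (move j j (left_op j (move j k (to_hub f))))))" for k
    by (rule in_vna_comp[OF from_hub_in in_vna_comp[OF hubs to_hub_in]])
  fix s :: "bool \<times> nat"
  obtain t k where s: "s = (t, k)" by (cases s)
  show "in_vna A (\<lambda>f. trunc (sector s) (left_op j f))"
  proof (cases t)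
    case True
    show ?thesis
      by (rule in_vna_cong[OF hubs[of k]]) (rule eq_by_coords; simp add: prim_defs s True)
  next
    case False
    show ?thesis
      by (rule in_vna_cong[OF leaves[of k]]) (rule eq_by_coords; simp add: prim_defs s False)
  qed
qed

end

section \<open>Right multiplications commute with the idempotents\<close>

lemma left_right_commute: "left_op k (right_op j f) = right_op j (left_op k f)"
  using left_right_signs[of k j]
  by (intro eq_by_coords) (simp_all add: prim_defs flip_commute mult_ac)

lemma right_op_commutes_prims:
  "branch0 (right_op j f) = right_op j (branch0 f)" "branch1 (right_op j f) = right_op j (branch1 f)"
  "branch0_adj (right_op j f) = right_op j (branch0_adj f)" "branch1_adj (right_op j f) = right_op j (branch1_adj f)"
  "from_hub (right_op j f) = right_op j (from_hub f)" "to_hub (right_op j f) = right_op j (to_hub f)"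
  "hub_weight (right_op j f) = right_op j (hub_weight f)" "hub_weight_inv (right_op j f) = right_op j (hub_weight_inv f)"
  "hub_proj (right_op j f) = right_op j (hub_proj f)" "leaf_proj (right_op j f) = right_op j (leaf_proj f)"
  by (rule eq_by_coords; simp add: prim_defs)+

lemma right_op_commutes_hub_sign: "hub_sign (right_op j f) = right_op j (hub_sign f)"
proof -
  have "hub_sign (right_op j f) n = right_op j (hub_sign f) n" for n
    using fun_cong[OF left_right_commute[of "site n" j f], of n] by (auto simp: hub_sign_def right_op_def)
  then show ?thesis by blast
qed

lemma right_op_linear:
  "right_op j (\<lambda>n. f n + g n) = (\<lambda>n. right_op j f n + right_op j g n)"
  "right_op j (\<lambda>n. f n - g n) = (\<lambda>n. right_op j f n - right_op j g n)"
  "right_op j (\<lambda>n. c * f n) = (\<lambda>n. c * right_op j f n)"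
  by (simp_all add: right_op_def algebra_simps)

lemma right_op_commutes_rows:
  "row3 (right_op j f) = right_op j (row3 f)" "col3 \<kappa> (right_op j f) = right_op j (col3 \<kappa> f)"
  "row4 \<kappa> (right_op j f) = right_op j (row4 \<kappa> f)" "col4 \<kappa> (right_op j f) = right_op j (col4 \<kappa> f)"
  unfolding row3_def col3_def row4_def col4_def
  by (simp_all only: right_op_linear right_op_commutes_prims right_op_commutes_hub_sign)

lemma right_op_commutes_gens_3_4_5:
  "gen3 \<kappa> (right_op j f) = right_op j (gen3 \<kappa> f)" "gen4 \<kappa> (right_op j f) = right_op j (gen4 \<kappa> f)"
  "gen5 x (right_op j f) = right_op j (gen5 x f)"
  unfolding gen3_def gen4_def gen5_def
  by (simp_all only: right_op_linear right_op_commutes_prims right_op_commutes_rows)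

lemma right_op_commutes_gens345: "gens345 \<kappa> (right_op j f) = right_op j (gens345 \<kappa> f)"
  unfolding gens345_def by (simp only: right_op_linear right_op_commutes_gens_3_4_5)

lemma right_op_commutes_gens_1_2:
  "gen1 \<kappa> (right_op j f) = right_op j (gen1 \<kappa> f)" "gen2 \<kappa> (right_op j f) = right_op j (gen2 \<kappa> f)"
  unfolding gen1_def gen2_def
  by (simp_all only: right_op_linear right_op_commutes_prims right_op_commutes_gens345)

lemmas right_op_commutes_gens = right_op_commutes_gens_1_2 right_op_commutes_gens_3_4_5

section \<open>Left and right multiplications far away\<close>

lemma bit_bound: "bit g j \<Longrightarrow> j < g" for g j :: nat
proof (rule ccontr)
  assume b: "bit g j" and "\<not> j < g"
  then have "g < 2 ^ j" using less_exp[of j] by linarith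
  then have "g div 2 ^ j = 0" by simp
  with b show False by (simp add: bit_iff_odd)
qed

text \<open>Finitely many bit flips connect every number with 0.\<close>

lemma flip_induct:
  fixes P :: "nat \<Rightarrow> bool"
  assumes zero: "P 0" and flip: "\<And>j g. P (flip_bit j g) \<Longrightarrow> P g"
  shows "P g"
proof -
  have "P g" if "\<forall>j\<ge>m. \<not> bit g j" for m g
    using that
  proof (induction m arbitrary: g)
    case 0
    then have "g = 0" by (intro bit_eqI) simp
    then show ?case using zero by simp
  next
    case (Suc m)
    show ?case
    proof (cases "bit g m")
      case True
      then have "\<forall>j\<ge>m. \<not> bit (flip_bit m g) j" using Suc.prems True by (metis bit_flip Suc_leI le_neq_implies_less)
      from flip[OF Suc.IH[OF this]] show ?thesis .
    next
      case False
      then have "\<forall>j\<ge>m. \<not> bit g j" using Suc.prems False by (metis Suc_leI le_neq_implies_less)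
      from Suc.IH[OF this] show ?thesis .
    qed
  qed
  then show ?thesis using bit_bound by (metis not_less)
qed

text \<open>The left and the right multiplication with the same index compose to a diagonal operator
  that reads off the bit with the partner index; together these operators see all bits.\<close>

lemma sign_separates:
  assumes "g \<noteq> g'"
  obtains j where "left_sign j g * right_sign j g \<noteq> left_sign j g' * right_sign j g'"
proof -
  obtain b where b: "bit g b \<noteq> bit g' b" using assms bit_eq_iff by blast
  show thesis
  proof (cases "even b")
    case True
    with b show thesis using that[of "b + 1"] by (auto simp: left_sign_def right_sign_def split: if_splits)
  next
    case False
    then obtain j where "b = j + 1" "even j" by (metis even_plus_one_iff odd_pos Suc_eq_plus1 Suc_pred)
    with b show thesis using that[of j] by (auto simp: left_sign_def right_sign_def split: if_splits)
  qed
qed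

lemma left_op_involution: "left_op j (left_op j f) = f"
  by (rule eq_by_coords) (simp_all add: prim_defs)

lemma right_op_involution: "right_op j (right_op j f) = f"
  by (rule eq_by_coords) (simp_all add: prim_defs)

lemma left_op_closed: "f \<in> carrier l2 \<Longrightarrow> left_op j f \<in> carrier l2"
  by (rule blin_closed[OF adj_pairD(1)[OF adj_pair_left_op]])

lemma right_op_closed: "f \<in> carrier l2 \<Longrightarrow> right_op j f \<in> carrier l2"
  by (rule blin_closed[OF adj_pairD(1)[OF adj_pair_right_op]])

lemma hnorm_left_op: "f \<in> carrier l2 \<Longrightarrow> hnorm l2 (left_op j f) = hnorm l2 f"
  using adj_pairD(3)[OF adj_pair_left_op, of f "left_op j f" j] left_op_closed[of f j]
  by (simp add: hnorm_def left_op_involution)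

lemma hnorm_right_op: "f \<in> carrier l2 \<Longrightarrow> hnorm l2 (right_op j f) = hnorm l2 f"
  using adj_pairD(3)[OF adj_pair_right_op, of f "right_op j f" j] right_op_closed[of f j]
  by (simp add: hnorm_def right_op_involution)

lemma right_op_anticommute:
  assumes "even m" shows "right_op m (right_op (m + 1) f) = (\<lambda>n. - right_op (m + 1) (right_op m f) n)"
  using assms by (intro eq_by_coords) (simp_all add: prim_defs right_sign_def flip_commute)

text \<open>Left and right multiplication agree on vectors that do not involve the tensor factor in
  question: in both cases the sign is decided by a bit that is 0.\<close>

lemma left_op_eq_right_op:
  assumes "even m" "j = m \<or> j = m + 1" and F: "\<And>n. n \<in> F \<Longrightarrow> \<not> bit (bits n) m \<and> \<not> bit (bits n) (m + 1)"
  shows "left_op j (trunc F f) = right_op j (trunc F f)"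
proof
  fix n
  let ?n = "pt (hub n) (site n) (flip_bit j (bits n))"
  show "left_op j (trunc F f) n = right_op j (trunc F f) n"
  proof (cases "?n \<in> F")
    case True
    from F[OF True] have "left_sign j (bits n) = right_sign j (bits n)"
      using assms(1,2) by (auto simp: left_sign_def right_sign_def split: if_splits)
    then show ?thesis by (simp add: left_op_def right_op_def)
  qed (simp add: left_op_def right_op_def trunc_def)
qed

text \<open>Every vector is up to a small tail a vector as in the preceding lemma, once \<open>m\<close> is large
  enough.\<close>

lemma left_op_near_right_op:
  assumes "even m" "j = m \<or> j = m + 1" and F: "\<And>n. n \<in> F \<Longrightarrow> \<not> bit (bits n) m \<and> \<not> bit (bits n) (m + 1)"
    and f: "f \<in> carrier l2"
  shows "hnorm l2 (\<lambda>n. left_op j f n - right_op j f n) \<le> 2 * hnorm l2 (trunc (- F) f)"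
proof -
  let ?t = "trunc (- F) f"
  have t: "?t \<in> carrier l2" by (rule trunc_closed[OF f])
  have "f = (\<lambda>n. trunc F f n + ?t n)" by (auto simp: trunc_def)
  then have "left_op j f = (\<lambda>n. left_op j (trunc F f) n + left_op j ?t n)"
    "right_op j f = (\<lambda>n. right_op j (trunc F f) n + right_op j ?t n)"
    using blin_add[OF adj_pairD(1)[OF adj_pair_left_op[of j]] trunc_closed[OF f, of F] t]
      blin_add[OF adj_pairD(1)[OF adj_pair_right_op[of j]] trunc_closed[OF f, of F] t] by metis+
  then have "(\<lambda>n. left_op j f n - right_op j f n) = (\<lambda>n. left_op j ?t n + - right_op j ?t n)"
    using left_op_eq_right_op[where F = F and f = f, OF assms(1-3)] by simp
  then show ?thesis
    using hnorm_l2_triangle[OF left_op_closed[OF t] l2_uminus_closed[OF right_op_closed[OF t]], of j j]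
    by (simp add: hnorm_left_op[OF t] hnorm_right_op[OF t] hnorm_l2_uminus[OF right_op_closed[OF t]])
qed

section \<open>A factor without abelian projections\<close>

lemma one_BH_nonzero: "\<one>\<^bsub>BH (l2 :: ('i \<Rightarrow> complex) hilbert)\<^esub> \<noteq> \<zero>\<^bsub>BH l2\<^esub>"
proof
  fix i :: 'i
  assume "\<one>\<^bsub>BH (l2 :: ('i \<Rightarrow> complex) hilbert)\<^esub> = \<zero>\<^bsub>BH l2\<^esub>"
  then have "\<one>\<^bsub>BH l2\<^esub> (basis_vec i) i = \<zero>\<^bsub>BH l2\<^esub> (basis_vec i) i" by simp
  then have "basis_vec i i = 0" by simp
  then show False by (simp add: basis_vec_def)
qed

lemma scalar_in_bicommutant:
  fixes A :: "(('i \<Rightarrow> complex) \<Rightarrow> 'i \<Rightarrow> complex) set"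
  shows "c \<odot>\<^bsub>BH l2\<^esub> \<one>\<^bsub>BH l2\<^esub> \<in> commutant l2 (commutant l2 A)"
proof -
  have "restrict (\<lambda>f i. c * f i) (carrier l2) \<in> commutant l2 (commutant l2 A)"
    by (rule in_vna_restrict[OF in_vna_scale[OF in_vna_id]])
  moreover have "restrict (\<lambda>f i. c * f i) (carrier l2) = c \<odot>\<^bsub>BH (l2 :: ('i \<Rightarrow> complex) hilbert)\<^esub> \<one>\<^bsub>BH l2\<^esub>"
    by (simp cong: restrict_cong)
  ultimately show ?thesis by (simp only:)
qed

text \<open>The right multiplications are the elements of the commutant against which elements of the
  generated algebra are tested.\<close>

locale clifford_generated = generated +
  assumes right_ops: "restrict (right_op j) (carrier l2) \<in> commutant l2 A"
begin

abbreviation N where "N \<equiv> commutant l2 (commutant l2 A)"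

lemma commutes_right_op:
  assumes "T \<in> N" "f \<in> carrier l2" shows "T (right_op j f) = right_op j (T f)"
proof -
  have "commutes T (restrict (right_op j) (carrier l2))" "blin T"
    using assms(1) right_ops by (auto simp: mem_commutant_l2 bounded_op_l2)
  then show ?thesis using assms(2) blin_closed[of T f] by (auto simp: commutes_def)
qed

text \<open>A central operator commutes both with the sector projections and with the compositions of
  left and right multiplications. These diagonal operators jointly separate the basis
  vectors.\<close>

lemma central_off_diagonal:
  assumes N: "T \<in> N" and M: "T \<in> commutant l2 A" and "n \<noteq> i"
  shows "T (basis_vec i) n = 0"
proof (cases "(hub n, site n) = (hub i, site i)")
  case False
  let ?s = "trunc (sector (hub i, site i))"
  have "?s (basis_vec i) = basis_vec i" by (auto simp: trunc_def basis_vec_def)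
  then have "T (basis_vec i) = ?s (T (basis_vec i))"
    using in_vnaD(3)[OF sector_in M basis_vec_closed] by metis
  then have "T (basis_vec i) n = ?s (T (basis_vec i)) n" by (rule fun_cong)
  with False show ?thesis by (auto simp: trunc_def split: if_splits)
next
  case True
  have "bits n \<noteq> bits i"
  proof
    assume "bits n = bits i"
    with True have "pt (hub n) (site n) (bits n) = pt (hub i) (site i) (bits i)" by simp
    with \<open>n \<noteq> i\<close> show False by simp
  qed
  then obtain j where j: "left_sign j (bits n) * right_sign j (bits n) \<noteq> left_sign j (bits i) * right_sign j (bits i)"
    by (rule sign_separates)
  define z where "z f = left_op j (right_op j f)" for f
  have z: "z f n = left_sign j (bits n) * right_sign j (bits n) * f n" for f n
    by (simp add: z_def left_op_def right_op_def)
  have bT: "blin T" using N by (simp add: mem_commutant_l2 bounded_op_l2)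
  have "T (z (basis_vec i)) = z (T (basis_vec i))"
    unfolding z_def using in_vnaD(3)[OF left_op_in M right_op_closed[OF basis_vec_closed]]
      commutes_right_op[OF N basis_vec_closed] by simp
  moreover have "z (basis_vec i) = (\<lambda>n. (left_sign j (bits i) * right_sign j (bits i)) * basis_vec i n)"
    by (auto simp: z basis_vec_def)
  ultimately have "(\<lambda>n. (left_sign j (bits i) * right_sign j (bits i)) * T (basis_vec i) n) = z (T (basis_vec i))"
    using blin_smult[OF bT basis_vec_closed] by metis
  from fun_cong[OF this, of n] show ?thesis using j unfolding z by auto
qed

text \<open>The diagonal entries of a central operator agree along bit flips, along matrix units between
  hubs and along the matching of hubs and leaves.\<close>

lemma central_is_scalar:
  assumes N: "T \<in> N" and M: "T \<in> commutant l2 A"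
  obtains c where "T = c \<odot>\<^bsub>BH l2\<^esub> \<one>\<^bsub>BH l2\<^esub>"
proof -
  have bT: "bounded_op l2 T" "blin T" using N by (auto simp: mem_commutant_l2 bounded_op_l2)
  define T' where "T' = op_adjoint l2 T"
  have T': "T' \<in> N" "T' \<in> commutant l2 A"
    using N M commutant_star_closed[OF A] commutant_star_closed[OF commutant_star_closed[OF A]]
    by (auto simp: star_closed_def T'_def)
  have TT': "adj_pair T T'" unfolding T'_def by (rule adj_pair_op_adjoint[OF bT(2)])
  define c where "c n = cnj (T' (basis_vec n) n)" for n
  have T: "T f n = c n * f n" if f: "f \<in> carrier l2" for f n
  proof -
    have "T' (basis_vec n) = (\<lambda>m. cnj (c n) * basis_vec n m)"
      using central_off_diagonal[OF T'] by (auto simp: c_def basis_vec_def)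
    then show ?thesis using adj_pair_coord[OF TT' f, of n] by (simp add: l2_cinner_smult_right)
  qed
  have swap: "c n = c m" if S: "in_vna A S" and "S (basis_vec m) n \<noteq> 0"
      and loc: "\<And>f. S f n = a * f m" for S n m a
  proof -
    have "T (S (basis_vec m)) n = S (T (basis_vec m)) n" using in_vnaD(3)[OF S M basis_vec_closed] by simp
    then have "c n * S (basis_vec m) n = a * T (basis_vec m) m"
      using T[OF blin_closed[OF in_vna_blin[OF S] basis_vec_closed]] loc by simp
    then show ?thesis using that(2) T[OF basis_vec_closed, of m m] unfolding loc by (simp add: basis_vec_def)
  qed
  have flip: "c (pt True 0 g) = c (pt True 0 (flip_bit j g))" for j g
    by (rule swap[OF left_op_in[of j]]) (auto simp: left_op_def basis_vec_def)
  have "c (pt True 0 g) = c (pt True 0 0)" for g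
    by (rule flip_induct[where P = "\<lambda>g. c (pt True 0 g) = c (pt True 0 0)"]) (use flip in auto)
  moreover have "c (pt True k g) = c (pt True 0 g)" for k g
    by (rule swap[OF move_in[of k 0], where a = 1]) (auto simp: move_def basis_vec_def)
  moreover have "c (pt False k g) = c (pt True k g)" for k g
    by (rule swap[OF from_hub_in, where a = 1]) (auto simp: from_hub_def basis_vec_def)
  ultimately have "c (pt (hub n) (site n) (bits n)) = c (pt True 0 0)" for n by (cases "hub n") metis+
  then have "c n = c (pt True 0 0)" for n by simp
  then have "T f = (\<lambda>n. c (pt True 0 0) * f n)" if "f \<in> carrier l2" for f using T[OF that] by (metis ext)
  then have "T = c (pt True 0 0) \<odot>\<^bsub>BH l2\<^esub> \<one>\<^bsub>BH l2\<^esub>"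
    using bT(1) by (intro extensionalityI[of _ "carrier l2"]) (auto simp: bounded_op_l2)
  then show thesis by (rule that)
qed

lemma factor_on_N: "factor_on l2 N"
  unfolding factor_on_def
proof (intro conjI one_BH_nonzero von_neumann_algebra_bicommutant A equalityI subsetI)
  fix T assume "T \<in> N \<inter> commutant l2 N"
  then have "T \<in> N" "T \<in> commutant l2 A" using commutant_triple[OF A] by auto
  then show "T \<in> {c \<odot>\<^bsub>BH l2\<^esub> \<one>\<^bsub>BH l2\<^esub> | c. True}" using central_is_scalar by blast
next
  fix T assume "T \<in> {c \<odot>\<^bsub>BH (l2 :: (nat \<Rightarrow> complex) hilbert)\<^esub> \<one>\<^bsub>BH l2\<^esub> | c. True}"
  then obtain c where "T = c \<odot>\<^bsub>BH (l2 :: (nat \<Rightarrow> complex) hilbert)\<^esub> \<one>\<^bsub>BH l2\<^esub>" by blast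
  then show "T \<in> N \<inter> commutant l2 N"
    using scalar_in_bicommutant[of c A] scalar_in_bicommutant[of c "commutant l2 A"] by blast
qed

text \<open>The vector \<open>h\<close> is fixed by \<open>p\<close> and \<open>p\<close> commutes with the right multiplications. Replacing
  the left multiplications one after the other by right ones, which move past \<open>p\<close> and past
  the remaining left ones, turns the product of compressions into the product of right
  multiplications in the opposite order. Each replacement costs at most \<open>d\<close> before \<open>p\<close> is
  applied.\<close>

lemma compressed_products_near:
  assumes p: "p \<in> N" and h: "h \<in> carrier l2" "p h = h"
    and K: "0 \<le> K" "\<And>f. f \<in> carrier l2 \<Longrightarrow> hnorm l2 (p f) \<le> K * hnorm l2 f"
    and d: "hnorm l2 (\<lambda>n. left_op i h n - right_op i h n) \<le> d" "hnorm l2 (\<lambda>n. left_op j h n - right_op j h n) \<le> d"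
  shows "hnorm l2 (\<lambda>n. p (left_op i (p (left_op j h))) n - right_op j (right_op i h) n) \<le> (K + K * K) * d"
proof -
  have bp: "blin p" using p by (simp add: mem_commutant_l2 bounded_op_l2)
  have bu: "blin (left_op i)" for i by (rule adj_pairD(1)[OF adj_pair_left_op])
  have br: "blin (right_op i)" for i by (rule adj_pairD(1)[OF adj_pair_right_op])
  define e1 where "e1 = (\<lambda>n. left_op j h n - right_op j h n)"
  define e2 where "e2 = (\<lambda>n. left_op i h n - right_op i h n)"
  have e: "e1 \<in> carrier l2" "e2 \<in> carrier l2"
    unfolding e1_def e2_def using h(1) by (simp_all add: left_op_closed right_op_closed)
  have r: "p (right_op k h) = right_op k h" for k using commutes_right_op[OF p h(1)] h(2) by simp
  have rr: "p (right_op j (right_op i h)) = right_op j (right_op i h)"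
    using commutes_right_op[OF p right_op_closed[OF h(1)]] r by simp
  note cl = h(1) e right_op_closed left_op_closed blin_closed[OF bp]
  have "left_op j h = (\<lambda>n. right_op j h n + e1 n)" by (simp add: e1_def)
  then have "p (left_op j h) = (\<lambda>n. right_op j h n + p e1 n)"
    using blin_add[OF bp, of "right_op j h" e1] by (simp add: cl r)
  then have "left_op i (p (left_op j h)) = (\<lambda>n. left_op i (right_op j h) n + left_op i (p e1) n)"
    using blin_add[OF bu, of "right_op j h" "p e1"] by (simp add: cl)
  also have "left_op i (right_op j h) = right_op j (left_op i h)" by (rule left_right_commute)
  also have "left_op i h = (\<lambda>n. right_op i h n + e2 n)" by (simp add: e2_def)
  also have "right_op j (\<lambda>n. right_op i h n + e2 n) = (\<lambda>n. right_op j (right_op i h) n + right_op j e2 n)"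
    by (rule right_op_linear(1))
  finally have "p (left_op i (p (left_op j h)))
      = (\<lambda>n. (right_op j (right_op i h) n + p (right_op j e2) n) + p (left_op i (p e1)) n)"
    using blin_add[OF bp, of "\<lambda>n. right_op j (right_op i h) n + right_op j e2 n" "left_op i (p e1)"]
      blin_add[OF bp, of "right_op j (right_op i h)" "right_op j e2"] by (simp add: cl rr)
  then have "(\<lambda>n. p (left_op i (p (left_op j h))) n - right_op j (right_op i h) n)
      = (\<lambda>n. p (right_op j e2) n + p (left_op i (p e1)) n)" by simp
  then have "hnorm l2 (\<lambda>n. p (left_op i (p (left_op j h))) n - right_op j (right_op i h) n)
     \<le> hnorm l2 (p (right_op j e2)) + hnorm l2 (p (left_op i (p e1)))"
    using hnorm_l2_triangle[of "p (right_op j e2)" "p (left_op i (p e1))"] by (simp add: cl)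
  also have "\<dots> \<le> K * hnorm l2 e2 + K * hnorm l2 (p e1)"
    using K(2)[OF right_op_closed[OF e(2)], of j] K(2)[OF left_op_closed[OF blin_closed[OF bp e(1)]], of i]
    by (simp add: hnorm_right_op e hnorm_left_op blin_closed[OF bp])
  also have "\<dots> \<le> K * d + K * (K * d)"
    using d K(1) order_trans[OF K(2)[OF e(1)] mult_left_mono[of _ d K]] unfolding e1_def[symmetric] e2_def[symmetric]
    by (intro add_mono mult_left_mono) auto
  finally show ?thesis by (simp add: algebra_simps)
qed

text \<open>If \<open>p\<close> is not zero, then the compressions of the two left multiplications in a far away
  tensor factor act on \<open>h = p f\<close> almost like two anticommuting unitary operators. So they do
  not commute.\<close>

lemma abelian_projection_zero:
  assumes "abelian_projection l2 N p" shows "p = \<zero>\<^bsub>BH l2\<^esub>"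
proof (rule ccontr)
  assume nz: "p \<noteq> \<zero>\<^bsub>BH l2\<^esub>"
  have p: "p \<in> N" "compose (carrier l2) p p = p"
    using assms by (auto simp: abelian_projection_def projections_def)
  have bp: "bounded_op l2 p" "blin p" using p(1) by (auto simp: mem_commutant_l2 bounded_op_l2)
  have pp: "p (p f) = p f" if "f \<in> carrier l2" for f
    using fun_cong[OF p(2), of f] that by (simp add: compose_def)
  have "\<exists>f\<in>carrier l2. p f \<noteq> (\<lambda>i. 0)"
  proof (rule ccontr)
    assume "\<not> ?thesis"
    then have "p = \<zero>\<^bsub>BH l2\<^esub>"
      using bp(1) by (intro extensionalityI[of _ "carrier l2"]) (auto simp: bounded_op_l2)
    with nz show False ..
  qed
  then obtain f where f: "f \<in> carrier l2" "p f \<noteq> (\<lambda>i. 0)" by blast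
  define h where "h = p f"
  have h: "h \<in> carrier l2" "p h = h" "0 < hnorm l2 h"
    using f blin_closed[OF bp(2) f(1)] pp[OF f(1)] hnorm_l2_eq_0D[of h] hnorm_l2_nonneg[of h]
    by (auto simp: h_def less_le)
  obtain K where K: "0 \<le> K" "\<And>f. f \<in> carrier l2 \<Longrightarrow> hnorm l2 (p f) \<le> K * hnorm l2 f"
    using blin_bound[OF bp(2)] by blast
  \<comment> \<open>Commuting compressions would give \<open>2 \<parallel>h\<parallel> \<le> 4 (K + K\<^sup>2) \<tau>\<close> with the norm \<open>\<tau>\<close> of the tail of \<open>h\<close>; the tail is made smaller than \<open>\<parallel>h\<parallel> / L\<close>.\<close>
  define L where "L = 4 * (K + K * K) + 1"
  have L: "L > 0" using K(1) by (simp add: L_def add_nonneg_pos)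
  obtain F where F: "finite F" "hnorm l2 (trunc (- F) h) < hnorm l2 h / L"
    using l2_small_tail[OF h(1), of "hnorm l2 h / L"] h(3) L by auto
  \<comment> \<open>An even bound for the positions of all nonzero bits that occur in \<open>F\<close>.\<close>
  define m where "m = 2 * (\<Sum>n\<in>F. bits n)"
  have bits: "\<not> bit (bits n) m \<and> \<not> bit (bits n) (m + 1)" if "n \<in> F" for n
  proof -
    have "bits n \<le> (\<Sum>n\<in>F. bits n)" using F(1) that by (intro member_le_sum) auto
    then have "bits n \<le> m" by (simp add: m_def)
    then show ?thesis using bit_bound[of "bits n"] by (metis not_less le_add1 order_trans)
  qed
  have m: "even m" by (simp add: m_def)
  define d where "d = 2 * hnorm l2 (trunc (- F) h)"
  have dm: "hnorm l2 (\<lambda>n. left_op m h n - right_op m h n) \<le> d"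
       "hnorm l2 (\<lambda>n. left_op (m + 1) h n - right_op (m + 1) h n) \<le> d"
    unfolding d_def using left_op_near_right_op[OF m _ bits h(1)] by blast+
  let ?u = "left_op m" and ?v = "left_op (m + 1)" and ?r = "right_op m" and ?s = "right_op (m + 1)"
  define a where "a = p (?u (p (?v h)))"
  have comm: "a = p (?v (p (?u h)))"
  proof -
    let ?U = "restrict ?u (carrier l2)" and ?V = "restrict ?v (carrier l2)"
    let ?c = "compose (carrier l2)"
    have "?U \<in> N" "?V \<in> N" by (rule in_vna_restrict[OF left_op_in])+
    then have "?c (?c (?c p ?U) p) (?c (?c p ?V) p) = ?c (?c (?c p ?V) p) (?c (?c p ?U) p)"
      using assms unfolding abelian_projection_def BH_l2_simps by blast
    from fun_cong[OF this, of h] show ?thesis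
      using h blin_closed[OF bp(2)] left_op_closed pp by (simp add: compose_def a_def)
  qed
  have a: "a \<in> carrier l2" unfolding a_def using h blin_closed[OF bp(2)] left_op_closed by simp
  have 1: "hnorm l2 (\<lambda>n. a n - ?s (?r h) n) \<le> (K + K * K) * d"
    unfolding a_def by (rule compressed_products_near[OF p(1) h(1,2) K dm])
  have 2: "hnorm l2 (\<lambda>n. a n - ?r (?s h) n) \<le> (K + K * K) * d"
    unfolding comm by (rule compressed_products_near[OF p(1) h(1,2) K dm(2,1)])
  have "2 * hnorm l2 h = hnorm l2 (\<lambda>n. 2 * ?r (?s h) n)"
    using h(1) by (simp add: hnorm_l2_smult hnorm_right_op right_op_closed)
  also have "(\<lambda>n. 2 * ?r (?s h) n) = (\<lambda>n. (a n - ?s (?r h) n) + - (a n - ?r (?s h) n))"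
    using right_op_anticommute[OF m, of h] by (simp add: fun_eq_iff)
  also have "hnorm l2 \<dots> \<le> (K + K * K) * d + (K + K * K) * d"
  proof -
    have cl: "(\<lambda>n. a n - ?s (?r h) n) \<in> carrier l2" "(\<lambda>n. a n - ?r (?s h) n) \<in> carrier l2"
      using a h(1) by (simp_all add: right_op_closed)
    show ?thesis
      using order_trans[OF hnorm_l2_triangle[OF cl(1) l2_uminus_closed[OF cl(2)]] add_mono[OF 1]] 2
      unfolding hnorm_l2_uminus[OF cl(2)] by blast
  qed
  also have "\<dots> = 4 * (K + K * K) * hnorm l2 (trunc (- F) h)" by (simp add: d_def)
  also have "\<dots> \<le> L * hnorm l2 (trunc (- F) h)"
    unfolding L_def using h(1) by (intro mult_right_mono) auto
  also have "\<dots> < hnorm l2 h" using F(2) L by (simp add: field_simps)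
  finally show False using h(3) by simp
qed

text \<open>The unit is a central projection, and the only abelian projection below it is zero.\<close>

lemma not_type_I_N: "\<not> type_I l2 N"
proof
  assume I: "type_I l2 N"
  have one: "\<one>\<^bsub>BH l2\<^esub> = 1 \<odot>\<^bsub>BH l2\<^esub> \<one>\<^bsub>BH (l2 :: (nat \<Rightarrow> complex) hilbert)\<^esub>" by (simp cong: restrict_cong)
  have "\<one>\<^bsub>BH l2\<^esub> \<in> N \<inter> commutant l2 N"
    by (subst one, rule IntI; rule scalar_in_bicommutant)
  moreover have "op_adjoint l2 (\<one>\<^bsub>BH (l2 :: (nat \<Rightarrow> complex) hilbert)\<^esub>) = \<one>\<^bsub>BH l2\<^esub>"
  proof -
    have "adj_pair (\<one>\<^bsub>BH (l2 :: (nat \<Rightarrow> complex) hilbert)\<^esub>) (\<lambda>f. f)"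
      by (rule adj_pair_cong[OF adj_pair_id]) simp_all
    from op_adjoint_eqI[OF this] show ?thesis by simp
  qed
  ultimately have "\<one>\<^bsub>BH l2\<^esub> \<in> projections l2 (N \<inter> commutant l2 N)"
    by (simp add: projections_def compose_def cong: restrict_cong)
  then obtain p where "abelian_projection l2 N p" "p \<noteq> \<zero>\<^bsub>BH l2\<^esub>"
    using I one_BH_nonzero unfolding type_I_def by blast
  then show False using abelian_projection_zero by blast
qed

end

section \<open>The representation\<close>

definition five_idempotents :: "complex \<Rightarrow> nat \<Rightarrow> (nat \<Rightarrow> complex) \<Rightarrow> nat \<Rightarrow> complex" where
  "five_idempotents \<kappa> k =
    (if k = 1 then gen1 \<kappa> else if k = 2 then gen2 \<kappa> else if k = 3 then gen3 \<kappa> else if k = 4 then gen4 \<kappa>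
     else if k = 5 then gen5 ((3 * \<kappa> + 1) / 2) else (\<lambda>f i. 0))"

theorem proposition13:
  fixes lam :: complex and n :: nat
  assumes "n \<ge> 5"
  shows "\<not> type_I_star_algebra (Q_star_algebra n lam)"
proof -
  \<comment> \<open>The five idempotents with parameter \<open>\<kappa>\<close> have the sum \<open>(\<kappa> + 5) / 2\<close>. The remaining generators are sent to zero.\<close>
  define \<kappa> where "\<kappa> = 2 * lam - 5"
  define q where "q = five_idempotents \<kappa>"
  let ?A = "eval_free q ` carrier (free_star_algebra n)"
  have blin_q: "blin (q k)" for k
    unfolding q_def five_idempotents_def
    by (simp add: blin_gen1 blin_gen2 blin_gen3 blin_gen4 blin_gen5 blin_const_zero)
  have idem: "q k (q k f) = q k f" for k f
    unfolding q_def five_idempotents_def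
    by (simp add: gen1_idem gen2_idem gen3_idem gen4_idem gen5_idem)
  have sum: "(\<Sum>k=1..n. q k f i) = lam * f i" if "f \<in> carrier l2" for f i
  proof -
    have "(\<Sum>k=1..n. q k f i) = (\<Sum>k\<in>{1,2,3,4,5}. q k f i)"
      using assms by (intro sum.mono_neutral_right) (auto simp: q_def five_idempotents_def)
    also have "\<dots> = lam * f i"
      using gens_sum[OF that, of \<kappa> i] by (simp add: q_def five_idempotents_def \<kappa>_def add.assoc)
    finally show ?thesis .
  qed
  obtain \<pi> where \<pi>: "\<pi> \<in> star_hom (Q_star_algebra n lam) (BH l2)" "\<pi> ` carrier (Q_star_algebra n lam) = ?A"
    using Q_algebra_representation[OF blin_q idem sum] by blast
  have in_q: "in_vna ?A (q k)" if "k \<in> {1..n}" for k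
    by (rule in_vna_eval_free[OF blin_q that])
  interpret clifford_generated ?A \<kappa>
  proof
    show "star_closed ?A" by (rule star_closed_eval_free[OF blin_q])
    show "in_vna ?A (gen1 \<kappa>)" "in_vna ?A (gen3 \<kappa>)" "in_vna ?A (gen4 \<kappa>)" "in_vna ?A (gen5 ((3 * \<kappa> + 1) / 2))"
      using in_q[of 1] in_q[of 3] in_q[of 4] in_q[of 5] assms by (simp_all add: q_def five_idempotents_def)
    fix j
    have comm: "commutes (right_op j) (q k)" for k
      unfolding q_def five_idempotents_def commutes_def
      by (simp add: right_op_commutes_gens) (simp add: right_op_def)
    show "restrict (right_op j) (carrier l2) \<in> commutant l2 ?A"
    proof (rule commutant_eval_freeI[OF blin_q adj_pairD(1)[OF adj_pair_right_op] comm])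
      fix k show "commutes (right_op j) (op_adjoint l2 (q k))"
        by (rule commutes_adj[OF adj_pair_right_op adj_pair_op_adjoint[OF blin_q] comm])
    qed
  qed
  have vna: "generated_vna (Q_star_algebra n lam) l2 \<pi> = N" by (simp add: generated_vna_def \<pi>(2))
  have "factor_representation (Q_star_algebra n lam) l2 \<pi>"
    unfolding factor_representation_def star_representation_def vna
    using \<pi>(1) separable_hilbert_space_l2 factor_on_N by blast
  moreover have "\<not> type_I_representation (Q_star_algebra n lam) l2 \<pi>"
    unfolding type_I_representation_def vna by (rule not_type_I_N)
  ultimately show ?thesis unfolding type_I_star_algebra_def by blast
qed

end
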